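(* Let $K=\mathbb R$ or $K=\mathbb C$, let $n\ge 2$, let $G=\mathrm{Isom}_+(\mathbf H^n_K)$, let $G/A\cong\partial^2\mathbf H^n_K$ be the space of ordered pairs of distinct boundary points, and let $\Gamma<G$ be a discrete subgroup whose action on $G/A\cong\partial^2\mathbf H^n_K$ is ergodic with respect to the $G$-invariant measure class. Then $$\operatorname{Map}_\Gamma(G/A,G/A)=\operatorname{Map}_G(G/A,G/A)=\operatorname{Aut}_G(G/A)\cong\mathcal N_G(A)/A=\{1,F\},$$ where $F$ denotes the flip $F:(x,y)\mapsto(y,x)$ on $\partial^2\mathbf H^n_K$.
   Context: $\mathbf H^n_K$ is the $n$-dimensional hyperbolic space over $K$ (real or complex hyperbolic space, a rank one symmetric space), $\mathrm{Isom}_+(\mathbf H^n_K)$ its group of orientation preserving isometries, $\partial\mathbf H^n_K$ its boundary at infinity, and $\partial^2\mathbf H^n_K=\partial\mathbf H^n_K\times\partial\mathbf H^n_K\smallsetminus\Delta$, where $\Delta$ is the diagonal. $G$ acts transitively on $\partial^2\mathbf H^n_K$; $A$ denotes the stabilizer in $G$ of a pair of distinct boundary points, so that $\partial^2\mathbf H^n_K\cong G/A$, equipped with its unique $G$-invariant measure class (Haar measure class). For a closed subgroup $L<G$, $\operatorname{Map}_L(G/A,G/A)$ is the set of Borel maps $f:G/A\to G/A$ such that for every $g\in L$, $f(gx)=gf(x)$ for a.e. $x$ in the source, with maps agreeing a.e. identified; the target is viewed as a Borel $L$-space. Equality $\operatorname{Map}_\Gamma=\operatorname{Map}_G$ means that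 the natural injection $\operatorname{Map}_G\to\operatorname{Map}_\Gamma$ is surjective. $\mathcal N_G(A)$ is the normalizer of $A$ in $G$ and $\operatorname{Aut}_G(G/A)$ is the group of $G$-equivariant bijections of $G/A$. An action is ergodic if invariant measurable sets are null or conull. *)

theory Defs
  imports "HOL-Analysis.Analysis" "HOL-Algebra.Algebra"
begin

section \<open>Hyperbolic space over the reals or the complex numbers\<close>

text \<open>
  Throughout, \<open>K\<close> is one of the subfields \<open>\<real>\<close> and \<open>UNIV\<close> of the complex numbers, and
  \<open>n = CARD('n)\<close>. The space \<open>K\<^sup>n\<close> is the set of those vectors of type \<open>complex ^ 'n\<close> all of
  whose coordinates lie in \<open>K\<close>; for \<open>K = \<real>\<close> this is Euclidean n-space with its usual norm.
\<close>

definition Kvec :: "complex set \<Rightarrow> (complex ^ 'n) set" where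
  "Kvec K = {z. \<forall>i. z $ i \<in> K}"

definition herm :: "complex ^ 'n \<Rightarrow> complex ^ 'n \<Rightarrow> complex" where
  "herm z w = (\<Sum>i\<in>UNIV. z $ i * cnj (w $ i))"

text \<open>
  The projective (Klein) ball model: a point \<open>z\<close> of the unit ball of \<open>K\<^sup>n\<close> stands for the line
  spanned by \<open>Z = (z, 1)\<close>, which is negative for the Hermitian form
  \<open>\<langle>Z, W\<rangle> = herm z w - 1\<close> of signature (n,1).  The distance is given by
  \<open>cosh\<^sup>2 d = \<langle>Z, W\<rangle> \<langle>W, Z\<rangle> / (\<langle>Z, Z\<rangle> \<langle>W, W\<rangle>)\<close>.  This normalises the metric to have
  curvature -1 if \<open>K = \<real>\<close> and sectional curvatures in [-4,-1] if \<open>K\<close> is the complex field; the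
  isometry group does not depend on this choice of scale.
\<close>

definition hyp :: "complex set \<Rightarrow> (complex ^ 'n) set" where
  "hyp K = {z \<in> Kvec K. norm z < 1}"

definition hyp_dist :: "complex ^ 'n \<Rightarrow> complex ^ 'n \<Rightarrow> real" where
  "hyp_dist z w =
     arcosh (cmod (1 - herm z w) / (sqrt (1 - (norm z)\<^sup>2) * sqrt (1 - (norm w)\<^sup>2)))"

text \<open>
  The boundary at infinity is the unit sphere of \<open>K\<^sup>n\<close>.
\<close>

definition bdry :: "complex set \<Rightarrow> (complex ^ 'n) set" where
  "bdry K = {z \<in> Kvec K. norm z = 1}"

definition bdry2 :: "complex set \<Rightarrow> ((complex ^ 'n) \<times> (complex ^ 'n)) set" where
  "bdry2 K = {(x, y). x \<in> bdry K \<and> y \<in> bdry K \<and> x \<noteq> y}"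


section \<open>Orientation preserving isometries\<close>

text \<open>
  The standard basis of \<open>complex ^ 'n\<close> over the reals consists of the vectors \<open>axis i 1\<close> and
  \<open>axis i \<i>\<close>; its members lying in \<open>Kvec K\<close> form an orthonormal basis of \<open>K\<^sup>n\<close> over the reals.
  The determinant of a real-linear endomorphism of \<open>K\<^sup>n\<close> is the Leibniz sum for its matrix in
  this basis.
\<close>

definition Kbasis :: "complex set \<Rightarrow> (complex ^ 'n) set" where
  "Kbasis K = Basis \<inter> Kvec K"

definition real_det :: "complex set \<Rightarrow> (complex ^ 'n \<Rightarrow> complex ^ 'n) \<Rightarrow> real" where
  "real_det K L =
     (\<Sum>p | p permutes Kbasis K. of_int (sign p) * (\<Prod>b\<in>Kbasis K. L b \<bullet> p b))"

text \<open>
  Isometries of \<open>hyp K\<close> are smooth, so asking for differentiability excludes none of them.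
  For \<open>K = \<real>\<close> the derivative within \<open>hyp K\<close> is only determined on \<open>K\<^sup>n\<close>, which is all that
  \<open>real_det K\<close> depends on.
\<close>

definition orientation_preserving :: "complex set \<Rightarrow> (complex ^ 'n \<Rightarrow> complex ^ 'n) \<Rightarrow> bool" where
  "orientation_preserving K g \<longleftrightarrow>
     (\<forall>z\<in>hyp K. \<exists>L. (g has_derivative L) (at z within hyp K) \<and> real_det K L > 0)"

definition Isom_plus :: "complex set \<Rightarrow> (complex ^ 'n \<Rightarrow> complex ^ 'n) monoid" where
  "Isom_plus K = (BijGroup (hyp K))
     \<lparr>carrier := {g \<in> Bij (hyp K).
        (\<forall>z\<in>hyp K. \<forall>w\<in>hyp K. hyp_dist (g z) (g w) = hyp_dist z w) \<and>
        orientation_preserving K g}\<rparr>"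

text \<open>
  The topology on the isometry group is that of pointwise convergence, which on isometries
  coincides with the compact-open topology.  On \<open>hyp K\<close> the Euclidean topology is the one
  induced by \<open>hyp_dist\<close>.
\<close>

definition discrete_isometries :: "complex set \<Rightarrow> (complex ^ 'n \<Rightarrow> complex ^ 'n) set \<Rightarrow> bool" where
  "discrete_isometries K \<Gamma> \<longleftrightarrow>
     subtopology (product_topology (\<lambda>_. top_of_set (hyp K)) (hyp K)) \<Gamma> = discrete_topology \<Gamma>"


section \<open>The action on pairs of distinct boundary points\<close>

text \<open>
  An isometry acts on the boundary through its continuous extension to the closed ball.
\<close>

definition bdry_act ::
    "complex set \<Rightarrow> (complex ^ 'n \<Rightarrow> complex ^ 'n) \<Rightarrow> complex ^ 'n \<Rightarrow> complex ^ 'n" where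
  "bdry_act K g \<xi> = Lim (at \<xi> within hyp K) g"

definition act2 ::
    "complex set \<Rightarrow> (complex ^ 'n \<Rightarrow> complex ^ 'n) \<Rightarrow>
     (complex ^ 'n) \<times> (complex ^ 'n) \<Rightarrow> (complex ^ 'n) \<times> (complex ^ 'n)" where
  "act2 K g = map_prod (bdry_act K g) (bdry_act K g)"

text \<open>
  A \<open>G\<close>-invariant measure class on \<open>bdry2 K\<close> is represented by a nonzero sigma-finite Borel
  measure whose null sets are permuted by \<open>G\<close>.  Since \<open>G\<close> is transitive on \<open>bdry2 K\<close>, there is
  exactly one such class, the Haar measure class of \<open>G/A\<close>; all notions below depend on the
  measure only through its class.
\<close>

definition invariant_class ::
    "complex set \<Rightarrow> ((complex ^ 'n) \<times> (complex ^ 'n)) measure \<Rightarrow> bool" where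
  "invariant_class K \<mu> \<longleftrightarrow>
     sets \<mu> = sets (restrict_space borel (bdry2 K)) \<and>
     sigma_finite_measure \<mu> \<and>
     emeasure \<mu> (space \<mu>) \<noteq> 0 \<and>
     (\<forall>g\<in>carrier (Isom_plus K). \<forall>E\<in>null_sets \<mu>. act2 K g ` E \<in> null_sets \<mu>)"

definition ergodic_on ::
    "complex set \<Rightarrow> (complex ^ 'n \<Rightarrow> complex ^ 'n) set \<Rightarrow>
     ((complex ^ 'n) \<times> (complex ^ 'n)) measure \<Rightarrow> bool" where
  "ergodic_on K \<Gamma> \<mu> \<longleftrightarrow>
     (\<forall>E\<in>sets \<mu>. (\<forall>g\<in>\<Gamma>. act2 K g ` E = E) \<longrightarrow>
        E \<in> null_sets \<mu> \<or> space \<mu> - E \<in> null_sets \<mu>)"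


section \<open>Equivariant maps\<close>

definition ae_class :: "'a measure \<Rightarrow> ('a \<Rightarrow> 'a) \<Rightarrow> ('a \<Rightarrow> 'a) set" where
  "ae_class \<mu> f = {h \<in> \<mu> \<rightarrow>\<^sub>M \<mu>. AE x in \<mu>. h x = f x}"

text \<open>
  \<open>Map_eq K \<mu> L\<close> is \<open>Map\<^sub>L(G/A, G/A)\<close>, a set of almost-everywhere classes of Borel maps.
  The classes do not depend on \<open>L\<close>, so for \<open>L \<subseteq> L'\<close> the natural injection from the
  \<open>L'\<close>-equivariant to the \<open>L\<close>-equivariant classes is the inclusion of sets.
\<close>

definition Map_eq ::
    "complex set \<Rightarrow> ((complex ^ 'n) \<times> (complex ^ 'n)) measure \<Rightarrow>
     (complex ^ 'n \<Rightarrow> complex ^ 'n) set \<Rightarrow>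
     ((complex ^ 'n) \<times> (complex ^ 'n) \<Rightarrow> (complex ^ 'n) \<times> (complex ^ 'n)) set set" where
  "Map_eq K \<mu> L =
     ae_class \<mu> ` {f \<in> \<mu> \<rightarrow>\<^sub>M \<mu>. \<forall>g\<in>L. AE x in \<mu>. f (act2 K g x) = act2 K g (f x)}"

definition Aut_eq ::
    "complex set \<Rightarrow> ((complex ^ 'n) \<times> (complex ^ 'n) \<Rightarrow> (complex ^ 'n) \<times> (complex ^ 'n)) monoid" where
  "Aut_eq K = (BijGroup (bdry2 K))
     \<lparr>carrier := {\<phi> \<in> Bij (bdry2 K).
        \<forall>g\<in>carrier (Isom_plus K). \<forall>x\<in>bdry2 K. \<phi> (act2 K g x) = act2 K g (\<phi> x)}\<rparr>"

definition flip :: "complex set \<Rightarrow> (complex ^ 'n) \<times> (complex ^ 'n) \<Rightarrow> (complex ^ 'n) \<times> (complex ^ 'n)" where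
  "flip K = (\<lambda>(x, y)\<in>bdry2 K. (y, x))"

end

theory Submission
  imports Defs
begin

text \<open>
  Let \<open>f\<close> be a \<open>\<Gamma>\<close>-equivariant map on pairs.  If \<open>f (x, y)\<close> is neither \<open>(x, y)\<close> nor \<open>(y, x)\<close>, then one
  of its two entries is a third boundary point, so off the invariant set where \<open>f\<close> is the identity
  or the flip one obtains an equivariant map from pairs to triples of distinct boundary points.  On
  triples \<open>\<Gamma>\<close> acts properly, hence with closed discrete orbits, and ergodicity forces almost all triples
  into one orbit; a triple determines its pair, so a countable orbit of pairs is conull.  But points
  are null, since \<open>G\<close> is transitive on the uncountable set of pairs.  So \<open>f\<close> is almost everywhere the
  identity or the flip.

  No classification of isometries is needed.  With \<open>rho z w = \<bar>1 - herm z w\<bar>\<close>, an isometry satisfies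
  \<open>rho (g z) (g w) = rho z w * conf g z * conf g w\<close> for an explicit positive function \<open>conf g\<close>.  This
  identity gives the continuous extension to the boundary and properness on triples.  Explicit
  isometries, induced by unitary reflections and boosts of signature \<open>(n, 1)\<close>, are used only for
  transitivity on pairs and to see that the stabilizer of a pair fixes no further boundary point.
\<close>

section \<open>The Hermitian form and the metric\<close>

text \<open>Ergodicity enters as a zero-one law over a countable basis of the space of triples: for
  each basic open set the pairs whose triple has a translate in it form a null or a conull set, so
  almost all pairs have triples with the same orbit closure, and properness turns equal closures
  into equal orbits. Equivariance is assumed for each element separately and only almost everywhere.
  Countability of \<open>\<Gamma>\<close> is therefore needed to reach an invariant conull set; it
  is drawn from discreteness, through the finiteness of the set of elements that move 0 by a bounded
  amount. Orientation is the main burden in proving transitivity: \<open>Isom_plus\<close> asks for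
  a positive Jacobian at every point, so its sign has to be constant, multiplicative and stable
  under inverses. Over the complex numbers every unitary reflection in use is the square of another
  one, hence orientation preserving. Over the reals a wrong sign is repaired by a reflection that
  fixes the standard pair, which takes a second coordinate.\<close>

lemma herm_add_left: "herm (x + y) z = herm x z + herm y z"
  by (simp add: herm_def distrib_right sum.distrib)

lemma herm_add_right: "herm x (y + z) = herm x y + herm x z"
  by (simp add: herm_def distrib_left sum.distrib)

lemma herm_diff_left: "herm (x - y) z = herm x z - herm y z"
  by (simp add: herm_def left_diff_distrib sum_subtractf)

lemma herm_diff_right: "herm x (y - z) = herm x y - herm x z"
  by (simp add: herm_def right_diff_distrib sum_subtractf)

lemma herm_uminus_left: "herm (- x) y = - herm x y"
  by (simp add: herm_def sum_negf)



lemma herm_zero_left [simp]: "herm 0 z = 0"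
  by (simp add: herm_def)

lemma herm_zero_right [simp]: "herm z 0 = 0"
  by (simp add: herm_def)

lemma herm_scale_left: "herm (c *s x) y = c * herm x y"
  by (simp add: herm_def sum_distrib_left mult.assoc)

lemma herm_scale_right: "herm x (c *s y) = cnj c * herm x y"
  by (simp add: herm_def sum_distrib_left mult_ac)

lemma cnj_herm: "cnj (herm x y) = herm y x"
  by (simp add: herm_def mult.commute)

lemma Re_herm: "Re (herm x y) = x \<bullet> y"
  by (simp add: herm_def inner_vec_def inner_complex_def)

lemma herm_self: "herm x x = of_real ((norm x)\<^sup>2)"
proof (rule complex_eqI)
  have "Im (herm x x) = - Im (herm x x)"
    using arg_cong[OF cnj_herm[of x x], of Im] by simp
  then show "Im (herm x x) = Im (of_real ((norm x)\<^sup>2))" by simp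
qed (simp add: Re_herm dot_square_norm)

lemma norm_scale: "norm (c *s x) = cmod c * norm (x :: complex ^ 'n)"
  by (simp add: norm_vec_def norm_mult L2_set_right_distrib)

text \<open>Multiplying \<open>x\<close> by the unit scalar \<open>c\<close> makes the product real
  and nonnegative, so the Cauchy-Schwarz inequality of the real inner product applies.\<close>

lemma cmod_herm_le: "cmod (herm x y) \<le> norm x * norm y"
proof (cases "herm x y = 0")
  case False
  define c where "c = cnj (herm x y) / of_real (cmod (herm x y))"
  have c: "cmod c = 1" using False by (simp add: c_def norm_divide)
  have "herm (c *s x) y = of_real (cmod (herm x y))"
    using False complex_norm_square[of "herm x y"]
    by (simp add: herm_scale_left c_def power2_eq_square mult.commute divide_simps)
  then have "cmod (herm x y) = (c *s x) \<bullet> y"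
    by (metis Re_complex_of_real Re_herm)
  also have "\<dots> \<le> norm (c *s x) * norm y" by (rule norm_cauchy_schwarz)
  finally show ?thesis using c by (simp add: norm_scale)
qed simp

lemma bounded_bilinear_herm: "bounded_bilinear (herm :: complex ^ 'n \<Rightarrow> complex ^ 'n \<Rightarrow> complex)"
proof
  show "\<exists>K. \<forall>a b :: complex ^ 'n. norm (herm a b) \<le> norm a * norm b * K"
    by (rule exI[of _ 1]) (simp add: cmod_herm_le)
next
  fix r :: real and a b :: "complex ^ 'n"
  have "r *\<^sub>R a = complex_of_real r *s a" "r *\<^sub>R b = complex_of_real r *s b"
    by (simp_all add: vec_eq_iff complex_eq_iff)
  then show "herm (r *\<^sub>R a) b = r *\<^sub>R herm a b" "herm a (r *\<^sub>R b) = r *\<^sub>R herm a b"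
    by (simp_all add: herm_scale_left herm_scale_right scaleR_conv_of_real)
qed (simp_all add: herm_add_left herm_add_right)

lemmas continuous_on_herm [continuous_intros] =
  bounded_bilinear.continuous_on[OF bounded_bilinear_herm]
lemmas tendsto_herm [tendsto_intros] = bounded_bilinear.tendsto[OF bounded_bilinear_herm]

lemma bounded_bilinear_vec_scale:
  "bounded_bilinear ((*s) :: complex \<Rightarrow> complex ^ 'n \<Rightarrow> complex ^ 'n)"
proof
  show "\<exists>K. \<forall>a (b :: complex ^ 'n). norm (a *s b) \<le> norm a * norm b * K"
    by (rule exI[of _ 1]) (simp add: norm_scale)
qed (simp_all add: vec_eq_iff distrib_left distrib_right)

lemmas continuous_on_vec_scale [continuous_intros] =
  bounded_bilinear.continuous_on[OF bounded_bilinear_vec_scale]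


text \<open>The modulus of the form of signature (n, 1) on the lifts \<open>(z, 1)\<close> and
  \<open>(w, 1)\<close>. Unlike the distance it stays finite and continuous on the closed ball, so
  every passage to the boundary is phrased with it.\<close>

definition rho :: "complex ^ 'n \<Rightarrow> complex ^ 'n \<Rightarrow> real" where
  "rho z w = cmod (1 - herm z w)"



lemma rho_nonneg [simp]: "0 \<le> rho z w"
  by (simp add: rho_def)

lemma continuous_on_rho [continuous_intros]:
  "continuous_on S f \<Longrightarrow> continuous_on S g \<Longrightarrow> continuous_on S (\<lambda>x. rho (f x) (g x))"
  unfolding rho_def by (intro continuous_intros)

lemma tendsto_rho [tendsto_intros]:
  "(f \<longlongrightarrow> a) F \<Longrightarrow> (g \<longlongrightarrow> b) F \<Longrightarrow> ((\<lambda>x. rho (f x) (g x)) \<longlongrightarrow> rho a b) F"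
  unfolding rho_def by (intro tendsto_intros)

lemma rho_self: "norm z \<le> 1 \<Longrightarrow> rho z z = 1 - (norm z)\<^sup>2"
proof -
  assume "norm z \<le> 1"
  then have "(norm z)\<^sup>2 \<le> 1" by (simp add: power_le_one)
  moreover have "1 - herm z z = of_real (1 - (norm z)\<^sup>2)" by (simp add: herm_self)
  ultimately show ?thesis unfolding rho_def by (simp only: norm_of_real)
qed

lemma rho_zero [simp]: "rho z 0 = 1" "rho 0 z = 1"
  by (simp_all add: rho_def)

text \<open>The squared distance is at most \<open>2 - 2 * Re (herm z w)\<close>, and a real part is
  at most the modulus. This is how bounds on \<open>rho\<close> become Euclidean
  convergence.\<close>

lemma norm_diff_rho:
  assumes "norm z \<le> 1" "norm w \<le> 1"
  shows "(norm (z - w))\<^sup>2 \<le> 2 * rho z w"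
proof -
  have "(norm z)\<^sup>2 \<le> 1" "(norm w)\<^sup>2 \<le> 1" using assms by (simp_all add: power_le_one)
  moreover have "(norm (z - w))\<^sup>2 = (norm z)\<^sup>2 + (norm w)\<^sup>2 - 2 * Re (herm z w)"
    by (simp add: Re_herm power2_norm_eq_inner inner_diff_left inner_diff_right inner_commute)
  moreover have "1 - Re (herm z w) \<le> rho z w"
    unfolding rho_def using complex_Re_le_cmod[of "1 - herm z w"] by simp
  ultimately show ?thesis by simp
qed

lemma rho_le_2:
  assumes "norm z \<le> 1" "norm w \<le> 1"
  shows "rho z w \<le> 2"
proof -
  have "rho z w \<le> 1 + norm z * norm w"
    unfolding rho_def using norm_triangle_ineq4[of 1 "herm z w"] cmod_herm_le[of z w] by simp
  moreover have "norm z * norm w \<le> 1 * 1" using assms by (intro mult_mono) auto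
  ultimately show ?thesis by simp
qed

lemma rho_lower: "1 - norm z * norm w \<le> rho z w"
  unfolding rho_def using norm_triangle_ineq2[of 1 "herm z w"] cmod_herm_le[of z w] by simp

lemma rho_pos:
  assumes "norm z \<le> 1" "norm w < 1"
  shows "0 < rho z w"
proof -
  have "norm z * norm w \<le> 1 * norm w" using assms by (intro mult_right_mono) auto
  then show ?thesis using rho_lower[of z w] assms by linarith
qed

lemma rho_eq_0:
  assumes "norm z \<le> 1" "norm w \<le> 1"
  shows "rho z w = 0 \<longleftrightarrow> z = w \<and> norm z = 1"
proof
  assume r: "rho z w = 0"
  then have "z = w" using norm_diff_rho[OF assms] by simp
  then show "z = w \<and> norm z = 1" using r rho_pos[of z w] assms by fastforce
next
  assume "z = w \<and> norm z = 1"
  then show "rho z w = 0" using rho_self[of z] assms by auto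
qed

text \<open>A quantitative reversed Cauchy-Schwarz inequality for signature (n, 1): with
  \<open>v = w - z\<close> the right-hand side is exactly (1 - |z|^2) |v|^2 + |herm z v|^2, and the
  last term is dropped.\<close>

lemma rho_gram: "(1 - (norm z)\<^sup>2) * (norm (z - w))\<^sup>2 \<le> (rho z w)\<^sup>2 - (1 - (norm z)\<^sup>2) * (1 - (norm w)\<^sup>2)"
proof -
  define a where "a = herm z w"
  define v where "v = w - z"
  have w: "w = z + v" by (simp add: v_def)
  have nz: "norm (z - w) = norm v" by (simp add: v_def norm_minus_commute)
  have r: "(rho z w)\<^sup>2 = 1 - 2 * Re a + (cmod a)\<^sup>2"
    unfolding rho_def a_def[symmetric] cmod_power2 by (simp add: power2_eq_square algebra_simps)
  have ha: "a = of_real ((norm z)\<^sup>2) + herm z v"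
    by (simp add: a_def w herm_add_right herm_self)
  have nw: "(norm w)\<^sup>2 = (norm z)\<^sup>2 + 2 * Re (herm z v) + (norm v)\<^sup>2"
    by (simp add: w power2_norm_eq_inner inner_add_left inner_add_right Re_herm inner_commute)
  have ca: "(cmod a)\<^sup>2 = (norm z)^4 + 2 * (norm z)\<^sup>2 * Re (herm z v) + (cmod (herm z v))\<^sup>2"
    unfolding ha cmod_power2 by (simp add: power2_eq_square power4_eq_xxxx algebra_simps)
  have Rea: "Re a = (norm z)\<^sup>2 + Re (herm z v)" by (simp add: ha)
  have "(rho z w)\<^sup>2 - (1 - (norm z)\<^sup>2) * (1 - (norm w)\<^sup>2)
      = (1 - (norm z)\<^sup>2) * (norm v)\<^sup>2 + (cmod (herm z v))\<^sup>2"
    unfolding r nw ca Rea by (simp add: algebra_simps power2_eq_square power4_eq_xxxx)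
  then show ?thesis by (simp add: nz)
qed

text \<open>This is the hyperbolic cosine of \<open>hyp_dist\<close>. On the ball it is at least 1,
  where arcosh is injective, so isometries can be tested on it.\<close>

definition cdist :: "complex ^ 'n \<Rightarrow> complex ^ 'n \<Rightarrow> real" where
  "cdist z w = rho z w / (sqrt (1 - (norm z)\<^sup>2) * sqrt (1 - (norm w)\<^sup>2))"

lemma hyp_dist_cdist: "hyp_dist z w = arcosh (cdist z w)"
  by (simp add: hyp_dist_def cdist_def rho_def)

lemma norm_sq_less_1: "norm (z :: 'a::real_normed_vector) < 1 \<Longrightarrow> (norm z)\<^sup>2 < 1"
  by (simp add: abs_square_less_1)

lemma cdist_square:
  assumes "norm z < 1" "norm w < 1"
  shows "(cdist z w)\<^sup>2 = (rho z w)\<^sup>2 / ((1 - (norm z)\<^sup>2) * (1 - (norm w)\<^sup>2))"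
  using norm_sq_less_1[OF assms(1)] norm_sq_less_1[OF assms(2)]
  by (simp add: cdist_def power_divide power_mult_distrib)

text \<open>Divide \<open>rho_gram\<close> by the product of the two factors 1 - |z|^2 and 1 -
  |w|^2, the second being at most 1. Hyperbolic closeness thus gives Euclidean closeness, as used
  for the continuity of isometries and for discreteness.\<close>

lemma norm_diff_cdist:
  assumes "norm z < 1" "norm w < 1"
  shows "(norm (z - w))\<^sup>2 \<le> (cdist z w)\<^sup>2 - 1"
proof -
  define a b where "a = 1 - (norm z)\<^sup>2" and "b = 1 - (norm w)\<^sup>2"
  have ab: "0 < a" "0 < b" "b \<le> 1"
    using norm_sq_less_1 assms by (auto simp: a_def b_def)
  have "(norm (z - w))\<^sup>2 * b \<le> (norm (z - w))\<^sup>2 * 1"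
    using ab by (intro mult_left_mono) auto
  then have "a * ((norm (z - w))\<^sup>2 * b) \<le> (rho z w)\<^sup>2 - a * b"
    using rho_gram[of z w] ab by (smt (verit) a_def b_def mult_left_mono mult.right_neutral)
  then have "(norm (z - w))\<^sup>2 * (a * b) \<le> (rho z w)\<^sup>2 - a * b" by (simp add: algebra_simps)
  then have "(norm (z - w))\<^sup>2 \<le> ((rho z w)\<^sup>2 - a * b) / (a * b)"
    using ab by (simp add: pos_le_divide_eq)
  also have "\<dots> = (cdist z w)\<^sup>2 - 1"
    using ab cdist_square[OF assms] by (simp add: a_def b_def diff_divide_distrib)
  finally show ?thesis .
qed

lemma cdist_ge_1:
  assumes "norm z < 1" "norm w < 1"
  shows "1 \<le> cdist z w"
proof -
  have "1 \<le> (cdist z w)\<^sup>2" using norm_diff_cdist[OF assms] zero_le_power2[of "norm (z - w)"] by linarith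
  moreover have "0 \<le> cdist z w"
    unfolding cdist_def using norm_sq_less_1[of z] norm_sq_less_1[of w] assms by (intro divide_nonneg_nonneg mult_nonneg_nonneg) auto
  ultimately show ?thesis using power2_le_imp_le[of 1] by simp
qed

lemma hyp_dist_eq_iff:
  assumes "norm z < 1" "norm w < 1" "norm z' < 1" "norm w' < 1"
  shows "hyp_dist z w = hyp_dist z' w' \<longleftrightarrow> cdist z w = cdist z' w'"
  unfolding hyp_dist_cdist using cosh_arcosh_real cdist_ge_1 assms by metis

lemma cdist_self: "norm z < 1 \<Longrightarrow> cdist z z = 1"
  using rho_self[of z] norm_sq_less_1[of z] by (simp add: cdist_def)

lemma tendsto_cdist:
  assumes "(f \<longlongrightarrow> a) F" "(g \<longlongrightarrow> b) F" "norm a < 1" "norm b < 1"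
  shows "((\<lambda>x. cdist (f x) (g x)) \<longlongrightarrow> cdist a b) F"
  unfolding cdist_def using assms norm_sq_less_1[of a] norm_sq_less_1[of b]
  by (intro tendsto_intros) auto

lemma hyp_iff: "z \<in> hyp K \<longleftrightarrow> z \<in> Kvec K \<and> norm z < 1"
  by (simp add: hyp_def)

lemma bdry_iff: "z \<in> bdry K \<longleftrightarrow> z \<in> Kvec K \<and> norm z = 1"
  by (simp add: bdry_def)

section \<open>Extension of isometries to the boundary\<close>

locale hyp_field =
  fixes K :: "complex set"
  assumes K: "K = \<real> \<or> K = UNIV"
begin

lemma K_closed [simp, intro]:
  "0 \<in> K" "1 \<in> K" "of_real r \<in> K"
  "a \<in> K \<Longrightarrow> b \<in> K \<Longrightarrow> a + b \<in> K" "a \<in> K \<Longrightarrow> b \<in> K \<Longrightarrow> a - b \<in> K"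
  "a \<in> K \<Longrightarrow> b \<in> K \<Longrightarrow> a * b \<in> K" "a \<in> K \<Longrightarrow> b \<in> K \<Longrightarrow> a / b \<in> K"
  "a \<in> K \<Longrightarrow> - a \<in> K" "a \<in> K \<Longrightarrow> cnj a \<in> K" "a \<in> K \<Longrightarrow> r *\<^sub>R a \<in> K"
  using K by (auto elim!: Reals_cases simp: scaleR_conv_of_real simp flip: of_real_add of_real_diff of_real_mult of_real_divide of_real_minus)

lemma Kvec_closed [simp, intro]:
  "0 \<in> Kvec K"
  "z \<in> Kvec K \<Longrightarrow> w \<in> Kvec K \<Longrightarrow> z + w \<in> Kvec K"
  "z \<in> Kvec K \<Longrightarrow> w \<in> Kvec K \<Longrightarrow> z - w \<in> Kvec K"
  "z \<in> Kvec K \<Longrightarrow> - z \<in> Kvec K"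
  "c \<in> K \<Longrightarrow> z \<in> Kvec K \<Longrightarrow> c *s z \<in> Kvec K"
  "z \<in> Kvec K \<Longrightarrow> r *\<^sub>R z \<in> Kvec K"
  by (auto simp: Kvec_def)

lemma herm_in_K [simp, intro]: "z \<in> Kvec K \<Longrightarrow> w \<in> Kvec K \<Longrightarrow> herm z w \<in> K"
proof -
  assume *: "z \<in> Kvec K" "w \<in> Kvec K"
  have "(\<Sum>i\<in>A. z $ i * cnj (w $ i)) \<in> K" if "finite A" for A
    using that * by (induction A rule: finite_induct) (auto simp: Kvec_def)
  then show ?thesis by (simp add: herm_def)
qed

lemma closed_K: "closed K"
  using K by (auto intro: closed_complex_Reals)

lemma closed_Kvec: "closed (Kvec K :: (complex ^ 'n) set)"
proof -
  have "Kvec K = (\<Inter>i. (\<lambda>z :: complex ^ 'n. z $ i) -` K)"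
    by (auto simp: Kvec_def)
  moreover have "closed ((\<lambda>z :: complex ^ 'n. z $ i) -` K)" for i
    by (rule closed_vimage[OF closed_K]) (intro continuous_intros)
  ultimately show ?thesis by auto
qed

lemma subspace_Kvec: "subspace (Kvec K :: (complex ^ 'n) set)"
  by (simp add: subspace_def)

lemma zero_hyp [simp, intro]: "0 \<in> hyp K"
  by (simp add: hyp_iff)

lemma hyp_norm: "z \<in> hyp K \<Longrightarrow> norm z < 1"
  by (simp add: hyp_iff)



lemma convex_hyp: "convex (hyp K :: (complex ^ 'n) set)"
proof -
  have "(hyp K :: (complex ^ 'n) set) = Kvec K \<inter> ball 0 1" by (auto simp: hyp_iff)
  then show ?thesis by (simp add: convex_Int subspace_imp_convex[OF subspace_Kvec])
qed

text \<open>Orientation is split off: the boundary theory is the same for all isometries, and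
  orientation reversing ones occur as factors.\<close>

definition hyp_isom :: "(complex ^ 'n \<Rightarrow> complex ^ 'n) \<Rightarrow> bool" where
  "hyp_isom g \<longleftrightarrow> g \<in> Bij (hyp K) \<and> (\<forall>z\<in>hyp K. \<forall>w\<in>hyp K. hyp_dist (g z) (g w) = hyp_dist z w)"

lemma hyp_isomD:
  assumes "hyp_isom g"
  shows "bij_betw g (hyp K) (hyp K)" "g \<in> extensional (hyp K)"
    "z \<in> hyp K \<Longrightarrow> g z \<in> hyp K"
  using assms by (auto simp: hyp_isom_def Bij_def bij_betw_def)

lemma hyp_isom_cdist:
  assumes "hyp_isom g" "z \<in> hyp K" "w \<in> hyp K"
  shows "cdist (g z) (g w) = cdist z w"
  using assms hyp_isomD(3)[OF assms(1)] hyp_dist_eq_iff[of "g z" "g w" z w]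
  by (simp add: hyp_isom_def hyp_norm)

lemma hyp_isomI:
  assumes "g \<in> Bij (hyp K)" "\<And>z w. z \<in> hyp K \<Longrightarrow> w \<in> hyp K \<Longrightarrow> cdist (g z) (g w) = cdist z w"
  shows "hyp_isom g"
  using assms by (simp add: hyp_isom_def hyp_dist_cdist)

text \<open>Restricted to the ball so that it stays in \<open>Bij\<close>;
  \<open>inv_Isom_plus\<close> identifies it with the inverse of the group.\<close>

definition hinv :: "(complex ^ 'n \<Rightarrow> complex ^ 'n) \<Rightarrow> complex ^ 'n \<Rightarrow> complex ^ 'n" where
  "hinv g = (\<lambda>x\<in>hyp K. inv_into (hyp K) g x)"

lemma hinv:
  assumes "hyp_isom g"
  shows "z \<in> hyp K \<Longrightarrow> hinv g z \<in> hyp K" "z \<in> hyp K \<Longrightarrow> g (hinv g z) = z"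
    "z \<in> hyp K \<Longrightarrow> hinv g (g z) = z" "hyp_isom (hinv g)"
proof -
  have b: "g \<in> Bij (hyp K)" "g ` hyp K = hyp K" "inj_on g (hyp K)"
    using assms by (auto simp: hyp_isom_def Bij_def bij_betw_def)
  show 1: "hinv g z \<in> hyp K" if "z \<in> hyp K" for z
    using b that unfolding hinv_def by (simp add: inv_into_into)
  show 2: "g (hinv g z) = z" if "z \<in> hyp K" for z
    using b that unfolding hinv_def by (simp add: f_inv_into_f)
  show "hinv g (g z) = z" if "z \<in> hyp K" for z
    using b that hyp_isomD(3)[OF assms that] unfolding hinv_def by simp
  show "hyp_isom (hinv g)"
  proof (rule hyp_isomI)
    show "hinv g \<in> Bij (hyp K)" unfolding hinv_def by (rule restrict_inv_into_Bij[OF b(1)])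
    show "cdist (hinv g z) (hinv g w) = cdist z w" if "z \<in> hyp K" "w \<in> hyp K" for z w
      using hyp_isom_cdist[OF assms 1 1, of z w] that 2 by simp
  qed
qed

lemma hyp_isom_compose:
  assumes "hyp_isom g" "hyp_isom h"
  shows "hyp_isom (compose (hyp K) g h)"
proof (rule hyp_isomI)
  show "compose (hyp K) g h \<in> Bij (hyp K)" using assms by (simp add: hyp_isom_def compose_Bij)
qed (simp add: compose_def hyp_isom_cdist assms hyp_isomD)

lemma hyp_isom_id: "hyp_isom (\<lambda>x\<in>hyp K. x)"
  by (rule hyp_isomI) (auto simp: id_Bij)

text \<open>For an isometry induced by a form-preserving linear map \<open>M\<close> this equals
  \<open>1 / cmod (den M z)\<close>; the preimage of the centre expresses it without any
  \<open>M\<close>.\<close>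

definition conf :: "(complex ^ 'n \<Rightarrow> complex ^ 'n) \<Rightarrow> complex ^ 'n \<Rightarrow> real" where
  "conf g z = sqrt (1 - (norm (hinv g 0))\<^sup>2) / rho z (hinv g 0)"

text \<open>
  The point \<open>hinv g 0\<close> absorbs the two factors \<open>cdist (g z) 0\<close> and \<open>cdist (g w) 0\<close> in
  \<open>rho = cdist / (cdist _ 0 * cdist _ 0)\<close>; the resulting conformal factor \<open>conf g\<close> still makes
  sense on the sphere, and this is what extends \<open>g\<close> to the boundary without a classification of
  isometries.
\<close>

lemma rho_isom:
  assumes g: "hyp_isom g" and z: "z \<in> hyp K" and w: "w \<in> hyp K"
  shows "rho (g z) (g w) = rho z w * conf g z * conf g w"
proof -
  define p where "p = hinv g 0"
  have p: "p \<in> hyp K" "g p = 0" using hinv[OF g] by (auto simp: p_def)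
  define s where "s = (\<lambda>z :: complex ^ 'a. sqrt (1 - (norm z)\<^sup>2))"
  have s: "s x > 0" if "x \<in> hyp K" for x
    using norm_sq_less_1[OF hyp_norm[OF that]] by (simp add: s_def)
  have gs: "s (g x) = s x * s p / rho x p" if x: "x \<in> hyp K" for x
  proof -
    have "rho (g x) (g p) / (s (g x) * s (g p)) = rho x p / (s x * s p)"
      using hyp_isom_cdist[OF g x p(1)] by (simp add: cdist_def s_def)
    moreover have "s (g x) > 0" "s x > 0" "s p > 0" using s hyp_isomD(3)[OF g] x p by auto
    moreover have "rho x p > 0" using x p by (intro rho_pos) (auto simp: hyp_iff)
    moreover have "s (g p) = 1" using p by (simp add: s_def)
    ultimately show ?thesis using p by (simp add: field_simps)
  qed
  have cf: "conf g x = s p / rho x p" for x by (simp add: conf_def p_def s_def)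
  have pos: "s (g z) > 0" "s (g w) > 0" "s z > 0" "s w > 0" "s p > 0"
    using s hyp_isomD(3)[OF g] z w p by auto
  have "rho (g z) (g w) / (s (g z) * s (g w)) = rho z w / (s z * s w)"
    using hyp_isom_cdist[OF g z w] by (simp add: cdist_def s_def)
  then have "rho (g z) (g w) = rho z w * (s (g z) / s z) * (s (g w) / s w)"
    using pos by (simp add: field_simps)
  also have "s (g z) / s z = conf g z" using pos(3) by (simp add: gs[OF z] cf)
  also have "s (g w) / s w = conf g w" using pos(4) by (simp add: gs[OF w] cf)
  finally show ?thesis .
qed

text \<open>An isometry and its inverse move the centre equally far. In formulas,
  \<open>rho_isom\<close> at the pair (0, 0) says that 1 - |g 0|^2 is the square of
  \<open>conf g 0\<close>, which is the square root of 1 - |hinv g 0|^2.\<close>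

lemma norm_hinv_0:
  assumes g: "hyp_isom g"
  shows "norm (hinv g 0) = norm (g 0)"
proof -
  have "1 - (norm (g 0))\<^sup>2 = (conf g 0)\<^sup>2"
    using rho_isom[OF g zero_hyp zero_hyp] rho_self[of "g 0"] hyp_isomD(3)[OF g zero_hyp]
    by (simp add: hyp_norm less_imp_le power2_eq_square)
  also have "\<dots> = 1 - (norm (hinv g 0))\<^sup>2"
    using norm_sq_less_1[OF hyp_norm[OF hinv(1)[OF g zero_hyp]]] by (simp add: conf_def)
  finally have "(norm (g 0))\<^sup>2 = (norm (hinv g 0))\<^sup>2" by linarith
  then show ?thesis by (simp add: power2_eq_iff_nonneg)
qed

text \<open>On the whole closed ball the denominator of \<open>conf\<close> lies between
  \<open>1 - norm (hinv g 0)\<close> and 2, so the bounds are uniform in \<open>z\<close>.\<close>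

lemma conf_bounds:
  assumes g: "hyp_isom g" and z: "norm z \<le> 1"
  shows "sqrt (1 - (norm (g 0))\<^sup>2) / 2 \<le> conf g z" "0 < conf g z"
    "conf g z \<le> 1 / (1 - norm (g 0))"
proof -
  have n: "norm (hinv g 0) < 1" using hinv(1)[OF g zero_hyp] by (simp add: hyp_norm)
  have r: "rho z (hinv g 0) > 0" "rho z (hinv g 0) \<le> 2"
    using z n by (auto intro: rho_pos rho_le_2)
  have "norm z * norm (hinv g 0) \<le> 1 * norm (hinv g 0)" using z by (intro mult_right_mono) auto
  then have r2: "1 - norm (hinv g 0) \<le> rho z (hinv g 0)" using rho_lower[of z "hinv g 0"] by simp
  have s: "sqrt (1 - (norm (hinv g 0))\<^sup>2) > 0" "sqrt (1 - (norm (hinv g 0))\<^sup>2) \<le> 1"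
    using norm_sq_less_1[OF n] by auto
  show "0 < conf g z" using r s by (simp add: conf_def)
  show "sqrt (1 - (norm (g 0))\<^sup>2) / 2 \<le> conf g z"
    unfolding conf_def norm_hinv_0[OF g, symmetric] using r s by (intro divide_left_mono) auto
  show "conf g z \<le> 1 / (1 - norm (g 0))"
    unfolding conf_def norm_hinv_0[OF g, symmetric] using r r2 s n by (intro frac_le) auto
qed

lemma tendsto_conf:
  assumes g: "hyp_isom g" and z: "norm z \<le> 1" and f: "(f \<longlongrightarrow> z) F"
  shows "((\<lambda>x. conf g (f x)) \<longlongrightarrow> conf g z) F"
  unfolding conf_def
  using rho_pos[OF z hyp_norm[OF hinv(1)[OF g zero_hyp]]] f by (intro tendsto_intros) auto

text \<open>The bound is uniform up to the sphere. As \<open>rho\<close> vanishes on the diagonal of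
  the sphere, points converging to the same boundary point have images that come together.\<close>

lemma norm_diff_isom:
  assumes g: "hyp_isom g" and z: "z \<in> hyp K" and w: "w \<in> hyp K"
  shows "(norm (g z - g w))\<^sup>2 \<le> 2 * (1 / (1 - norm (g 0)))\<^sup>2 * rho z w"
proof -
  let ?C = "1 / (1 - norm (g 0))"
  have "(norm (g z - g w))\<^sup>2 \<le> 2 * rho (g z) (g w)"
    using hyp_isomD(3)[OF g] z w by (intro norm_diff_rho) (auto simp: hyp_iff less_imp_le)
  also have "\<dots> = 2 * (rho z w * (conf g z * conf g w))"
    by (simp add: rho_isom[OF g z w])
  also have "\<dots> \<le> 2 * (rho z w * (?C * ?C))"
    using conf_bounds[OF g, of z] conf_bounds[OF g, of w] z w hyp_norm[OF hyp_isomD(3)[OF g zero_hyp]]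
    by (intro mult_left_mono mult_mono) (auto simp: hyp_iff less_imp_le)
  finally show ?thesis by (simp add: power2_eq_square)
qed

section \<open>Radial approach to the sphere and boundary values of isometries\<close>

definition rad :: "complex ^ 'n \<Rightarrow> nat \<Rightarrow> complex ^ 'n" where
  "rad \<xi> k = (1 - inverse (real (Suc k))) *\<^sub>R \<xi>"

lemma rad:
  assumes "\<xi> \<in> bdry K"
  shows "rad \<xi> k \<in> hyp K" "rad \<xi> k \<noteq> \<xi>" "rad \<xi> \<longlonglongrightarrow> \<xi>"
    "filterlim (rad \<xi>) (at \<xi> within hyp K) sequentially"
proof -
  have e: "\<bar>1 - inverse (real (Suc k))\<bar> < 1" for k
  proof -
    have "0 < inverse (real (Suc k))" "inverse (real (Suc k)) \<le> 1"
      by (auto simp: field_simps)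
    then show ?thesis by linarith
  qed
  show 1: "rad \<xi> k \<in> hyp K" for k using assms e[of k] by (simp add: rad_def hyp_iff bdry_iff)
  show 2: "rad \<xi> k \<noteq> \<xi>" for k using 1[of k] assms by (auto simp: hyp_iff bdry_iff)
  have "(\<lambda>k. (1 - inverse (real (Suc k))) *\<^sub>R \<xi>) \<longlonglongrightarrow> (1 - 0) *\<^sub>R \<xi>"
    by (intro tendsto_intros LIMSEQ_inverse_real_of_nat)
  then show 3: "rad \<xi> \<longlonglongrightarrow> \<xi>" by (simp add: rad_def[abs_def])
  show "filterlim (rad \<xi>) (at \<xi> within hyp K) sequentially"
    using 1 2 3 by (auto simp: filterlim_at)
qed

lemma at_bdry_nontrivial:
  assumes "\<xi> \<in> bdry K" shows "at \<xi> within hyp K \<noteq> bot"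
  using rad(4)[OF assms] by (auto simp: filterlim_def bot_unique filtermap_bot_iff)

text \<open>By \<open>norm_diff_isom\<close> the images along \<open>rad \<xi>\<close> are Cauchy.
  Letting one argument of the same estimate run along \<open>rad \<xi>\<close> bounds the distance
  of \<open>g z\<close> from their limit for every \<open>z\<close> in the ball, so the full limit
  exists. It has norm 1 because \<open>rho_isom\<close> makes \<open>rho\<close> of the image points
  with themselves tend to 0.\<close>

lemma bdry_act_tendsto:
  assumes g: "hyp_isom g" and \<xi>: "\<xi> \<in> bdry K"
  shows "(g \<longlongrightarrow> bdry_act K g \<xi>) (at \<xi> within hyp K)" "bdry_act K g \<xi> \<in> bdry K"
proof -
  define C where "C = 2 * (1 / (1 - norm (g 0)))\<^sup>2"
  define h where "h = (\<lambda>k. g (rad \<xi> k))"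
  have C0: "C \<ge> 0" by (simp add: C_def)
  have r0: "rho \<xi> \<xi> = 0" using \<xi> by (simp add: rho_eq_0 bdry_iff)
  have est: "(norm (g z - g w))\<^sup>2 \<le> C * rho z w" if "z \<in> hyp K" "w \<in> hyp K" for z w
    using norm_diff_isom[OF g that] by (simp add: C_def)
  have "Cauchy h"
  proof (rule metric_CauchyI)
    fix e :: real assume e: "0 < e"
    have "((\<lambda>x. C * rho (fst x) (snd x)) \<longlongrightarrow> C * rho \<xi> \<xi>) (nhds \<xi> \<times>\<^sub>F nhds \<xi>)"
      by (intro tendsto_intros filterlim_fst filterlim_snd)
    then have "((\<lambda>x. C * rho (fst x) (snd x)) \<longlongrightarrow> 0) (nhds \<xi> \<times>\<^sub>F nhds \<xi>)"
      by (simp add: r0)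
    then have "\<forall>\<^sub>F x in nhds \<xi> \<times>\<^sub>F nhds \<xi>. C * rho (fst x) (snd x) < e\<^sup>2"
      using e by (intro order_tendstoD) auto
    then obtain P Q where PQ: "eventually P (nhds \<xi>)" "eventually Q (nhds \<xi>)"
        "\<And>x y. P x \<Longrightarrow> Q y \<Longrightarrow> C * rho x y < e\<^sup>2"
      unfolding eventually_prod_filter by auto
    then have "eventually (\<lambda>k. P (rad \<xi> k) \<and> Q (rad \<xi> k)) sequentially"
      using rad(3)[OF \<xi>] by (simp add: filterlim_iff eventually_conj)
    then obtain M where M: "\<And>k. k \<ge> M \<Longrightarrow> P (rad \<xi> k) \<and> Q (rad \<xi> k)"
      by (auto simp: eventually_sequentially)
    have "dist (h m) (h n) < e" if "m \<ge> M" "n \<ge> M" for m n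
    proof -
      have "(dist (h m) (h n))\<^sup>2 \<le> C * rho (rad \<xi> m) (rad \<xi> n)"
        unfolding h_def dist_norm by (intro est rad \<xi>)
      also have "\<dots> < e\<^sup>2" using PQ(3) M that by blast
      finally show ?thesis using e power2_less_imp_less by fastforce
    qed
    then show "\<exists>M. \<forall>m\<ge>M. \<forall>n\<ge>M. dist (h m) (h n) < e" by blast
  qed
  then obtain l where l: "h \<longlonglongrightarrow> l" using Cauchy_convergent convergent_def by blast
  have lim: "(norm (g z - l))\<^sup>2 \<le> C * rho z \<xi>" if z: "z \<in> hyp K" for z
  proof (rule tendsto_le[OF trivial_limit_sequentially])
    show "(\<lambda>k. C * rho z (rad \<xi> k)) \<longlonglongrightarrow> C * rho z \<xi>"
      by (intro tendsto_intros rad \<xi>)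
    show "(\<lambda>k. (norm (g z - h k))\<^sup>2) \<longlonglongrightarrow> (norm (g z - l))\<^sup>2"
      by (intro tendsto_intros l)
    show "\<forall>\<^sub>F k in sequentially. (norm (g z - h k))\<^sup>2 \<le> C * rho z (rad \<xi> k)"
      unfolding h_def using est[OF z rad(1)[OF \<xi>]] by simp
  qed
  have "((\<lambda>z. C * rho z \<xi>) \<longlongrightarrow> C * rho \<xi> \<xi>) (at \<xi> within hyp K)" by (intro tendsto_intros)
  then have 0: "((\<lambda>z. C * rho z \<xi>) \<longlongrightarrow> 0) (at \<xi> within hyp K)"
    by (simp add: r0)
  have "((\<lambda>z. (norm (g z - l))\<^sup>2) \<longlongrightarrow> 0) (at \<xi> within hyp K)"
    by (rule tendsto_sandwich[OF _ _ tendsto_const 0]) (use lim in \<open>auto simp: eventually_at_filter\<close>)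
  then have "((\<lambda>z. sqrt ((norm (g z - l))\<^sup>2)) \<longlongrightarrow> sqrt 0) (at \<xi> within hyp K)"
    by (rule tendsto_real_sqrt)
  then have gl: "(g \<longlongrightarrow> l) (at \<xi> within hyp K)"
    by (simp add: tendsto_norm_zero_iff LIM_zero_iff)
  have bl: "bdry_act K g \<xi> = l"
    unfolding bdry_act_def by (rule tendsto_Lim[OF at_bdry_nontrivial[OF \<xi>] gl])
  show "(g \<longlongrightarrow> bdry_act K g \<xi>) (at \<xi> within hyp K)" using gl bl by simp
  have hk: "h k \<in> hyp K" for k unfolding h_def using rad(1)[OF \<xi>] hyp_isomD(3)[OF g] by blast
  have "l \<in> Kvec K"
    by (rule closed_sequentially[OF closed_Kvec _ l]) (use hk in \<open>auto simp: hyp_iff\<close>)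
  moreover have "norm l = 1"
  proof -
    have "(\<lambda>k. rho (h k) (h k)) \<longlonglongrightarrow> rho l l" by (intro tendsto_intros l)
    moreover have "(\<lambda>k. rho (h k) (h k)) \<longlonglongrightarrow> rho \<xi> \<xi> * conf g \<xi> * conf g \<xi>"
      unfolding h_def rho_isom[OF g rad(1)[OF \<xi>] rad(1)[OF \<xi>]]
      using \<xi> by (intro tendsto_intros tendsto_conf g rad \<xi>) (auto simp: bdry_iff)
    ultimately have "rho l l = 0" using LIMSEQ_unique r0 by fastforce
    moreover have "norm l \<le> 1"
      by (rule tendsto_upperbound[OF tendsto_norm[OF l]])
         (use hk in \<open>auto simp: hyp_iff intro!: always_eventually less_imp_le\<close>)
    ultimately show ?thesis using rho_eq_0 by blast
  qed
  ultimately show "bdry_act K g \<xi> \<in> bdry K" by (simp add: bl bdry_iff)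
qed

lemma bdry_act_rad:
  assumes g: "hyp_isom g" and \<xi>: "\<xi> \<in> bdry K"
  shows "(\<lambda>k. g (rad \<xi> k)) \<longlonglongrightarrow> bdry_act K g \<xi>"
  by (rule filterlim_compose[OF bdry_act_tendsto(1)[OF g \<xi>] rad(4)[OF \<xi>]])

lemma rho_bdry_act:
  assumes g: "hyp_isom g" and \<xi>: "\<xi> \<in> bdry K" and \<eta>: "\<eta> \<in> bdry K"
  shows "rho (bdry_act K g \<xi>) (bdry_act K g \<eta>) = rho \<xi> \<eta> * conf g \<xi> * conf g \<eta>"
proof (rule LIMSEQ_unique)
  show "(\<lambda>k. rho (g (rad \<xi> k)) (g (rad \<eta> k))) \<longlonglongrightarrow> rho (bdry_act K g \<xi>) (bdry_act K g \<eta>)"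
    by (intro tendsto_intros bdry_act_rad assms)
  show "(\<lambda>k. rho (g (rad \<xi> k)) (g (rad \<eta> k))) \<longlonglongrightarrow> rho \<xi> \<eta> * conf g \<xi> * conf g \<eta>"
    unfolding rho_isom[OF g rad(1)[OF \<xi>] rad(1)[OF \<eta>]]
    using \<xi> \<eta> by (intro tendsto_intros tendsto_conf g rad \<xi> \<eta>) (auto simp: bdry_iff)
qed

lemma rho_bdry_eq_0: "\<xi> \<in> bdry K \<Longrightarrow> \<eta> \<in> bdry K \<Longrightarrow> rho \<xi> \<eta> = 0 \<longleftrightarrow> \<xi> = \<eta>"
  by (auto simp: rho_eq_0 bdry_iff)

lemma bdry_act_eq_iff:
  assumes g: "hyp_isom g" and \<xi>: "\<xi> \<in> bdry K" and \<eta>: "\<eta> \<in> bdry K"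
  shows "bdry_act K g \<xi> = bdry_act K g \<eta> \<longleftrightarrow> \<xi> = \<eta>"
proof -
  have "conf g \<xi> > 0" "conf g \<eta> > 0" using \<xi> \<eta> by (auto intro!: conf_bounds g simp: bdry_iff)
  then show ?thesis
    using rho_bdry_act[OF assms] rho_bdry_eq_0[OF \<xi> \<eta>]
      rho_bdry_eq_0[OF bdry_act_tendsto(2)[OF g \<xi>] bdry_act_tendsto(2)[OF g \<eta>]] by auto
qed

lemma continuous_on_bdry_act:
  assumes g: "hyp_isom g"
  shows "continuous_on (bdry K) (bdry_act K g)"
proof (unfold continuous_on_def, rule ballI)
  fix \<xi> :: "complex ^ 'a" assume \<xi>: "\<xi> \<in> bdry K"
  define C where "C = 2 * (1 / (1 - norm (g 0)))\<^sup>2"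
  have est: "(norm (bdry_act K g \<eta> - bdry_act K g \<xi>))\<^sup>2 \<le> C * rho \<eta> \<xi>" if \<eta>: "\<eta> \<in> bdry K" for \<eta>
  proof (rule tendsto_le[OF trivial_limit_sequentially])
    show "(\<lambda>k. C * rho (rad \<eta> k) (rad \<xi> k)) \<longlonglongrightarrow> C * rho \<eta> \<xi>" by (intro tendsto_intros rad \<xi> \<eta>)
    show "(\<lambda>k. (norm (g (rad \<eta> k) - g (rad \<xi> k)))\<^sup>2) \<longlonglongrightarrow> (norm (bdry_act K g \<eta> - bdry_act K g \<xi>))\<^sup>2"
      by (intro tendsto_intros bdry_act_rad g \<xi> \<eta>)
    show "\<forall>\<^sub>F k in sequentially. (norm (g (rad \<eta> k) - g (rad \<xi> k)))\<^sup>2 \<le> C * rho (rad \<eta> k) (rad \<xi> k)"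
      using norm_diff_isom[OF g rad(1)[OF \<eta>] rad(1)[OF \<xi>]] by (simp add: C_def)
  qed
  have "((\<lambda>\<eta>. C * rho \<eta> \<xi>) \<longlongrightarrow> C * rho \<xi> \<xi>) (at \<xi> within bdry K)" by (intro tendsto_intros)
  then have 0: "((\<lambda>\<eta>. C * rho \<eta> \<xi>) \<longlongrightarrow> 0) (at \<xi> within bdry K)"
    using rho_bdry_eq_0[OF \<xi> \<xi>] by simp
  have "((\<lambda>\<eta>. (norm (bdry_act K g \<eta> - bdry_act K g \<xi>))\<^sup>2) \<longlongrightarrow> 0) (at \<xi> within bdry K)"
    by (rule tendsto_sandwich[OF _ _ tendsto_const 0]) (use est in \<open>auto simp: eventually_at_filter\<close>)
  then have "((\<lambda>\<eta>. sqrt ((norm (bdry_act K g \<eta> - bdry_act K g \<xi>))\<^sup>2)) \<longlongrightarrow> sqrt 0) (at \<xi> within bdry K)"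
    by (rule tendsto_real_sqrt)
  then show "(bdry_act K g \<longlongrightarrow> bdry_act K g \<xi>) (at \<xi> within bdry K)"
    by (simp add: tendsto_norm_zero_iff LIM_zero_iff)
qed

lemma bdry_act_compose:
  assumes g: "hyp_isom g" and h: "hyp_isom h" and \<xi>: "\<xi> \<in> bdry K"
  shows "bdry_act K (compose (hyp K) g h) \<xi> = bdry_act K g (bdry_act K h \<xi>)"
proof (rule LIMSEQ_unique[OF bdry_act_rad[OF hyp_isom_compose[OF g h] \<xi>]])
  have hb: "bdry_act K h \<xi> \<in> bdry K" by (rule bdry_act_tendsto[OF h \<xi>])
  have hk: "h (rad \<xi> k) \<in> hyp K" for k using hyp_isomD(3)[OF h] rad(1)[OF \<xi>] by blast
  \<comment> \<open>The limit lies on the sphere and the sequence in the open ball, so the sequence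
    avoids its limit, as the punctured filter demands.\<close>
  have "filterlim (\<lambda>k. h (rad \<xi> k)) (at (bdry_act K h \<xi>) within hyp K) sequentially"
    unfolding filterlim_at
    using bdry_act_rad[OF h \<xi>] hk hb by (auto simp: hyp_iff bdry_iff intro!: always_eventually) (metis less_irrefl)
  then have "(\<lambda>k. g (h (rad \<xi> k))) \<longlonglongrightarrow> bdry_act K g (bdry_act K h \<xi>)"
    by (rule filterlim_compose[OF bdry_act_tendsto(1)[OF g hb]])
  then show "(\<lambda>k. compose (hyp K) g h (rad \<xi> k)) \<longlonglongrightarrow> bdry_act K g (bdry_act K h \<xi>)"
    by (simp add: compose_def rad(1)[OF \<xi>])
qed

lemma bdry_act_id: "\<xi> \<in> bdry K \<Longrightarrow> bdry_act K (\<lambda>x\<in>hyp K. x) \<xi> = \<xi>"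
  using LIMSEQ_unique[OF bdry_act_rad[OF hyp_isom_id]] rad(1,3) by fastforce

end

section \<open>Orientation and the isometry group\<close>

text \<open>\<open>real_det\<close> sums over permutations of a set of vectors. Conjugating by a
  bijection with a finite type turns it into a matrix determinant, which brings multiplicativity and
  invertibility.\<close>

lemma det_reindex:
  fixes \<beta> :: "'m::finite \<Rightarrow> 'b"
  assumes \<beta>: "bij_betw \<beta> UNIV B"
  shows "(\<Sum>p | p permutes B. of_int (sign p) * (\<Prod>b\<in>B. f b (p b))) = (det (\<chi> i j. f (\<beta> i) (\<beta> j)) :: real)"
proof -
  have inj: "inj \<beta>" and im: "\<beta> ` UNIV = B" using \<beta> by (auto simp: bij_betw_def)
  let ?\<Phi> = "map_permutation UNIV \<beta>"
  have bij: "bij_betw ?\<Phi> {p. p permutes UNIV} {p. p permutes B}"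
    using bij_betw_permutations[OF \<beta>] im
    by (simp add: map_permutation_def[abs_def] restrict_id_def[abs_def])
  have "(\<Sum>p | p permutes B. of_int (sign p) * (\<Prod>b\<in>B. f b (p b)))
      = (\<Sum>q | q permutes UNIV. of_int (sign (?\<Phi> q)) * (\<Prod>b\<in>B. f b (?\<Phi> q b)))"
    by (rule sum.reindex_bij_betw[OF bij, symmetric])
  also have "\<dots> = (\<Sum>q | q permutes UNIV. of_int (sign q) * (\<Prod>i\<in>UNIV. f (\<beta> i) (\<beta> (q i))))"
  proof (rule sum.cong[OF refl])
    fix q :: "'m \<Rightarrow> 'm" assume "q \<in> {q. q permutes UNIV}"
    then have "sign (?\<Phi> q) = sign q" using inj by (simp add: sign_map_permutation)
    moreover have "(\<Prod>b\<in>B. f b (?\<Phi> q b)) = (\<Prod>i\<in>UNIV. f (\<beta> i) (\<beta> (q i)))"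
      by (subst prod.reindex_bij_betw[OF \<beta>, symmetric]) (simp add: map_permutation_apply[OF inj])
    ultimately show "of_int (sign (?\<Phi> q)) * (\<Prod>b\<in>B. f b (?\<Phi> q b))
        = of_int (sign q) * (\<Prod>i\<in>UNIV. f (\<beta> i) (\<beta> (q i)))" by simp
  qed
  finally show ?thesis by (simp add: det_def)
qed

lemma Basis_cvec: "Basis = range (\<lambda>i. axis i 1 :: complex ^ 'n) \<union> range (\<lambda>i. axis i \<i>)"
  by (auto simp: Basis_vec_def Basis_complex_def)

lemma axis_Kvec: "0 \<in> K \<Longrightarrow> axis i c \<in> Kvec K \<longleftrightarrow> c \<in> K"
  by (auto simp: Kvec_def axis_def)

lemma Kbasis_real: "Kbasis \<real> = range (\<lambda>i. axis i 1 :: complex ^ 'n)"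
  unfolding Kbasis_def Basis_cvec by (auto simp: complex_is_Real_iff axis_Kvec)

context hyp_field begin



section \<open>Determinants of real-linear maps of \<open>Kvec K\<close>\<close>

lemma Kbasis_Kvec: "b \<in> Kbasis K \<Longrightarrow> b \<in> Kvec K"
  by (simp add: Kbasis_def)

lemma Kbasis_inner: "b \<in> Kbasis K \<Longrightarrow> b' \<in> Kbasis K \<Longrightarrow> b \<bullet> b' = (if b = b' then 1 else 0)"
  by (simp add: Kbasis_def inner_Basis)





lemma Kvec_expansion:
  assumes "x \<in> Kvec K"
  shows "(\<Sum>b\<in>Kbasis K. (x \<bullet> b) *\<^sub>R b) = x"
proof -
  have "(\<Sum>b\<in>Kbasis K. (x \<bullet> b) *\<^sub>R b) = (\<Sum>b\<in>Basis. (x \<bullet> b) *\<^sub>R b)"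
  proof (rule sum.mono_neutral_left)
    show "\<forall>b\<in>Basis - Kbasis K. (x \<bullet> b) *\<^sub>R b = 0"
    proof
      fix b :: "complex ^ 'a" assume "b \<in> Basis - Kbasis K"
      then obtain i where "b = axis i \<i>" "\<i> \<notin> K"
        unfolding Kbasis_def Basis_cvec by (auto simp: axis_Kvec)
      moreover have "K = \<real>" using K calculation by auto
      ultimately have "x \<bullet> b = 0"
        using assms by (auto simp: inner_axis Kvec_def complex_is_Real_iff)
      then show "(x \<bullet> b) *\<^sub>R b = 0" by simp
    qed
  qed (auto simp: Kbasis_def)
  then show ?thesis by (simp add: euclidean_representation)
qed

text \<open>The basis has n elements over the reals and 2n over the complex numbers. This
  elimination rule supplies both index types, so a statement proved for an arbitrary finite index
  type covers the two fields.\<close>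

lemma Kbasis_ex:
  assumes "\<And>\<beta> :: 'n::finite \<Rightarrow> complex ^ 'n. bij_betw \<beta> UNIV (Kbasis K) \<Longrightarrow> P"
    and "\<And>\<beta> :: 'n \<times> bool \<Rightarrow> complex ^ 'n. bij_betw \<beta> UNIV (Kbasis K) \<Longrightarrow> P"
  shows P
  using K
proof
  assume "K = \<real>"
  then have "bij_betw (\<lambda>i. axis i 1 :: complex ^ 'n) UNIV (Kbasis K)"
    by (auto simp: Kbasis_real bij_betw_def inj_def axis_eq_axis)
  then show P by (rule assms(1))
next
  assume "K = UNIV"
  then have "Kbasis K = (Basis :: (complex ^ 'n) set)" by (auto simp: Kbasis_def Kvec_def)
  moreover have "bij_betw (\<lambda>(i, b). axis i (if b then \<i> else 1) :: complex ^ 'n) UNIV Basis"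
    unfolding bij_betw_def Basis_cvec
    by (auto simp: inj_def axis_eq_axis complex_eq_iff split: if_splits
        intro: range_eqI[where x = "(_, True)"] range_eqI[where x = "(_, False)"])
  ultimately show P using assms(2) by simp
qed

lemma real_det_det:
  fixes \<beta> :: "'m::finite \<Rightarrow> complex ^ 'n"
  assumes "bij_betw \<beta> UNIV (Kbasis K)"
  shows "real_det K L = det (\<chi> i j. L (\<beta> i) \<bullet> \<beta> j)"
  unfolding real_det_def by (rule det_reindex[OF assms])

lemma real_det_compose:
  fixes L M :: "complex ^ 'n \<Rightarrow> complex ^ 'n"
  assumes L: "linear L" and M: "\<And>b. b \<in> Kbasis K \<Longrightarrow> M b \<in> Kvec K"
  shows "real_det K (\<lambda>x. L (M x)) = real_det K L * real_det K M"
proof -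
  have *: "real_det K (\<lambda>x. L (M x)) = real_det K L * real_det K M"
    if \<beta>: "bij_betw \<beta> UNIV (Kbasis K)" for \<beta> :: "'m::finite \<Rightarrow> complex ^ 'n"
  proof -
    have \<beta>K: "\<beta> i \<in> Kbasis K" for i using \<beta> by (auto simp: bij_betw_def)
    have "L (M (\<beta> i)) \<bullet> \<beta> j = (\<Sum>k\<in>UNIV. (M (\<beta> i) \<bullet> \<beta> k) * (L (\<beta> k) \<bullet> \<beta> j))" for i j
    proof -
      have "L (M (\<beta> i)) = L (\<Sum>b\<in>Kbasis K. (M (\<beta> i) \<bullet> b) *\<^sub>R b)"
        using Kvec_expansion[OF M[OF \<beta>K]] by simp
      also have "\<dots> = (\<Sum>b\<in>Kbasis K. (M (\<beta> i) \<bullet> b) *\<^sub>R L b)"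
        by (simp add: linear_sum[OF L] linear_cmul[OF L])
      also have "\<dots> = (\<Sum>k\<in>UNIV. (M (\<beta> i) \<bullet> \<beta> k) *\<^sub>R L (\<beta> k))"
        by (rule sum.reindex_bij_betw[OF \<beta>, symmetric])
      finally show ?thesis by (simp add: inner_sum_left)
    qed
    \<comment> \<open>The image of \<open>\<beta> i\<close> is row \<open>i\<close> of the matrix,
      so composition becomes the matrix product in the opposite order, which the determinant does
      not see.\<close>
    then have "(\<chi> i j. L (M (\<beta> i)) \<bullet> \<beta> j) = (\<chi> i j. M (\<beta> i) \<bullet> \<beta> j) ** (\<chi> i j. L (\<beta> i) \<bullet> \<beta> j)"
      by (simp add: matrix_matrix_mult_def vec_eq_iff)
    then show ?thesis by (simp add: real_det_det[OF \<beta>] det_mul)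
  qed
  show ?thesis by (rule Kbasis_ex; erule *)
qed

lemma real_det_cong:
  assumes "\<And>b b'. b \<in> Kbasis K \<Longrightarrow> b' \<in> Kbasis K \<Longrightarrow> L b \<bullet> b' = M b \<bullet> b'"
  shows "real_det K L = real_det K M"
  unfolding real_det_def
  by (intro sum.cong prod.cong refl arg_cong2[where f = "(*)"]) (use assms permutes_in_image in fastforce)

lemma real_det_id: "real_det K (\<lambda>x :: complex ^ 'n. x) = 1"
proof -
  have *: "real_det K (\<lambda>x :: complex ^ 'n. x) = 1" if \<beta>: "bij_betw \<beta> UNIV (Kbasis K)"
    for \<beta> :: "'m::finite \<Rightarrow> complex ^ 'n"
  proof -
    have \<beta>K: "\<beta> i \<in> Kbasis K" and "inj \<beta>" for i using \<beta> by (auto simp: bij_betw_def)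
    then have "(\<chi> i j. \<beta> i \<bullet> \<beta> j) = mat 1"
      by (auto simp: mat_def vec_eq_iff Kbasis_inner dest: injD)
    then show ?thesis using real_det_det[OF \<beta>, of "\<lambda>x. x"] by simp
  qed
  show ?thesis by (rule Kbasis_ex; erule *)
qed

lemma real_det_nonzero_inj:
  fixes L :: "complex ^ 'n \<Rightarrow> complex ^ 'n"
  assumes L: "linear L" and d: "real_det K L \<noteq> 0" and x: "x \<in> Kvec K" "L x = 0"
  shows "x = 0"
proof -
  have *: "x = 0" if \<beta>: "bij_betw \<beta> UNIV (Kbasis K)" for \<beta> :: "'m::finite \<Rightarrow> complex ^ 'n"
  proof -
    define A where "A = (\<chi> i j. L (\<beta> i) \<bullet> \<beta> j)"
    have ex: "x = (\<Sum>k\<in>UNIV. (x \<bullet> \<beta> k) *\<^sub>R \<beta> k)"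
      using Kvec_expansion[OF x(1)] sum.reindex_bij_betw[OF \<beta>, of "\<lambda>b. (x \<bullet> b) *\<^sub>R b"] by simp
    have "L x = (\<Sum>k\<in>UNIV. (x \<bullet> \<beta> k) *\<^sub>R L (\<beta> k))"
      by (subst ex) (simp add: linear_sum[OF L] linear_cmul[OF L])
    then have "(\<Sum>k\<in>UNIV. (x \<bullet> \<beta> k) *\<^sub>R L (\<beta> k)) \<bullet> \<beta> j = 0" for j using x(2) by simp
    then have "transpose A *v (\<chi> k. x \<bullet> \<beta> k) = 0"
      by (simp add: matrix_vector_mult_def transpose_def A_def vec_eq_iff inner_sum_left mult.commute)
    moreover have "invertible (transpose A)"
      using d by (simp add: invertible_det_nz det_transpose A_def real_det_det[OF \<beta>])
    ultimately have "(\<chi> k. x \<bullet> \<beta> k) = 0"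
      using invertible_left_inverse matrix_left_invertible_ker by blast
    then have "x \<bullet> \<beta> k = 0" for k by (simp add: vec_eq_iff)
    then show "x = 0" using ex by simp
  qed
  show ?thesis by (rule Kbasis_ex; erule *)
qed

text \<open>The orthogonal projection onto \<open>Kvec K\<close>. For real \<open>K\<close> it
  extends maps of the ball, which has empty interior, to an open set.\<close>

definition Kproj :: "complex ^ 'n \<Rightarrow> complex ^ 'n" where
  "Kproj z = (if K = \<real> then (\<chi> i. of_real (Re (z $ i))) else z)"

lemma linear_Kproj: "linear Kproj"
  by (rule linearI) (auto simp: Kproj_def vec_eq_iff complex_eq_iff)

lemma bounded_linear_Kproj: "bounded_linear Kproj"
  using linear_Kproj linear_conv_bounded_linear by blast

lemma Kproj_Kvec [simp, intro]: "Kproj z \<in> Kvec K"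
  using K by (auto simp: Kproj_def Kvec_def)

lemma Kproj_id [simp]: "z \<in> Kvec K \<Longrightarrow> Kproj z = z"
  by (auto simp: Kproj_def Kvec_def vec_eq_iff complex_is_Real_iff complex_eq_iff)

lemma Kproj_inner: "b \<in> Kbasis K \<Longrightarrow> Kproj x \<bullet> b = x \<bullet> b"
  by (auto simp: Kproj_def inner_axis Kbasis_real)

lemma continuous_on_Kproj [continuous_intros]: "continuous_on S f \<Longrightarrow> continuous_on S (\<lambda>x. Kproj (f x))"
  using bounded_linear.continuous_on[OF bounded_linear_Kproj] .

text \<open>The value 1 of \<open>\<epsilon>\<close> gives \<open>orientation_preserving\<close>;
  the value -1 records reversing maps, so that signs multiply under composition.\<close>

definition oriented :: "real \<Rightarrow> (complex ^ 'n \<Rightarrow> complex ^ 'n) \<Rightarrow> bool" where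
  "oriented \<epsilon> g \<longleftrightarrow>
     (\<forall>z\<in>hyp K. \<exists>L. (g has_derivative L) (at z within hyp K) \<and> 0 < \<epsilon> * real_det K L)"

text \<open>
  For \<open>K = \<real>\<close> a derivative within \<open>hyp K\<close> is arbitrary off \<open>Kvec K\<close>; this picks one that maps
  into \<open>Kvec K\<close>, as the multiplicativity of the determinant requires.
\<close>

lemma has_derivative_Kproj:
  assumes g: "(g has_derivative L) (at z within hyp K)" and z: "z \<in> hyp K"
    and im: "\<And>x. x \<in> hyp K \<Longrightarrow> g x \<in> hyp K"
  shows "(g has_derivative (\<lambda>x. Kproj (L (Kproj x)))) (at z within hyp K)"
    "real_det K (\<lambda>x. Kproj (L (Kproj x))) = real_det K L"
proof -
  have [simp]: "Kproj x = x" if "x \<in> hyp K" for x using that by (simp add: hyp_iff)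
  have "Kproj ` hyp K = hyp K" by force
  then have "(g has_derivative L) (at (Kproj z) within Kproj ` hyp K)" using g z by simp
  then have "((\<lambda>x. g (Kproj x)) has_derivative (\<lambda>x. L (Kproj x))) (at z within hyp K)"
    by (rule has_derivative_in_compose[OF bounded_linear.has_derivative[OF bounded_linear_Kproj has_derivative_ident]])
  then have "((\<lambda>x. Kproj (g (Kproj x))) has_derivative (\<lambda>x. Kproj (L (Kproj x)))) (at z within hyp K)"
    by (rule bounded_linear.has_derivative[OF bounded_linear_Kproj])
  then show "(g has_derivative (\<lambda>x. Kproj (L (Kproj x)))) (at z within hyp K)"
    by (rule has_derivative_transform[OF z, rotated]) (simp add: im)
  show "real_det K (\<lambda>x. Kproj (L (Kproj x))) = real_det K L"
    by (rule real_det_cong) (simp add: Kproj_inner Kbasis_Kvec)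
qed

lemma oriented_compose:
  assumes g: "oriented \<epsilon> g" "\<And>x. x \<in> hyp K \<Longrightarrow> g x \<in> hyp K"
    and h: "oriented \<delta> h" "\<And>x. x \<in> hyp K \<Longrightarrow> h x \<in> hyp K"
  shows "oriented (\<epsilon> * \<delta>) (compose (hyp K) g h)"
  unfolding oriented_def
proof
  fix z :: "complex ^ 'a" assume z: "z \<in> hyp K"
  obtain M where M: "(h has_derivative M) (at z within hyp K)" "0 < \<delta> * real_det K M"
    using h(1) z unfolding oriented_def by blast
  obtain L where L: "(g has_derivative L) (at (h z) within hyp K)" "0 < \<epsilon> * real_det K L"
    using g(1) h(2)[OF z] unfolding oriented_def by blast
  define M' where "M' = (\<lambda>x. Kproj (M (Kproj x)))"
  note M' = has_derivative_Kproj[OF M(1) z h(2), folded M'_def]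
  have "(g has_derivative L) (at (h z) within h ` hyp K)"
    by (rule has_derivative_subset[OF L(1)]) (use h(2) in blast)
  from has_derivative_in_compose[OF M'(1) this]
  have "((\<lambda>x. g (h x)) has_derivative (\<lambda>x. L (M' x))) (at z within hyp K)" .
  then have "(compose (hyp K) g h has_derivative (\<lambda>x. L (M' x))) (at z within hyp K)"
    by (rule has_derivative_transform[OF z, rotated]) (simp add: compose_def)
  moreover have "real_det K (\<lambda>x. L (M' x)) = real_det K L * real_det K M'"
    using has_derivative_linear[OF L(1)] by (rule real_det_compose) (simp add: M'_def)
  then have "0 < \<epsilon> * \<delta> * real_det K (\<lambda>x. L (M' x))"
    using mult_pos_pos[OF L(2) M(2)] M'(2) by (simp add: mult_ac)
  ultimately show "\<exists>L. (compose (hyp K) g h has_derivative L) (at z within hyp K) \<and> 0 < \<epsilon> * \<delta> * real_det K L"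
    by blast
qed

text \<open>An isometry preserves \<open>cdist\<close>, which tends to 1 as \<open>x\<close>
  approaches \<open>z\<close>, and \<open>norm_diff_cdist\<close> turns this into Euclidean
  convergence. Applied to the inverse, it supplies the continuity required by the inverse function
  rule.\<close>

lemma continuous_on_isom:
  assumes g: "hyp_isom g"
  shows "continuous_on (hyp K) g"
proof (unfold continuous_on_def, rule ballI)
  fix z :: "complex ^ 'a" assume z: "z \<in> hyp K"
  have "((\<lambda>x. (cdist x z)\<^sup>2 - 1) \<longlongrightarrow> (cdist z z)\<^sup>2 - 1) (at z within hyp K)"
    by (intro tendsto_intros tendsto_cdist hyp_norm z)
  then have 0: "((\<lambda>x. (cdist x z)\<^sup>2 - 1) \<longlongrightarrow> 0) (at z within hyp K)"
    by (simp add: cdist_self hyp_norm z)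
  have est: "(norm (g x - g z))\<^sup>2 \<le> (cdist x z)\<^sup>2 - 1" if "x \<in> hyp K" for x
    using norm_diff_cdist[of "g x" "g z"] hyp_isom_cdist[OF g that z] hyp_isomD(3)[OF g] z that
    by (simp add: hyp_norm)
  have "((\<lambda>x. (norm (g x - g z))\<^sup>2) \<longlongrightarrow> 0) (at z within hyp K)"
    by (rule tendsto_sandwich[OF _ _ tendsto_const 0]) (use est in \<open>auto simp: eventually_at_filter\<close>)
  then have "((\<lambda>x. sqrt ((norm (g x - g z))\<^sup>2)) \<longlongrightarrow> sqrt 0) (at z within hyp K)"
    by (rule tendsto_real_sqrt)
  then show "(g \<longlongrightarrow> g z) (at z within hyp K)"
    by (simp add: tendsto_norm_zero_iff LIM_zero_iff)
qed

text \<open>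
  For \<open>K = \<real>\<close> the ball \<open>hyp K\<close> is not open, so the inverse function rule is applied to the
  extension of \<open>g\<close> by the identity on the orthogonal complement of \<open>Kvec K\<close>.
\<close>

lemma oriented_hinv:
  assumes g: "hyp_isom g" and or: "oriented \<epsilon> g"
  shows "oriented \<epsilon> (hinv g)"
  unfolding oriented_def
proof
  fix z :: "complex ^ 'a" assume z: "z \<in> hyp K"
  define y where "y = hinv g z"
  have y: "y \<in> hyp K" "g y = z" using hinv[OF g] z by (auto simp: y_def)
  obtain M where M: "(g has_derivative M) (at y within hyp K)" "0 < \<epsilon> * real_det K M"
    using or y(1) unfolding oriented_def by blast
  define N where "N = (\<lambda>x. Kproj (M (Kproj x)))"
  note N = has_derivative_Kproj[OF M(1) y(1) hyp_isomD(3)[OF g], folded N_def]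
  have linN: "linear N" using N(1) by (rule has_derivative_linear)
  define S where "S = {x :: complex ^ 'a. Kproj x \<in> hyp K}"
  have S_eq: "S = (\<lambda>x. norm (Kproj x)) -` {..<1}" by (auto simp: S_def hyp_iff)
  have "open S"
    unfolding S_eq by (rule open_vimage) (auto intro!: continuous_intros)
  have hypS: "hyp K \<subseteq> S" by (auto simp: S_def hyp_iff)
  have [simp]: "Kproj x = x" if "x \<in> hyp K" for x using that by (simp add: hyp_iff)
  have Kp: "Kproj (a + (x - Kproj x)) = a" if "a \<in> Kvec K" for a x :: "complex ^ 'a"
    using that by (simp add: linear_add[OF linear_Kproj] linear_diff[OF linear_Kproj])
  define g' where "g' = (\<lambda>x. g (Kproj x) + (x - Kproj x))"
  define h' where "h' = (\<lambda>x. hinv g (Kproj x) + (x - Kproj x))"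
  define L where "L = (\<lambda>x. N (Kproj x) + (x - Kproj x))"
  have [simp]: "Kproj (Kproj x) = Kproj x" for x :: "complex ^ 'a" by simp
  have NK: "N x \<in> Kvec K" for x by (simp add: N_def)
  have yS: "y \<in> S" "z \<in> S" using y z hypS by auto
  have derg: "(g' has_derivative L) (at y)"
  proof -
    have "(Kproj has_derivative Kproj) (at y within S)"
      by (rule bounded_linear.has_derivative[OF bounded_linear_Kproj has_derivative_ident])
    moreover have "(g has_derivative N) (at (Kproj y) within Kproj ` S)"
      by (rule has_derivative_subset[of _ _ _ "hyp K"]) (use N(1) y in \<open>auto simp: S_def\<close>)
    ultimately have "((\<lambda>x. g (Kproj x)) has_derivative (\<lambda>x. N (Kproj x))) (at y within S)"
      by (rule has_derivative_in_compose)
    then have "(g' has_derivative L) (at y within S)"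
      unfolding g'_def L_def
      by (intro has_derivative_add has_derivative_diff has_derivative_ident
            bounded_linear.has_derivative[OF bounded_linear_Kproj])
    then show ?thesis using \<open>open S\<close> yS at_within_open by metis
  qed
  then have linL: "linear L" by (rule has_derivative_linear)
  have nz: "real_det K N \<noteq> 0" using M(2) N(2) by auto
  \<comment> \<open>\<open>L\<close> acts as \<open>N\<close> on \<open>Kvec K\<close> and as the
    identity on the orthogonal complement; on the former it is injective by the nonzero
    determinant.\<close>
  have "inj L"
  proof (rule linear_injective_0[OF linL, THEN iffD2])
    show "\<forall>x. L x = 0 \<longrightarrow> x = 0"
    proof (intro allI impI)
      fix x assume Lx: "L x = 0"
      have "N (Kproj x) = Kproj (L x)" unfolding L_def by (rule Kp[OF NK, symmetric])
      then have "N (Kproj x) = 0" by (simp only: Lx linear_0[OF linear_Kproj])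
      then have "Kproj x = 0"
        by (rule real_det_nonzero_inj[OF linN nz Kproj_Kvec])
      moreover have "L x = N (Kproj x) + (x - Kproj x)" by (simp only: L_def)
      ultimately show "x = 0" by (simp only: Lx linear_0[OF linN] diff_zero add_0)
    qed
  qed
  then obtain L' where L': "linear L'" "\<And>x. L' (L x) = x"
    using linear_injective_isomorphism[OF linL] by blast
  have "continuous_on S h'"
    unfolding h'_def
    by (intro continuous_intros continuous_on_compose2[OF continuous_on_isom[OF hinv(4)[OF g]]])
       (auto simp: S_def)
  then have conth: "continuous (at z) h'"
    using \<open>open S\<close> yS by (simp add: continuous_on_eq_continuous_at)
  have h'z: "h' z = y" using z by (simp add: h'_def y_def)
  have "(h' has_derivative L') (at z)"
  proof (rule has_derivative_inverse_basic[OF _ _ _ conth \<open>open S\<close> yS(2)])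
    show "(g' has_derivative L) (at (h' z))" using derg h'z by simp
    show "bounded_linear L'" using L'(1) linear_conv_bounded_linear by blast
    show "L' \<circ> L = id" using L'(2) by auto
    show "g' (h' x) = x" if "x \<in> S" for x
    proof -
      have x: "Kproj x \<in> hyp K" using that by (simp add: S_def)
      then have "hinv g (Kproj x) \<in> Kvec K" using hinv(1)[OF g] by (auto simp: hyp_iff)
      then have "Kproj (h' x) = hinv g (Kproj x)" unfolding h'_def by (rule Kp)
      then show ?thesis unfolding g'_def using hinv(2)[OF g x] by (simp add: h'_def)
    qed
  qed
  then have "(h' has_derivative L') (at z within hyp K)" by (rule has_derivative_at_withinI)
  then have "(hinv g has_derivative L') (at z within hyp K)"
    by (rule has_derivative_transform[OF z, rotated]) (simp add: h'_def)
  \<comment> \<open>On \<open>Kbasis K\<close> the maps \<open>L\<close> and \<open>N\<close> agree,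
    so \<open>L'\<close> inverts \<open>N\<close> there; the two determinants are reciprocal and
    share their sign.\<close>
  moreover have "real_det K L' * real_det K N = 1"
  proof -
    have "real_det K L' * real_det K N = real_det K (\<lambda>x. L' (N x))"
      by (rule real_det_compose[symmetric, OF L'(1)]) (rule NK)
    also have "\<dots> = real_det K (\<lambda>x :: complex ^ 'a. x)"
    proof (rule real_det_cong)
      fix b b' :: "complex ^ 'a" assume "b \<in> Kbasis K"
      then have "L b = N b" by (simp add: L_def Kbasis_Kvec)
      then show "L' (N b) \<bullet> b' = b \<bullet> b'" using L'(2)[of b] by simp
    qed
    finally show ?thesis by (simp add: real_det_id)
  qed
  then have "0 < real_det K L' * real_det K N" by simp
  then have "0 < \<epsilon> * real_det K L'"
    using M(2) N(2) unfolding zero_less_mult_iff by auto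
  ultimately show "\<exists>L. (hinv g has_derivative L) (at z within hyp K) \<and> 0 < \<epsilon> * real_det K L"
    by blast
qed

lemma oriented_id: "oriented 1 (\<lambda>x\<in>hyp K. x)"
  unfolding oriented_def
proof
  fix z :: "complex ^ 'a" assume z: "z \<in> hyp K"
  have "((\<lambda>x\<in>hyp K. x) has_derivative (\<lambda>x. x)) (at z within hyp K)"
    by (rule has_derivative_transform[OF z _ has_derivative_ident]) simp
  then show "\<exists>L. ((\<lambda>x\<in>hyp K. x) has_derivative L) (at z within hyp K) \<and> 0 < 1 * real_det K L"
    using real_det_id by (metis mult_1 zero_less_one)
qed

section \<open>The group structure of \<open>Isom_plus K\<close>\<close>

lemma carrier_Isom_plus: "g \<in> carrier (Isom_plus K) \<longleftrightarrow> hyp_isom g \<and> oriented 1 g"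
  by (auto simp: Isom_plus_def hyp_isom_def oriented_def orientation_preserving_def)

lemma mult_Isom_plus:
  "hyp_isom g \<Longrightarrow> hyp_isom h \<Longrightarrow> g \<otimes>\<^bsub>Isom_plus K\<^esub> h = compose (hyp K) g h"
  by (simp add: Isom_plus_def BijGroup_def hyp_isom_def)

lemma one_Isom_plus: "\<one>\<^bsub>Isom_plus K\<^esub> = (\<lambda>x\<in>hyp K. x)"
  by (simp add: Isom_plus_def BijGroup_def)

lemma subgroup_Isom_plus: "subgroup (carrier (Isom_plus K)) (BijGroup (hyp K :: (complex ^ 'n) set))"
proof (rule subgroup.intro)
  show "carrier (Isom_plus K) \<subseteq> carrier (BijGroup (hyp K :: (complex ^ 'n) set))"
    by (auto simp: Isom_plus_def BijGroup_def)
  fix g h :: "complex ^ 'n \<Rightarrow> complex ^ 'n"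
  assume gh: "g \<in> carrier (Isom_plus K)" "h \<in> carrier (Isom_plus K)"
  then have "oriented (1 * 1) (compose (hyp K) g h)"
    by (intro oriented_compose) (auto simp: carrier_Isom_plus hyp_isomD)
  moreover have "g \<otimes>\<^bsub>BijGroup (hyp K)\<^esub> h = compose (hyp K) g h"
    using gh by (simp add: carrier_Isom_plus hyp_isom_def BijGroup_def)
  ultimately show "g \<otimes>\<^bsub>BijGroup (hyp K)\<^esub> h \<in> carrier (Isom_plus K)"
    using gh by (simp add: carrier_Isom_plus hyp_isom_compose)
next
  show "\<one>\<^bsub>BijGroup (hyp K :: (complex ^ 'n) set)\<^esub> \<in> carrier (Isom_plus K)"
    using oriented_id hyp_isom_id by (simp add: carrier_Isom_plus BijGroup_def)
next
  fix g :: "complex ^ 'n \<Rightarrow> complex ^ 'n"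
  assume "g \<in> carrier (Isom_plus K)"
  moreover from this have "inv\<^bsub>BijGroup (hyp K)\<^esub> g = hinv g"
    by (simp add: inv_BijGroup hinv_def carrier_Isom_plus hyp_isom_def)
  ultimately show "inv\<^bsub>BijGroup (hyp K)\<^esub> g \<in> carrier (Isom_plus K)"
    using hinv oriented_hinv by (auto simp: carrier_Isom_plus)
qed

lemma group_Isom_plus: "group (Isom_plus K :: (complex ^ 'n \<Rightarrow> complex ^ 'n) monoid)"
proof -
  have "Isom_plus K = (BijGroup (hyp K))\<lparr>carrier := carrier (Isom_plus K)\<rparr>"
    by (simp add: Isom_plus_def)
  then show ?thesis using subgroup.subgroup_is_group[OF subgroup_Isom_plus group_BijGroup] by metis
qed

lemma inv_Isom_plus:
  assumes "g \<in> carrier (Isom_plus K)"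
  shows "inv\<^bsub>Isom_plus K\<^esub> g = hinv g"
proof (rule group.inv_equality[OF group_Isom_plus _ assms])
  have g: "hyp_isom g" "oriented 1 g" using assms by (auto simp: carrier_Isom_plus)
  show "hinv g \<in> carrier (Isom_plus K)"
    using hinv(4)[OF g(1)] oriented_hinv[OF g] by (simp add: carrier_Isom_plus)
  have "compose (hyp K) (hinv g) g = (\<lambda>x\<in>hyp K. x)"
    by (rule ext) (simp add: compose_def restrict_def hinv(3)[OF g(1)])
  then show "hinv g \<otimes>\<^bsub>Isom_plus K\<^esub> g = \<one>\<^bsub>Isom_plus K\<^esub>"
    using g hinv(4)[OF g(1)] by (simp add: mult_Isom_plus one_Isom_plus)
qed

end

section \<open>Projective isometries\<close>

definition sc :: "complex \<Rightarrow> (complex ^ 'n) \<times> complex \<Rightarrow> (complex ^ 'n) \<times> complex" where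
  "sc c Z = (c *s fst Z, c * snd Z)"

definition form :: "(complex ^ 'n) \<times> complex \<Rightarrow> (complex ^ 'n) \<times> complex \<Rightarrow> complex" where
  "form Z W = herm (fst Z) (fst W) - snd Z * cnj (snd W)"

lemma fst_sc [simp]: "fst (sc c Z) = c *s fst Z" and snd_sc [simp]: "snd (sc c Z) = c * snd Z"
  by (simp_all add: sc_def)

lemma sc_simps:
  "sc c (Z + W) = sc c Z + sc c W" "sc c (Z - W) = sc c Z - sc c W"
  "sc (a + b) Z = sc a Z + sc b Z" "sc (a - b) Z = sc a Z - sc b Z"
  "sc a (sc b Z) = sc (a * b) Z" "sc 1 Z = Z" "sc 0 Z = 0" "sc c 0 = 0"
  by (simp_all add: prod_eq_iff algebra_simps vec_eq_iff)

lemma scaleR_sc: "r *\<^sub>R Z = sc (of_real r) Z"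
  by (simp add: prod_eq_iff vec_eq_iff complex_eq_iff)

lemma form_simps:
  "form (Z + W) T = form Z T + form W T" "form T (Z + W) = form T Z + form T W"
  "form (Z - W) T = form Z T - form W T" "form T (Z - W) = form T Z - form T W"
  "form (sc c Z) W = c * form Z W" "form Z (sc c W) = cnj c * form Z W"
  by (simp_all add: form_def herm_add_left herm_add_right herm_diff_left herm_diff_right
      herm_scale_left herm_scale_right algebra_simps)

lemma cnj_form: "cnj (form Z W) = form W Z"
  by (simp add: form_def cnj_herm mult.commute)

lemma form_self: "form Z Z = of_real ((norm (fst Z))\<^sup>2 - (cmod (snd Z))\<^sup>2)"
  using complex_norm_square[of "snd Z"] by (simp add: form_def herm_self)

lemma linear_form: "linear (\<lambda>Z. Z + sc (k * form Z V) V)"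
proof (rule linearI)
  fix r Z
  show "r *\<^sub>R Z + sc (k * form (r *\<^sub>R Z) V) V = r *\<^sub>R (Z + sc (k * form Z V) V)"
    by (simp add: scaleR_sc form_simps sc_simps mult_ac)
qed (simp add: form_simps sc_simps distrib_left algebra_simps)

definition den :: "((complex ^ 'n) \<times> complex \<Rightarrow> (complex ^ 'n) \<times> complex) \<Rightarrow> complex ^ 'n \<Rightarrow> complex" where
  "den M z = snd (M (z, 1))"

text \<open>The projective action of \<open>M\<close> in the chart of lifts with last coordinate 1;
  \<open>den\<close> is the factor that leads back into the chart.\<close>

definition proj :: "((complex ^ 'n) \<times> complex \<Rightarrow> (complex ^ 'n) \<times> complex) \<Rightarrow> complex ^ 'n \<Rightarrow> complex ^ 'n" where
  "proj M z = (1 / den M z) *s fst (M (z, 1))"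

text \<open>The quotient rule for \<open>proj M\<close> at \<open>z\<close> in direction
  \<open>h\<close>; the derivative of the lift is \<open>M (h, 0)\<close>.\<close>

definition pderiv_at :: "((complex ^ 'n) \<times> complex \<Rightarrow> (complex ^ 'n) \<times> complex) \<Rightarrow> complex ^ 'n \<Rightarrow> complex ^ 'n \<Rightarrow> complex ^ 'n" where
  "pderiv_at M z h = (1 / den M z) *s (fst (M (h, 0)) - snd (M (h, 0)) *s proj M z)"

text \<open>If \<open>form V V\<close> is nonzero this is the unitary reflection that multiplies
  \<open>V\<close> by \<open>u\<close> and fixes the orthogonal complement of \<open>V\<close> for
  the form.\<close>

definition refl :: "(complex ^ 'n) \<times> complex \<Rightarrow> complex \<Rightarrow> (complex ^ 'n) \<times> complex \<Rightarrow> (complex ^ 'n) \<times> complex" where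
  "refl V u Z = Z + sc ((u - 1) / form V V * form Z V) V"

declare split_paired_All [simp del]

context hyp_field begin

definition KZ :: "((complex ^ 'n) \<times> complex) set" where
  "KZ = Kvec K \<times> K"

lemma KZ_closed [simp, intro]:
  "Z \<in> KZ \<Longrightarrow> W \<in> KZ \<Longrightarrow> Z + W \<in> KZ" "Z \<in> KZ \<Longrightarrow> W \<in> KZ \<Longrightarrow> Z - W \<in> KZ"
  "c \<in> K \<Longrightarrow> Z \<in> KZ \<Longrightarrow> sc c Z \<in> KZ"
  "z \<in> Kvec K \<Longrightarrow> c \<in> K \<Longrightarrow> (z, c) \<in> KZ"
  by (auto simp: KZ_def sc_def)

lemma KZ_D: "Z \<in> KZ \<Longrightarrow> fst Z \<in> Kvec K" "Z \<in> KZ \<Longrightarrow> snd Z \<in> K"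
  by (auto simp: KZ_def)

lemma form_in_K: "Z \<in> KZ \<Longrightarrow> W \<in> KZ \<Longrightarrow> form Z W \<in> K"
  by (auto simp: form_def KZ_def)

text \<open>Linear isometries of the form that are defined over \<open>K\<close>. For real
  \<open>K\<close> they are complexified real isometries, so both fields share one ambient
  space.\<close>

definition KU :: "((complex ^ 'n) \<times> complex \<Rightarrow> (complex ^ 'n) \<times> complex) \<Rightarrow> bool" where
  "KU M \<longleftrightarrow> linear M \<and> (\<forall>c Z. M (sc c Z) = sc c (M Z)) \<and>
     (\<forall>Z W. form (M Z) (M W) = form Z W) \<and> (\<forall>Z\<in>KZ. M Z \<in> KZ)"

definition UU :: "((complex ^ 'n) \<times> complex \<Rightarrow> (complex ^ 'n) \<times> complex) \<Rightarrow> bool" where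
  "UU M \<longleftrightarrow> KU M \<and> (\<exists>M'. KU M' \<and> (\<forall>Z. M (M' Z) = Z) \<and> (\<forall>Z. M' (M Z) = Z))"

lemma KU_compose: "KU M \<Longrightarrow> KU N \<Longrightarrow> KU (\<lambda>Z. M (N Z))"
  unfolding KU_def by (auto intro: linear_compose[unfolded o_def] simp del: split_paired_All)

lemma UU_compose:
  assumes "UU M" "UU N"
  shows "UU (\<lambda>Z. M (N Z))"
proof -
  obtain M' N' where "KU M'" "\<And>Z. M (M' Z) = Z" "\<And>Z. M' (M Z) = Z"
    "KU N'" "\<And>Z. N (N' Z) = Z" "\<And>Z. N' (N Z) = Z"
    using assms unfolding UU_def by metis
  then show ?thesis
    using assms unfolding UU_def by (intro conjI exI[of _ "\<lambda>Z. N' (M' Z)"]) (simp_all add: KU_compose)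
qed

lemma UU_inv:
  assumes "UU M"
  obtains M' where "UU M'" "\<And>Z. M (M' Z) = Z" "\<And>Z. M' (M Z) = Z"
  using assms unfolding UU_def by blast

lemma KU_id: "KU (\<lambda>Z. Z)"
  by (simp add: KU_def linear_id[unfolded id_def])

lemma UU_id: "UU (\<lambda>Z. Z)"
  using KU_id by (auto simp: UU_def)

text \<open>If the last coordinate of the image vanished, the form would be nonnegative on the
  image; on the lift of a point of the closed ball it is nonpositive. So the image would be 0,
  against injectivity.\<close>

lemma den_nonzero:
  assumes M: "UU M" and z: "norm z \<le> 1"
  shows "den M z \<noteq> 0"
proof
  assume 0: "den M z = 0"
  obtain M' where M': "UU M'" "\<And>Z. M' (M Z) = Z" using UU_inv[OF M] by metis
  have "form (M (z, 1)) (M (z, 1)) = form (z, 1) (z, 1)" using M by (simp add: UU_def KU_def)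
  then have "of_real ((norm (fst (M (z, 1))))\<^sup>2) = (of_real ((norm z)\<^sup>2 - 1) :: complex)"
    using 0 by (simp add: form_self den_def)
  then have "(norm (fst (M (z, 1))))\<^sup>2 = (norm z)\<^sup>2 - 1" by (simp only: of_real_eq_iff)
  moreover have "(norm z)\<^sup>2 \<le> 1" using z by (simp add: power_le_one)
  ultimately have "fst (M (z, 1)) = 0" by (smt (verit) zero_le_power2 norm_eq_zero power2_eq_iff_nonneg zero_eq_power2)
  then have "M (z, 1) = 0" using 0 by (simp add: prod_eq_iff den_def)
  then have "(z, 1) = M' 0" using M'(2)[of "(z, 1)"] by simp
  then show False using M'(1) linear_0[of M'] by (simp add: UU_def KU_def prod_eq_iff)
qed

lemma lift_proj:
  assumes M: "UU M" and z: "norm z \<le> 1"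
  shows "M (z, 1) = sc (den M z) (proj M z, 1)"
  using den_nonzero[OF assms] by (simp add: prod_eq_iff proj_def den_def vec_eq_iff)

lemma proj_unique:
  assumes "M (z, 1) = sc c (w, 1)" "c \<noteq> 0"
  shows "proj M z = w" "den M z = c"
  using assms by (simp_all add: proj_def den_def vec_eq_iff)

lemma rho_proj:
  assumes M: "UU M" and z: "norm z \<le> 1" and w: "norm w \<le> 1"
  shows "1 - herm (proj M z) (proj M w) = (1 - herm z w) / (den M z * cnj (den M w))"
proof -
  have "form (M (z, 1)) (M (w, 1)) = form (z, 1) (w, 1)" using M by (simp add: UU_def KU_def)
  then have "den M z * cnj (den M w) * (herm (proj M z) (proj M w) - 1) = herm z w - 1"
    unfolding lift_proj[OF M z] lift_proj[OF M w] form_simps by (simp add: form_def mult_ac)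
  then show ?thesis using den_nonzero[OF M z] den_nonzero[OF M w]
    by (simp add: field_simps)
qed

lemma norm_proj:
  assumes M: "UU M" and z: "norm z \<le> 1"
  shows "1 - (norm (proj M z))\<^sup>2 = (1 - (norm z)\<^sup>2) / (cmod (den M z))\<^sup>2"
proof -
  have "complex_of_real (1 - (norm (proj M z))\<^sup>2) = of_real ((1 - (norm z)\<^sup>2) / (cmod (den M z))\<^sup>2)"
    using rho_proj[OF M z z] complex_norm_square[of "den M z"] by (simp add: herm_self)
  then show ?thesis by (simp only: of_real_eq_iff)
qed

lemma proj_Kvec: "UU M \<Longrightarrow> z \<in> Kvec K \<Longrightarrow> den M z \<in> K \<and> proj M z \<in> Kvec K"
proof -
  assume "UU M" "z \<in> Kvec K"
  then have "M (z, 1) \<in> KZ" by (simp add: UU_def KU_def)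
  from KZ_D[OF this] show ?thesis by (simp add: den_def proj_def)
qed

lemma proj_hyp: "UU M \<Longrightarrow> z \<in> hyp K \<Longrightarrow> proj M z \<in> hyp K"
proof -
  assume M: "UU M" and z: "z \<in> hyp K"
  then have "0 < 1 - (norm (proj M z))\<^sup>2"
    using norm_proj[OF M, of z] den_nonzero[OF M, of z] norm_sq_less_1[of z]
    by (simp add: hyp_iff less_imp_le)
  then have "norm (proj M z) < 1" using abs_square_less_1[of "norm (proj M z)"] by simp
  then show ?thesis using proj_Kvec[OF M] z by (simp add: hyp_iff)
qed

lemma proj_compose:
  assumes M: "UU M" and N: "UU N" and z: "norm z \<le> 1" and y: "norm (proj N z) \<le> 1"
  shows "proj (\<lambda>Z. M (N Z)) z = proj M (proj N z)"
    "den (\<lambda>Z. M (N Z)) z = den N z * den M (proj N z)"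
proof -
  have "M (N (z, 1)) = sc (den N z * den M (proj N z)) (proj M (proj N z), 1)"
    using M unfolding lift_proj[OF N z] by (simp add: UU_def KU_def lift_proj[OF M y] sc_simps)
  then show "proj (\<lambda>Z. M (N Z)) z = proj M (proj N z)" "den (\<lambda>Z. M (N Z)) z = den N z * den M (proj N z)"
    using proj_unique[of "\<lambda>Z. M (N Z)"] den_nonzero[OF N z] den_nonzero[OF M y] by simp_all
qed

lemma proj_id [simp]: "proj (\<lambda>Z. Z) z = z"
  by (simp add: proj_def den_def)

section \<open>Isometries of the ball induced by form-preserving linear maps\<close>

definition pact :: "((complex ^ 'n) \<times> complex \<Rightarrow> (complex ^ 'n) \<times> complex) \<Rightarrow> complex ^ 'n \<Rightarrow> complex ^ 'n" where
  "pact M = (\<lambda>z\<in>hyp K. proj M z)"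

lemma proj_inv:
  assumes M: "UU M" and M': "UU M'" and inv: "\<And>Z. M (M' Z) = Z" and z: "z \<in> hyp K"
  shows "proj M (proj M' z) = z"
  using proj_compose(1)[OF M M', of z] proj_hyp[OF M' z] z inv by (simp add: hyp_iff)

text \<open>The denominators by which \<open>rho\<close> and the factors 1 - |z|^2 are divided under
  \<open>proj M\<close> cancel in \<open>cdist\<close>.\<close>

lemma hyp_isom_pact:
  assumes M: "UU M"
  shows "hyp_isom (pact M)"
proof (rule hyp_isomI)
  obtain M' where M': "UU M'" "\<And>Z. M (M' Z) = Z" "\<And>Z. M' (M Z) = Z" using UU_inv[OF M] by metis
  have "bij_betw (proj M) (hyp K) (hyp K)"
    by (rule bij_betw_byWitness[of _ "proj M'"])
       (auto simp: proj_hyp M M'(1) proj_inv[OF M M'(1,2)] proj_inv[OF M'(1) M M'(3)])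
  then show "pact M \<in> Bij (hyp K)" by (simp add: pact_def Bij_def)
next
  fix z w :: "complex ^ 'a" assume zw: "z \<in> hyp K" "w \<in> hyp K"
  then have n: "norm z \<le> 1" "norm w \<le> 1" "norm z < 1" "norm w < 1" by (auto simp: hyp_iff)
  have d: "cmod (den M z) > 0" "cmod (den M w) > 0"
    using den_nonzero[OF M n(1)] den_nonzero[OF M n(2)] by auto
  have "sqrt (1 - (norm (proj M z))\<^sup>2) = sqrt (1 - (norm z)\<^sup>2) / cmod (den M z)"
    "sqrt (1 - (norm (proj M w))\<^sup>2) = sqrt (1 - (norm w)\<^sup>2) / cmod (den M w)"
    using d by (simp_all add: norm_proj[OF M] n real_sqrt_divide)
  moreover have "rho (proj M z) (proj M w) = rho z w / (cmod (den M z) * cmod (den M w))"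
    unfolding rho_def rho_proj[OF M n(1,2)] by (simp add: norm_divide norm_mult)
  ultimately show "cdist (pact M z) (pact M w) = cdist z w"
    using zw d by (simp add: cdist_def pact_def)
qed

lemma pact_compose:
  assumes "UU M" "UU N"
  shows "pact (\<lambda>Z. M (N Z)) = compose (hyp K) (pact M) (pact N)"
proof
  fix z show "pact (\<lambda>Z. M (N Z)) z = compose (hyp K) (pact M) (pact N) z"
    using proj_compose(1)[OF assms, of z] proj_hyp[OF assms(2), of z]
    by (auto simp: pact_def compose_def hyp_iff)
qed

lemma has_derivative_lift:
  assumes "UU M"
  shows "((\<lambda>z. M (z, 1)) has_derivative (\<lambda>h. M (h, 0))) (at z within S)"
proof -
  have "bounded_linear M" using assms linear_conv_bounded_linear by (auto simp: UU_def KU_def)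
  moreover have "((\<lambda>z. (z, 1)) has_derivative (\<lambda>h. (h, 0))) (at z within S)"
    by (intro derivative_eq_intros) auto
  ultimately show ?thesis by (rule bounded_linear.has_derivative)
qed

lemma has_derivative_proj:
  assumes M: "UU M" and z: "norm z \<le> 1"
  shows "(proj M has_derivative pderiv_at M z) (at z within S)"
proof -
  have d: "den M z \<noteq> 0" by (rule den_nonzero[OF M z])
  have 1: "(den M has_derivative (\<lambda>h. snd (M (h, 0)))) (at z within S)"
    unfolding den_def[abs_def]
    by (rule bounded_linear.has_derivative[OF bounded_linear_snd has_derivative_lift[OF M]])
  have 2: "((\<lambda>z. fst (M (z, 1))) has_derivative (\<lambda>h. fst (M (h, 0)))) (at z within S)"
    by (rule bounded_linear.has_derivative[OF bounded_linear_fst has_derivative_lift[OF M]])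
  have 3: "((\<lambda>z. inverse (den M z) *s fst (M (z, 1))) has_derivative
     (\<lambda>h. inverse (den M z) *s fst (M (h, 0)) +
        (- (inverse (den M z) * snd (M (h, 0)) * inverse (den M z))) *s fst (M (z, 1)))) (at z within S)"
    by (rule bounded_bilinear.FDERIV[OF bounded_bilinear_vec_scale Deriv.has_derivative_inverse[OF d 1] 2])
  have "proj M = (\<lambda>z. inverse (den M z) *s fst (M (z, 1)))"
    by (simp add: fun_eq_iff proj_def inverse_eq_divide)
  moreover have "pderiv_at M z = (\<lambda>h. inverse (den M z) *s fst (M (h, 0)) +
        (- (inverse (den M z) * snd (M (h, 0)) * inverse (den M z))) *s fst (M (z, 1)))"
    by (simp add: fun_eq_iff pderiv_at_def proj_def vec_eq_iff field_simps)
  ultimately show ?thesis using 3 by simp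
qed

lemma continuous_on_proj:
  assumes M: "UU M" shows "continuous_on {z. norm z \<le> 1} (proj M)"
  by (rule has_derivative_continuous_on[OF has_derivative_proj[OF M]]) simp

text \<open>The chain rule for the identity, done algebraically: on lifts \<open>M'\<close> undoes
  \<open>M\<close>, and the multiple of \<open>(z, 1)\<close> that remains is removed by the
  correction term of the quotient rule.\<close>

lemma pderiv_at_inverse:
  assumes M: "UU M" and M': "UU M'" and inv: "\<And>Z. M' (M Z) = Z" and z: "z \<in> hyp K"
  shows "pderiv_at M' (proj M z) (pderiv_at M z h) = h"
proof -
  define s q y where "s = den M z" and "q = snd (M (h, 0))" and "y = proj M z"
  have nz: "norm z \<le> 1" using z by (simp add: hyp_iff)
  have s: "s \<noteq> 0" using den_nonzero[OF M nz] by (simp add: s_def)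
  have lin: "linear M'" "\<And>c Z. M' (sc c Z) = sc c (M' Z)" using M' by (auto simp: UU_def KU_def)
  have "(y, 1) = sc (1 / s) (M (z, 1))"
    using s by (simp add: lift_proj[OF M nz] sc_simps flip: s_def y_def)
  then have M'y: "M' (y, 1) = sc (1 / s) (z, 1)" by (simp add: lin inv)
  then have dy: "den M' y = 1 / s" "proj M' y = z" using proj_unique[of M' y "1 / s" z, OF M'y] s by auto
  have "(pderiv_at M z h, 0) = sc (1 / s) (M (h, 0) - sc q (y, 1))"
    by (simp add: prod_eq_iff pderiv_at_def s_def q_def y_def)
  then have "M' (pderiv_at M z h, 0) = sc (1 / s) ((h, 0) - sc q (sc (1 / s) (z, 1)))"
    by (simp add: lin inv linear_diff M'y)
  then show ?thesis
    using s unfolding y_def[symmetric] pderiv_at_def[of M'] dy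
    by (simp add: vec_eq_iff field_simps)
qed

lemma pderiv_at_Kvec:
  assumes M: "UU M" and z: "z \<in> Kvec K" and h: "h \<in> Kvec K"
  shows "pderiv_at M z h \<in> Kvec K"
proof -
  have "M (h, 0) \<in> KZ" using M h by (simp add: UU_def KU_def)
  from KZ_D[OF this] show ?thesis using proj_Kvec[OF M z] by (simp add: pderiv_at_def)
qed

lemma real_det_pderiv_at:
  assumes M: "UU M" and z: "z \<in> hyp K"
  shows "real_det K (pderiv_at M z) \<noteq> 0"
proof -
  obtain M' where M': "UU M'" "\<And>Z. M' (M Z) = Z" using UU_inv[OF M] by metis
  have "norm (proj M z) \<le> 1" using proj_hyp[OF M z] by (simp add: hyp_iff)
  then have "linear (pderiv_at M' (proj M z))"
    using has_derivative_linear[OF has_derivative_proj[OF M'(1)]] by blast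
  then have "real_det K (\<lambda>x. pderiv_at M' (proj M z) (pderiv_at M z x))
      = real_det K (pderiv_at M' (proj M z)) * real_det K (pderiv_at M z)"
    using z by (intro real_det_compose pderiv_at_Kvec[OF M]) (auto simp: hyp_iff Kbasis_Kvec)
  then show ?thesis by (auto simp: pderiv_at_inverse[OF M M' z] real_det_id)
qed

text \<open>The sign is constant because the Jacobian is continuous and nonzero on a connected set.\<close>

lemma oriented_pact:
  assumes M: "UU M"
  obtains \<epsilon> where "\<epsilon> = 1 \<or> \<epsilon> = - 1" "oriented \<epsilon> (pact M)"
proof -
  define f where "f = (\<lambda>z. real_det K (pderiv_at M z))"
  have d: "den M z \<noteq> 0" if "z \<in> hyp K" for z using den_nonzero[OF M] that by (simp add: hyp_iff)
  have cp: "continuous_on (hyp K) (proj M)"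
    by (rule continuous_on_subset[OF continuous_on_proj[OF M]]) (auto simp: hyp_iff)
  have "continuous_on (hyp K) (\<lambda>z. M (z, 1))"
    by (rule has_derivative_continuous_on[OF has_derivative_lift[OF M]])
  then have cd: "continuous_on (hyp K) (den M)"
    unfolding den_def[abs_def] by (rule continuous_on_snd)
  have "continuous_on (hyp K) f"
    unfolding f_def real_det_def pderiv_at_def
    by (intro continuous_intros cp cd) (use d in auto)
  then have con: "connected (f ` hyp K)"
    by (rule connected_continuous_image) (rule convex_connected[OF convex_hyp])
  have nz: "f z \<noteq> 0" if "z \<in> hyp K" for z unfolding f_def by (rule real_det_pderiv_at[OF M that])
  define \<epsilon> where "\<epsilon> = sgn (f 0)"
  have "0 < \<epsilon> * f z" if z: "z \<in> hyp K" for z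
  proof (rule ccontr)
    assume "\<not> 0 < \<epsilon> * f z"
    then have "f 0 \<le> 0 \<and> 0 \<le> f z \<or> f z \<le> 0 \<and> 0 \<le> f 0"
      by (auto simp: \<epsilon>_def sgn_if not_less split: if_splits)
    then have "0 \<in> f ` hyp K"
      using connectedD_interval[OF con, of "f 0" "f z" 0] connectedD_interval[OF con, of "f z" "f 0" 0] z by auto
    then show False using nz by force
  qed
  moreover have "(pact M has_derivative pderiv_at M z) (at z within hyp K)" if z: "z \<in> hyp K" for z
    by (rule has_derivative_transform[OF z _ has_derivative_proj[OF M]]) (use z in \<open>auto simp: pact_def hyp_iff\<close>)
  ultimately have "oriented \<epsilon> (pact M)" unfolding oriented_def f_def by blast
  moreover have "\<epsilon> = 1 \<or> \<epsilon> = - 1" using nz[OF zero_hyp] by (auto simp: \<epsilon>_def sgn_if)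
  ultimately show ?thesis using that by blast
qed

lemma bdry_act_pact:
  assumes M: "UU M" and \<xi>: "\<xi> \<in> bdry K"
  shows "bdry_act K (pact M) \<xi> = proj M \<xi>"
proof (rule LIMSEQ_unique[OF bdry_act_rad[OF hyp_isom_pact[OF M] \<xi>]])
  have "(\<lambda>k. proj M (rad \<xi> k)) \<longlonglongrightarrow> proj M \<xi>"
    by (rule continuous_on_tendsto_compose[OF continuous_on_proj[OF M] rad(3)[OF \<xi>]])
       (use rad(1)[OF \<xi>] \<xi> in \<open>auto simp: hyp_iff bdry_iff less_imp_le\<close>)
  then show "(\<lambda>k. pact M (rad \<xi> k)) \<longlonglongrightarrow> proj M \<xi>" by (simp add: pact_def rad(1)[OF \<xi>])
qed

text \<open>Whatever the sign of \<open>pact M\<close> is, its square is 1. Complex reflections and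
  boosts are shown to preserve orientation by exhibiting a square root.\<close>

lemma oriented_pact_square:
  assumes M: "UU M"
  shows "oriented 1 (pact (\<lambda>Z. M (M Z)))"
proof -
  obtain \<epsilon> where e: "\<epsilon> = 1 \<or> \<epsilon> = - 1" "oriented \<epsilon> (pact M)" by (rule oriented_pact[OF M])
  have "oriented (\<epsilon> * \<epsilon>) (compose (hyp K) (pact M) (pact M))"
    by (rule oriented_compose[OF e(2) _ e(2)]) (simp_all add: hyp_isomD(3)[OF hyp_isom_pact[OF M]])
  then show ?thesis using e(1) by (auto simp: pact_compose[OF M M])
qed

lemma pact_in_G: "UU M \<Longrightarrow> oriented 1 (pact M) \<Longrightarrow> pact M \<in> carrier (Isom_plus K)"
  by (simp add: carrier_Isom_plus hyp_isom_pact)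

section \<open>Unitary reflections and their orientation\<close>

lemma refl_refl:
  assumes "form V V \<noteq> 0"
  shows "refl V u (refl V w Z) = refl V (u * w) Z"
proof -
  define a where "a = form Z V"
  have f: "form (refl V w Z) V = w * a"
    using assms by (simp add: refl_def form_simps a_def field_simps)
  have "refl V u (refl V w Z) = Z + sc ((w - 1) / form V V * a + (u - 1) / form V V * (w * a)) V"
    unfolding refl_def[of V u "refl V w Z"] f by (simp add: refl_def a_def sc_simps add.assoc)
  also have "(w - 1) / form V V * a + (u - 1) / form V V * (w * a) = (u * w - 1) / form V V * a"
    using assms by (simp add: field_simps)
  finally show ?thesis by (simp add: refl_def a_def)
qed

lemma KU_refl:
  assumes V: "V \<in> KZ" "form V V \<noteq> 0" and u: "u \<in> K" "cmod u = 1"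
  shows "KU (refl V u)"
  unfolding KU_def
proof (intro conjI allI ballI)
  show "linear (refl V u)" unfolding refl_def[abs_def] by (rule linear_form)
  show "refl V u (sc c Z) = sc c (refl V u Z)" for c Z
    by (simp add: refl_def form_simps sc_simps mult_ac)
  show "refl V u Z \<in> KZ" if "Z \<in> KZ" for Z
    using that V u by (simp add: refl_def form_in_K)
  fix Z W
  define f a b where "f = form V V" and "a = form Z V" and "b = form W V"
  have [simp]: "cnj f = f" by (simp add: f_def cnj_form)
  have f0: "f \<noteq> 0" using V by (simp add: f_def)
  have uu: "u * cnj u = 1" using u complex_norm_square[of u] by simp
  have "form (refl V u Z) (refl V u W)
      = form Z W + (cnj u - 1) / f * cnj b * a + (u - 1) / f * a * (cnj b + (cnj u - 1) / f * cnj b * f)"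
    unfolding refl_def form_simps by (simp add: cnj_form flip: f_def a_def b_def) (simp add: cnj_form b_def field_simps)
  also have "\<dots> = form Z W + (u * cnj u - 1) / f * (a * cnj b)"
    using f0 by (simp add: field_simps)
  finally show "form (refl V u Z) (refl V u W) = form Z W" by (simp add: uu)
qed

lemma UU_refl:
  assumes V: "V \<in> KZ" "form V V \<noteq> 0" and u: "u \<in> K" "cmod u = 1"
  shows "UU (refl V u)"
proof -
  have "u * cnj u = 1" using u complex_norm_square[of u] by simp
  moreover have "refl V 1 Z = Z" for Z by (simp add: refl_def sc_simps)
  ultimately show ?thesis
    unfolding UU_def using KU_refl[OF assms] KU_refl[OF V, of "cnj u"] u
    by (auto simp: refl_refl[OF V(2)] mult.commute intro!: exI[of _ "refl V (cnj u)"])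
qed

text \<open>A unit complex number \<open>u\<close> has a unit square root \<open>w\<close>, so
  \<open>refl V u\<close> is the square of \<open>refl V w\<close>. Over the reals
  \<open>u = - 1\<close> has no such root.\<close>

lemma oriented_refl_complex:
  assumes V: "form V V \<noteq> 0" and u: "cmod u = 1" and KC: "K = UNIV"
  shows "oriented 1 (pact (refl V u))"
proof -
  define w where "w = csqrt u"
  have w: "w * w = u" by (simp add: w_def power2_eq_square[symmetric])
  then have "cmod w * cmod w = 1" using u by (metis norm_mult)
  then have "cmod w = 1" using power2_eq_1_iff[of "cmod w"] norm_ge_zero[of w] by (auto simp: power2_eq_square)
  moreover have "V \<in> KZ" unfolding KZ_def Kvec_def using KC by (cases V) simp
  moreover have "w \<in> K" using KC by simp
  ultimately have "UU (refl V w)" using V by (intro UU_refl)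
  then show ?thesis using oriented_pact_square[of "refl V w"] by (simp add: refl_refl[OF V] w)
qed

text \<open>
  For \<open>K = \<real>\<close> the predicate ignores orientation: there the sign is corrected only at the end, by a
  reflection in a coordinate.
\<close>

definition UP :: "((complex ^ 'n) \<times> complex \<Rightarrow> (complex ^ 'n) \<times> complex) \<Rightarrow> bool" where
  "UP M \<longleftrightarrow> UU M \<and> (K = UNIV \<longrightarrow> oriented 1 (pact M))"

lemma UP_compose:
  assumes "UP M" "UP N"
  shows "UP (\<lambda>Z. M (N Z))"
proof -
  have U: "UU M" "UU N" using assms by (auto simp: UP_def)
  have "oriented 1 (pact (\<lambda>Z. M (N Z)))" if KC: "K = UNIV"
  proof -
    have "oriented 1 (pact M)" "oriented 1 (pact N)" using assms KC unfolding UP_def by blast+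
    then have "oriented (1 * 1) (compose (hyp K) (pact M) (pact N))"
      by (intro oriented_compose) (simp_all add: hyp_isomD(3)[OF hyp_isom_pact] U)
    then show ?thesis by (simp add: pact_compose U)
  qed
  then show ?thesis unfolding UP_def using UU_compose[OF U] by blast
qed

lemma UP_id: "UP (\<lambda>Z. Z)"
proof -
  have "pact (\<lambda>Z. Z) = (\<lambda>z\<in>hyp K. z)" by (simp add: pact_def)
  then show ?thesis unfolding UP_def using UU_id oriented_id by (metis (no_types))
qed

text \<open>
  The choice \<open>u = - cnj a / a\<close> solves \<open>Z + (u - 1) * a / (2 * Re a) * V = Z - V\<close>, and
  \<open>form V V = 2 * Re a\<close> because \<open>Z\<close> and \<open>W\<close> have the same length.
\<close>

lemma UP_move:
  assumes Z: "Z \<in> KZ" and W: "W \<in> KZ" and ZW: "form Z Z = form W W"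
    and V: "V = Z - W" and nd: "V = 0 \<or> form V V \<noteq> 0"
  obtains M where "UP M" "M Z = W" "\<And>T. form T V = 0 \<Longrightarrow> M T = T"
proof (cases "V = 0")
  case True
  then show ?thesis using that[of "\<lambda>Z. Z"] UP_id V by simp
next
  case False
  then have f: "form V V \<noteq> 0" using nd by simp
  define a where "a = form Z V"
  have fa: "form V V = a + cnj a"
  proof -
    have "form V V = form Z Z - form Z W - form W Z + form W W" by (simp add: V form_simps)
    moreover have "cnj a = form Z Z - form W Z" by (simp add: a_def cnj_form) (simp add: V form_simps)
    moreover have "a = form Z Z - form Z W" by (simp add: a_def V form_simps)
    ultimately show ?thesis using ZW by simp
  qed
  have a0: "a \<noteq> 0" using f fa by auto
  define u where "u = - cnj a / a"
  have VK: "V \<in> KZ" using Z W V by simp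
  have uK: "u \<in> K" using form_in_K[OF Z VK] by (simp add: u_def a_def)
  have u1: "cmod u = 1" using a0 by (simp add: u_def norm_divide)
  have "UP (refl V u)" using UU_refl[OF VK f uK u1] oriented_refl_complex[OF f u1] by (simp add: UP_def)
  moreover have "refl V u Z = W"
  proof -
    have "(u - 1) / form V V * form Z V = - 1"
    proof -
      have "u - 1 = - (a + cnj a) / a" using a0 by (simp add: u_def field_simps)
      then show ?thesis using a0 f unfolding fa a_def[symmetric] by (simp add: divide_eq_minus_1_iff)
    qed
    then have "refl V u Z = Z + sc (- 1) V" by (simp add: refl_def)
    also have "\<dots> = W" by (simp add: V prod_eq_iff vec_eq_iff)
    finally show ?thesis .
  qed
  moreover have "refl V u T = T" if "form T V = 0" for T using that by (simp add: refl_def sc_simps)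
  ultimately show ?thesis using that by blast
qed

end

section \<open>Transitivity on pairs and hyperbolic elements\<close>

text \<open>For a unit vector \<open>e\<close> and \<open>c\<close>, \<open>s\<close> the cosh and
  sinh of a number, this is the hyperbolic rotation in the plane of \<open>(e, 0)\<close> and
  \<open>(0, 1)\<close>: a translation along the geodesic joining \<open>- e\<close> and
  \<open>e\<close>.\<close>

definition boost :: "complex ^ 'n \<Rightarrow> real \<Rightarrow> real \<Rightarrow> (complex ^ 'n) \<times> complex \<Rightarrow> (complex ^ 'n) \<times> complex" where
  "boost e c s Z =
     (fst Z + (of_real (c - 1) * herm (fst Z) e + of_real s * snd Z) *s e,
      of_real s * herm (fst Z) e + of_real c * snd Z)"

text \<open>The new coefficients are the addition formulas of cosh and sinh. They provide the
  inverse, with \<open>s\<close> negated, and a square root.\<close>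

lemma boost_boost:
  assumes e: "norm e = 1"
  shows "boost e c s (boost e c' s' Z) = boost e (c * c' + s * s') (s * c' + c * s') Z"
proof -
  have ee: "herm e e = 1" using e by (simp add: herm_self)
  have "herm (fst (boost e c' s' Z)) e = of_real c' * herm (fst Z) e + of_real s' * snd Z"
    by (simp add: boost_def herm_add_left herm_scale_left ee) (simp add: algebra_simps)
  then show ?thesis
    unfolding boost_def[of e c s] by (simp add: boost_def vec_eq_iff algebra_simps)
qed

context hyp_field begin

lemma KU_boost:
  assumes e: "e \<in> Kvec K" "norm e = 1" and cs: "c\<^sup>2 - s\<^sup>2 = 1"
  shows "KU (boost e c s)"
  unfolding KU_def
proof (intro conjI allI ballI)
  show "linear (boost e c s)"
    by (rule linearI)
       (simp_all add: boost_def prod_eq_iff herm_add_left vec_eq_iff algebra_simps scaleR_sc herm_scale_left)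
  show "boost e c s (sc a Z) = sc a (boost e c s Z)" for a Z
    by (simp add: boost_def prod_eq_iff herm_scale_left vec_eq_iff algebra_simps)
  show "boost e c s Z \<in> KZ" if "Z \<in> KZ" for Z
    using that e KZ_D[OF that] by (simp add: boost_def)
  fix Z W :: "(complex ^ 'a) \<times> complex"
  have ee: "herm e e = 1" using e by (simp add: herm_self)
  have cs': "complex_of_real c * of_real c = 1 + of_real s * of_real s"
    using arg_cong[OF cs, of complex_of_real] by (simp add: power2_eq_square algebra_simps)
  define C S where "C = complex_of_real c" and "S = complex_of_real s"
  define a b where "a = herm (fst Z) e" and "b = herm (fst W) e"
  define A where "A = (C - 1) * a + S * snd Z"
  define B where "B = (C - 1) * b + S * snd W"
  have CC: "C * C = 1 + S * S" using cs' by (simp add: C_def S_def)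
  have cB: "cnj B = (C - 1) * cnj b + S * cnj (snd W)" by (simp add: B_def C_def S_def)
  have "form (boost e c s Z) (boost e c s W)
      = herm (fst Z) (fst W) + cnj B * a + A * cnj b + A * cnj B
        - (S * a + C * snd Z) * (S * cnj b + C * cnj (snd W))"
  proof -
    have "boost e c s Z = (fst Z + A *s e, S * a + C * snd Z)"
      "boost e c s W = (fst W + B *s e, S * b + C * snd W)"
      by (simp_all add: boost_def A_def B_def C_def S_def a_def b_def)
    then show ?thesis
      by (simp add: form_def herm_add_left herm_add_right herm_scale_left herm_scale_right ee)
        (simp add: a_def b_def cnj_herm C_def S_def algebra_simps)
  qed
  also have "\<dots> = herm (fst Z) (fst W) + (C * C - S * S - 1) * (a * cnj b) + (S * S - C * C) * (snd Z * cnj (snd W))"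
    unfolding cB A_def by (simp add: algebra_simps)
  also have "\<dots> = form Z W" by (simp add: CC form_def)
  finally show "form (boost e c s Z) (boost e c s W) = form Z W" .
qed

lemma UU_boost:
  assumes e: "e \<in> Kvec K" "norm e = 1" and cs: "c\<^sup>2 - s\<^sup>2 = 1"
  shows "UU (boost e c s)"
proof -
  have "boost e 1 0 Z = Z" for Z by (simp add: boost_def prod_eq_iff vec_eq_iff)
  moreover have "c * c - s * s = 1" using cs by (simp add: power2_eq_square)
  moreover have "KU (boost e c s)" "KU (boost e c (- s))" using KU_boost[OF e] cs by auto
  ultimately show ?thesis
    unfolding UU_def by (intro conjI exI[of _ "boost e c (- s)"]) (simp_all add: boost_boost[OF e(2)] mult.commute)
qed

lemma hyperbolic_element:
  assumes e: "e \<in> bdry K"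
  obtains g where "g \<in> carrier (Isom_plus K)" "\<And>\<xi>. \<xi> \<in> bdry K \<Longrightarrow> bdry_act K g \<xi> = \<xi> \<longleftrightarrow> \<xi> = e \<or> \<xi> = - e"
proof -
  have e': "e \<in> Kvec K" "norm e = 1" using e by (auto simp: bdry_iff)
  then have ee: "herm e e = 1" by (simp add: herm_self)
  \<comment> \<open>The numbers 5/4 and 3/4 are a rational pair with difference of squares 1.
    Doubling the argument gives 17/8 and 15/8, so \<open>N\<close> is a square root of
    \<open>M\<close>.\<close>
  define N where "N = boost e (5 / 4) (3 / 4)"
  define M where "M = boost e (17 / 8) (15 / 8)"
  have N: "UU N" unfolding N_def by (rule UU_boost[OF e']) (simp add: power2_eq_square)
  have M: "UU M" unfolding M_def by (rule UU_boost[OF e']) (simp add: power2_eq_square)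
  have "(\<lambda>Z. N (N Z)) = M" unfolding N_def M_def boost_boost[OF e'(2)] by (simp add: fun_eq_iff)
  then have "oriented 1 (pact M)" using oriented_pact_square[OF N] by simp
  then have "pact M \<in> carrier (Isom_plus K)" by (rule pact_in_G[OF M])
  moreover have "bdry_act K (pact M) \<xi> = \<xi> \<longleftrightarrow> \<xi> = e \<or> \<xi> = - e" if \<xi>: "\<xi> \<in> bdry K" for \<xi>
  proof -
    define h where "h = herm \<xi> e"
    have n\<xi>: "norm \<xi> \<le> 1" using \<xi> by (simp add: bdry_iff)
    have Mx: "M (\<xi>, 1) = (\<xi> + (9 / 8 * h + 15 / 8) *s e, 15 / 8 * h + 17 / 8)"
      by (simp add: M_def boost_def h_def)
    have "bdry_act K (pact M) \<xi> = \<xi> \<longleftrightarrow> proj M \<xi> = \<xi>" by (simp add: bdry_act_pact[OF M \<xi>])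
    also have "\<dots> \<longleftrightarrow> fst (M (\<xi>, 1)) = den M \<xi> *s \<xi>"
      using lift_proj[OF M n\<xi>] den_nonzero[OF M n\<xi>] by (auto simp: prod_eq_iff vec_eq_iff)
    also have "\<dots> \<longleftrightarrow> \<xi> + (9 / 8 * h + 15 / 8) *s e = (15 / 8 * h + 17 / 8) *s \<xi>"
      by (simp add: Mx den_def)
    also have "\<dots> \<longleftrightarrow> (9 * h + 15) *s e = (15 * h + 9) *s \<xi>"
    proof -
      have eqv: "a + (9 / 8 * h + 15 / 8) * b = (15 / 8 * h + 17 / 8) * a \<longleftrightarrow> (9 * h + 15) * b = (15 * h + 9) * a"
        for a b
      proof -
        have *: "a + (9 / 8 * h + 15 / 8) * b - (15 / 8 * h + 17 / 8) * a
            = 1 / 8 * ((9 * h + 15) * b - (15 * h + 9) * a)"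
          by (simp add: field_simps)
        show ?thesis
          unfolding eq_iff_diff_eq_0[of "a + (9 / 8 * h + 15 / 8) * b"]
            eq_iff_diff_eq_0[of "(9 * h + 15) * b"] * by simp
      qed
      show ?thesis by (simp only: vec_eq_iff vector_add_component vector_smult_component eqv)
    qed
    also have "\<dots> \<longleftrightarrow> \<xi> = e \<or> \<xi> = - e"
    proof
      \<comment> \<open>Pairing with \<open>e\<close> leaves h^2 = 1. For h = 1 both coefficients
        are 24, for h = -1 they are 6 and -6; being nonzero, they determine
        \<open>\<xi>\<close>.\<close>
      assume eq: "(9 * h + 15) *s e = (15 * h + 9) *s \<xi>"
      have "herm ((9 * h + 15) *s e) e = herm ((15 * h + 9) *s \<xi>) e"
        by (rule arg_cong[OF eq, of "\<lambda>v. herm v e"])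
      then have "9 * h + 15 = (15 * h + 9) * h" by (simp only: herm_scale_left ee h_def[symmetric] mult_1_right)
      then have "(h - 1) * (h + 1) = 0" by (simp add: field_simps)
      then consider "h = 1" | "h = - 1" by (auto simp: eq_neg_iff_add_eq_0)
      then show "\<xi> = e \<or> \<xi> = - e"
        by cases (use eq in \<open>auto simp: vec_eq_iff\<close>)
    next
      assume "\<xi> = e \<or> \<xi> = - e"
      then show "(9 * h + 15) *s e = (15 * h + 9) *s \<xi>"
      proof
        assume x: "\<xi> = e"
        then have "h = 1" by (simp add: h_def ee)
        then show ?thesis by (simp add: x)
      next
        assume x: "\<xi> = - e"
        then have "h = - 1" by (simp add: h_def ee herm_uminus_left)
        then show ?thesis by (simp add: x vec_eq_iff)
      qed
    qed
    finally show ?thesis .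
  qed
  ultimately show ?thesis using that by blast
qed

text \<open>A Witt-type argument in two moves. For suitably scaled null lifts \<open>X1\<close> and
  \<open>Y1\<close> the sum is a negative vector and is moved to \<open>(0, 2)\<close>; half the
  difference is orthogonal to it and is then moved to \<open>(e, 0)\<close> with
  \<open>(0, 2)\<close> kept fixed. Sum and difference recover the images \<open>(e, 1)\<close> and
  \<open>(- e, 1)\<close>.\<close>

lemma UP_transitive:
  fixes x y e :: "complex ^ 'n"
  assumes x: "x \<in> bdry K" and y: "y \<in> bdry K" and xy: "x \<noteq> y" and e: "e \<in> bdry K"
  obtains M where "UP M" "proj M x = e" "proj M y = - e"
proof -
  define a where "a = form (x, 1) (y, 1)"
  have xK: "(x, 1) \<in> KZ" "(y, 1) \<in> KZ" "(e, 1) \<in> KZ" "(e, 0) \<in> KZ" "(0 :: complex ^ 'n, 2) \<in> KZ"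
    using x y e K_closed(3)[of 2] by (auto simp: bdry_iff KZ_def)
  have xx: "form (x, 1) (x, 1) = 0" "form (y, 1) (y, 1) = 0"
    using x y by (simp_all add: form_self bdry_iff)
  have aK: "a \<in> K" unfolding a_def by (rule form_in_K) (use xK in auto)
  have a0: "a \<noteq> 0" using rho_bdry_eq_0[OF x y] xy by (auto simp: a_def form_def rho_def)
  \<comment> \<open>Rescale the null vectors so that their product is \<open>-2\<close>, the product of \<open>(e, 1)\<close> and \<open>(-e, 1)\<close>.\<close>
  define b where "b = - 2 / cnj a"
  have bK: "b \<in> K" using aK K_closed(3)[of 2] by (simp add: b_def)
  have b0: "b \<noteq> 0" using a0 by (simp add: b_def)
  define S0 where "S0 = (x, 1) + sc b (y, 1)"
  have prod: "form (x, 1) (sc b (y, 1)) = - 2" "form (sc b (y, 1)) (x, 1) = - 2"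
  proof -
    have "form (y, 1) (x, 1) = cnj a" by (simp add: a_def cnj_form)
    then show "form (x, 1) (sc b (y, 1)) = - 2" "form (sc b (y, 1)) (x, 1) = - 2"
      using a0 by (simp_all add: form_simps b_def flip: a_def)
  qed
  have S0: "form S0 S0 = - 4"
    unfolding S0_def by (simp add: form_simps(1,2) prod) (simp add: form_simps xx)
  have S0K: "S0 \<in> KZ" using xK bK by (simp add: S0_def)
  define t where "t = cmod (snd S0)"
  have t2: "t\<^sup>2 = 4 + (norm (fst S0))\<^sup>2"
  proof -
    have "complex_of_real ((norm (fst S0))\<^sup>2 - t\<^sup>2) = of_real (- 4)"
      using S0 by (simp add: form_self t_def)
    then have "(norm (fst S0))\<^sup>2 - t\<^sup>2 = - 4" by (simp only: of_real_eq_iff)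
    then show ?thesis by simp
  qed
  then have t0: "t \<ge> 2" using power2_le_imp_le[of 2 t] by (simp add: t_def)
  \<comment> \<open>This unit scalar makes the last coordinate of \<open>X1 + Y1\<close> the
    positive real \<open>t\<close>, which is at least 2. Then \<open>form V V = 4 * t - 8\<close>
    below vanishes only for t = 2, when \<open>V\<close> itself is 0, as \<open>UP_move\<close>
    demands.\<close>
  define w where "w = of_real t / snd S0"
  have s0: "snd S0 \<noteq> 0" using t0 by (auto simp: t_def)
  have wK: "w \<in> K" using KZ_D(2)[OF S0K] by (simp add: w_def)
  have w1: "cmod w = 1" using t0 s0 by (simp add: w_def norm_divide t_def)
  have ww: "w * cnj w = 1" using complex_norm_square[of w] w1 by simp
  have w0: "w \<noteq> 0" using w1 by auto
  define X1 Y1 where "X1 = sc w (x, 1)" and "Y1 = sc (w * b) (y, 1)"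
  have XY: "X1 \<in> KZ" "Y1 \<in> KZ" using xK wK bK by (auto simp: X1_def Y1_def)
  have Yb: "Y1 = sc w (sc b (y, 1))" by (simp add: Y1_def sc_simps)
  have fXY: "form X1 X1 = 0" "form Y1 Y1 = 0" "form X1 Y1 = - 2" "form Y1 X1 = - 2"
    unfolding Yb X1_def form_simps(5,6)[where c = w] prod
    using ww by (simp_all add: xx form_simps mult_ac)
  have sS: "snd (X1 + Y1) = of_real t"
  proof -
    have "snd (X1 + Y1) = w * snd S0" by (simp add: X1_def Y1_def S0_def distrib_left)
    then show ?thesis using s0 by (simp add: w_def)
  qed
  define V where "V = (X1 + Y1) - (0, 2)"
  have fV: "form V V = of_real (4 * t - 8)"
  proof -
    have "form (X1 + Y1) (0, 2) = - 2 * of_real t" "form (0, 2) (X1 + Y1) = - 2 * of_real t"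
      using sS by (simp_all add: form_def)
    moreover have "form (X1 + Y1) (X1 + Y1) = - 4" by (simp add: form_simps fXY)
    moreover have "form V V = form (X1 + Y1) (X1 + Y1) - form (X1 + Y1) (0, 2) - form (0, 2) (X1 + Y1) + form (0 :: complex ^ 'n, 2) (0, 2)"
      unfolding V_def by (simp only: form_simps(3,4)) simp
    ultimately show ?thesis by (simp add: form_def)
  qed
  have V0: "V = 0" if "t = 2"
  proof -
    have "fst S0 = 0" using t2 that by simp
    moreover have "X1 + Y1 = sc w S0" by (simp add: X1_def Yb S0_def sc_simps)
    ultimately have "fst (X1 + Y1) = 0" by simp
    then show ?thesis using sS that by (simp add: V_def prod_eq_iff)
  qed
  have V: "V = 0 \<or> form V V \<noteq> 0"
    using V0 unfolding fV of_real_eq_0_iff by auto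
  have eqf: "form (X1 + Y1) (X1 + Y1) = form (0 :: complex ^ 'n, 2) (0, 2)"
    by (simp add: form_simps(1,2) fXY) (simp add: form_def)
  obtain N where N: "UP N" "N (X1 + Y1) = (0, 2)"
    using UP_move[OF _ _ eqf V_def V] XY xK by blast
  have Nlin: "linear N" "\<And>Z W. form (N Z) (N W) = form Z W" "\<And>Z. Z \<in> KZ \<Longrightarrow> N Z \<in> KZ"
    "\<And>c Z. N (sc c Z) = sc c (N Z)"
    using N(1) by (auto simp: UP_def UU_def KU_def)
  define D where "D = N (sc (1 / 2) (X1 - Y1))"
  have hK: "1 / 2 \<in> K" using K_closed(3)[of "1 / 2"] by simp
  have DK: "D \<in> KZ" using XY Nlin(3) hK by (simp add: D_def)
  have "form D (0, 2) = form (sc (1 / 2) (X1 - Y1)) (X1 + Y1)" unfolding D_def N(2)[symmetric] by (rule Nlin(2))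
  also have "\<dots> = 0" by (simp add: form_simps fXY)
  finally have sD: "snd D = 0" by (simp add: form_def)
  have fD: "form D D = 1" unfolding D_def Nlin(2) by (simp add: form_simps fXY)
  have ee: "form (e, 0) (e, 0) = 1" using e by (simp add: form_self bdry_iff)
  \<comment> \<open>Both vectors have last coordinate 0, and on such vectors the form is positive
    definite.\<close>
  have "D - (e, 0) = 0 \<or> form (D - (e, 0)) (D - (e, 0)) \<noteq> 0"
    using sD by (auto simp: form_self prod_eq_iff)
  moreover have "form D D = form (e, 0) (e, 0)" by (simp add: fD ee)
  ultimately obtain R where R: "UP R" "R D = (e, 0)" "\<And>T. form T (D - (e, 0)) = 0 \<Longrightarrow> R T = T"
    using UP_move[OF DK xK(4) _ refl] by blast
  \<comment> \<open>The mirror vector \<open>D - (e, 0)\<close> is orthogonal to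
    \<open>(0, 2)\<close>, so the second move preserves what the first one achieved.\<close>
  have R2: "R (0, 2) = (0, 2)" by (rule R(3)) (simp add: form_def sD)
  have Rlin: "linear R" "\<And>c Z. R (sc c Z) = sc c (R Z)" using R(1) by (auto simp: UP_def UU_def KU_def)
  define M where "M = (\<lambda>Z. R (N Z))"
  have M: "UP M" unfolding M_def by (rule UP_compose[OF R(1) N(1)])
  have Mlin: "linear M" "\<And>c Z. M (sc c Z) = sc c (M Z)" using M by (auto simp: UP_def UU_def KU_def)
  have M1: "M (sc (1 / 2) (X1 + Y1)) = (0, 1)"
    unfolding M_def Nlin(4) N(2) Rlin(2) R2 by (simp add: prod_eq_iff)
  have M2: "M (sc (1 / 2) (X1 - Y1)) = (e, 0)"
    unfolding M_def using R(2) by (simp add: D_def)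
  have "X1 = sc (1 / 2) (X1 + Y1) + sc (1 / 2) (X1 - Y1)" "Y1 = sc (1 / 2) (X1 + Y1) - sc (1 / 2) (X1 - Y1)"
    by (simp_all add: prod_eq_iff vec_eq_iff field_simps)
  then have MXY: "M X1 = (e, 1)" "M Y1 = (- e, 1)"
    using linear_add[OF Mlin(1)] linear_diff[OF Mlin(1)] M1 M2 by (metis add_0 add.right_neutral add_Pair, metis diff_0 diff_zero diff_Pair)
  have "M (x, 1) = sc (1 / w) (e, 1)"
  proof -
    have "(x, 1) = sc (1 / w) X1" using w0 by (simp add: X1_def sc_simps)
    then show ?thesis using MXY Mlin(2) by simp
  qed
  moreover have "M (y, 1) = sc (1 / (w * b)) (- e, 1)"
  proof -
    have "(y, 1) = sc (1 / (w * b)) Y1" using w0 b0 by (simp add: Y1_def sc_simps)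
    then show ?thesis using MXY Mlin(2) by simp
  qed
  ultimately have "proj M x = e" "proj M y = - e"
    using proj_unique(1)[of M x "1 / w" e] proj_unique(1)[of M y "1 / (w * b)" "- e"] w0 b0 by auto
  then show ?thesis using that M by blast
qed

text \<open>Negating coordinate \<open>j\<close> is linear with diagonal Jacobian of determinant -1,
  and it fixes the standard pair, which lives in coordinate \<open>i\<close>.\<close>

lemma coordinate_reflection:
  fixes i j :: "'n::finite"
  assumes KR: "K = \<real>" and ij: "i \<noteq> j"
  obtains M where "UU M" "oriented (- 1) (pact M)" "proj M (axis i 1) = axis i 1" "proj M (- axis i 1) = - axis i 1"
proof -
  define v where "v = (axis j 1 :: complex ^ 'n)"
  have vK: "v \<in> Kvec K" by (simp add: v_def axis_Kvec)
  have nv: "norm v = 1" by (simp add: v_def)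
  have fv: "form (v, 0) (v, 0) = 1" by (simp add: form_self nv)
  define M where "M = refl (v, 0) (- 1)"
  have M: "UU M" unfolding M_def by (rule UU_refl) (use vK fv in auto)
  have hv: "herm z v = z $ j" for z
    by (simp add: herm_def v_def axis_def if_distrib[of cnj] if_distrib[of "(*) _"] cong: if_cong)
  have MZ: "M Z = (fst Z - (2 * fst Z $ j) *s v, snd Z)" for Z
    by (simp add: M_def refl_def fv prod_eq_iff) (simp add: form_def hv vec_eq_iff)
  have pz: "proj M z = z - (2 * z $ j) *s v" for z by (simp add: proj_def den_def MZ vec_eq_iff)
  have pd: "pderiv_at M z h = h - (2 * h $ j) *s v" for z h
    by (simp add: pderiv_at_def den_def MZ vec_eq_iff)
  have rd: "real_det K (pderiv_at M z) = - 1" for z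
  proof -
    have "bij_betw (\<lambda>i. axis i 1 :: complex ^ 'n) UNIV (Kbasis K)"
      by (auto simp: KR Kbasis_real bij_betw_def inj_def axis_eq_axis)
    from real_det_det[OF this]
    have "real_det K (pderiv_at M z) = det (\<chi> k l. pderiv_at M z (axis k 1) \<bullet> axis l 1)" .
    also have "(\<chi> k l. pderiv_at M z (axis k 1) \<bullet> axis l 1)
        = (\<chi> k l. if k = l then if k = j then - 1 else 1 else (0 :: real))"
      unfolding vec_eq_iff by (simp add: pd inner_axis v_def) (simp add: axis_def)
    also have "det \<dots> = (\<Prod>k\<in>UNIV. if k = j then - 1 else 1)"
      by (subst det_diagonal) simp_all
    also have "\<dots> = - 1" by (simp add: prod.If_cases)
    finally show ?thesis .
  qed
  have der: "(pact M has_derivative pderiv_at M z) (at z within hyp K)" if z: "z \<in> hyp K" for z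
    by (rule has_derivative_transform[OF z _ has_derivative_proj[OF M]]) (use z in \<open>auto simp: pact_def hyp_iff\<close>)
  have "oriented (- 1) (pact M)" unfolding oriented_def
  proof
    fix z :: "complex ^ 'n" assume "z \<in> hyp K"
    then show "\<exists>L. (pact M has_derivative L) (at z within hyp K) \<and> 0 < - 1 * real_det K L"
      using der[of z] rd[of z] by (intro exI[of _ "pderiv_at M z"]) simp
  qed
  moreover have "proj M (axis i 1) = axis i 1" "proj M (- axis i 1) = - axis i 1"
    using ij by (simp_all add: pz axis_def vec_eq_iff)
  ultimately show ?thesis using that M by blast
qed

text \<open>If the isometry from \<open>UP_transitive\<close> reverses orientation, then
  \<open>K\<close> is real, and composing with \<open>coordinate_reflection\<close> corrects the
  sign without disturbing the standard pair.\<close>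

lemma transitive_standard:
  fixes i j :: "'n::finite"
  assumes xy: "(x, y) \<in> bdry2 K" and ij: "K = UNIV \<or> i \<noteq> j"
  obtains g where "g \<in> carrier (Isom_plus K)" "act2 K g (x, y) = (axis i 1, - axis i 1)"
proof -
  define e where "e = (axis i 1 :: complex ^ 'n)"
  have e: "e \<in> bdry K" "- e \<in> bdry K" by (auto simp: e_def bdry_iff axis_Kvec)
  have xy': "x \<in> bdry K" "y \<in> bdry K" "x \<noteq> y" using xy by (auto simp: bdry2_def)
  obtain M where M: "UP M" "proj M x = e" "proj M y = - e"
    using UP_transitive[OF xy' e(1)] by blast
  have UM: "UU M" using M(1) by (simp add: UP_def)
  show ?thesis
  proof (cases "oriented 1 (pact M)")
    case True
    then show ?thesis
      using that[OF pact_in_G[OF UM True]] M(2,3) by (simp add: act2_def bdry_act_pact[OF UM] xy' e_def)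
  next
    case False
    then have neg: "oriented (- 1) (pact M)" using oriented_pact[OF UM] by metis
    have KC: "K \<noteq> UNIV" using False M(1) unfolding UP_def by blast
    then have KR: "K = \<real>" and ne: "i \<noteq> j" using K ij by auto
    obtain R where R: "UU R" "oriented (- 1) (pact R)" "proj R e = e" "proj R (- e) = - e"
      using coordinate_reflection[OF KR ne] unfolding e_def by metis
    have "oriented (- 1 * - 1) (compose (hyp K) (pact R) (pact M))"
      by (rule oriented_compose[OF R(2) _ neg]) (simp_all add: hyp_isomD(3)[OF hyp_isom_pact] UM R(1))
    then have "pact (\<lambda>Z. R (M Z)) \<in> carrier (Isom_plus K)"
      using UU_compose[OF R(1) UM] by (intro pact_in_G) (simp_all add: pact_compose R(1) UM)
    moreover have "bdry_act K (pact (\<lambda>Z. R (M Z))) z = proj R (proj M z)" if "z = x \<or> z = y" for z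
    proof -
      have z: "z \<in> bdry K" "norm (proj M z) \<le> 1" "norm z \<le> 1"
        using that xy' M(2,3) e by (auto simp: bdry_iff)
      then show ?thesis
        by (simp add: bdry_act_pact[OF UU_compose[OF R(1) UM]] proj_compose(1)[OF R(1) UM])
    qed
    ultimately show ?thesis using that M(2,3) R(3,4) by (simp add: act2_def e_def)
  qed
qed

end

section \<open>The action on pairs and on triples of boundary points\<close>

context hyp_field begin

lemma G_isom: "g \<in> carrier (Isom_plus K) \<Longrightarrow> hyp_isom g"
  by (simp add: carrier_Isom_plus)

lemma act2_bdry2: "hyp_isom g \<Longrightarrow> q \<in> bdry2 K \<Longrightarrow> act2 K g q \<in> bdry2 K"
  by (auto simp: bdry2_def act2_def bdry_act_tendsto(2) bdry_act_eq_iff)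

lemma act2_compose:
  "hyp_isom g \<Longrightarrow> hyp_isom h \<Longrightarrow> q \<in> bdry2 K \<Longrightarrow> act2 K (compose (hyp K) g h) q = act2 K g (act2 K h q)"
  by (auto simp: bdry2_def act2_def bdry_act_compose)

lemma act2_id: "q \<in> bdry2 K \<Longrightarrow> act2 K (\<lambda>x\<in>hyp K. x) q = q"
  by (auto simp: bdry2_def act2_def bdry_act_id)

lemma compose_hinv:
  assumes g: "hyp_isom g"
  shows "compose (hyp K) g (hinv g) = (\<lambda>x\<in>hyp K. x)" "compose (hyp K) (hinv g) g = (\<lambda>x\<in>hyp K. x)"
  by (auto simp: compose_def restrict_def fun_eq_iff hinv[OF g])

lemma act2_hinv:
  assumes "hyp_isom g" "q \<in> bdry2 K"
  shows "act2 K g (act2 K (hinv g) q) = q" "act2 K (hinv g) (act2 K g q) = q"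
  using act2_compose[OF assms(1) hinv(4)[OF assms(1)] assms(2)]
    act2_compose[OF hinv(4)[OF assms(1)] assms(1) assms(2)]
  by (simp_all add: compose_hinv[OF assms(1)] act2_id[OF assms(2)])

lemma act2_swap: "act2 K g (prod.swap q) = prod.swap (act2 K g q)"
  by (simp add: act2_def prod.swap_def)

lemma bdry2_swap: "q \<in> bdry2 K \<Longrightarrow> prod.swap q \<in> bdry2 K"
  by (auto simp: bdry2_def)

lemma act2_transitive:
  fixes i j :: "'n::finite"
  assumes q: "q \<in> bdry2 K" and r: "r \<in> (bdry2 K :: ((complex ^ 'n) \<times> (complex ^ 'n)) set)" and ij: "K = UNIV \<or> i \<noteq> j"
  obtains g where "g \<in> carrier (Isom_plus K)" "act2 K g q = r"
proof -
  obtain g where g: "g \<in> carrier (Isom_plus K)" "act2 K g q = (axis i 1, - axis i 1)"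
    using transitive_standard[of "fst q" "snd q" i j] q ij by auto
  obtain h where h: "h \<in> carrier (Isom_plus K)" "act2 K h r = (axis i 1, - axis i 1)"
    using transitive_standard[of "fst r" "snd r" i j] r ij by auto
  have gh: "hyp_isom g" "hyp_isom h" using g h by (auto simp: G_isom)
  have hi: "hinv h \<in> carrier (Isom_plus K)"
    using group.inv_closed[OF group_Isom_plus h(1)] inv_Isom_plus[OF h(1)] by simp
  have "compose (hyp K) (hinv h) g \<in> carrier (Isom_plus K)"
    using monoid.m_closed[OF group.is_monoid[OF group_Isom_plus] hi g(1)] mult_Isom_plus gh hinv(4) by metis
  moreover have "act2 K (compose (hyp K) (hinv h) g) q = r"
    using act2_compose[OF hinv(4)[OF gh(2)] gh(1) q] act2_hinv(2)[OF gh(2) r] g(2) h(2) by simp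
  ultimately show ?thesis using that by blast
qed

lemma continuous_on_act2:
  assumes "hyp_isom g"
  shows "continuous_on (bdry2 K) (act2 K g)"
  unfolding act2_def map_prod_def case_prod_beta
  by (intro continuous_intros continuous_on_compose2[OF continuous_on_bdry_act[OF assms]])
     (auto simp: bdry2_def)

text \<open>Antipodal pairs along an arc of the circle through \<open>axis i 1\<close> and
  \<open>axis j 1\<close> already form a continuum.\<close>

lemma uncountable_bdry2:
  fixes i j :: "'n::finite"
  assumes ij: "i \<noteq> j"
  shows "uncountable (bdry2 K :: ((complex ^ 'n) \<times> (complex ^ 'n)) set)"
proof
  define v where "v = (\<lambda>t. t *\<^sub>R axis i 1 + sqrt (1 - t\<^sup>2) *\<^sub>R axis j 1 :: complex ^ 'n)"
  define w where "w = (\<lambda>t. (v t, - v t))"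
  have vK: "v t \<in> Kvec K" for t by (simp add: v_def axis_Kvec)
  have vn: "norm (v t) = 1" if "t \<in> {0<..<1}" for t :: real
  proof -
    have "t\<^sup>2 \<le> 1" using that by (simp add: power_le_one)
    moreover have "v t \<bullet> v t = t * t + sqrt (1 - t\<^sup>2) * sqrt (1 - t\<^sup>2)"
      using ij by (simp add: v_def inner_add_left inner_add_right inner_axis_axis)
    ultimately show ?thesis by (simp add: norm_eq_1 power2_eq_square)
  qed
  have "w ` {0<..<1} \<subseteq> bdry2 K"
  proof
    fix q assume "q \<in> w ` {0<..<1}"
    then obtain t where t: "t \<in> {0<..<1}" "q = w t" by blast
    have "v t \<noteq> 0" using vn[OF t(1)] by auto
    then have "v t + v t \<noteq> 0" by (simp flip: scaleR_2)
    then have "v t \<noteq> - v t" unfolding eq_neg_iff_add_eq_0 .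
    then show "q \<in> bdry2 K" using t vn[of t] vK[of t] by (auto simp: w_def bdry2_def bdry_iff)
  qed
  moreover have "inj_on w {0<..<1}"
  proof (rule inj_onI)
    fix s t assume "w s = w t"
    then have "Re (v s $ i) = Re (v t $ i)" by (simp add: w_def)
    then show "s = t" using ij by (simp add: v_def axis_def)
  qed
  moreover assume "countable (bdry2 K :: ((complex ^ 'n) \<times> (complex ^ 'n)) set)"
  ultimately have "countable {0<..<1 :: real}"
    by (meson countable_image_inj_on countable_subset)
  then show False using uncountable_open_interval[of 0 1] by simp
qed

end

section \<open>Discrete groups: countability and properness on triples\<close>

locale discrete_group = hyp_field +
  fixes \<Gamma> :: "(complex ^ 'n \<Rightarrow> complex ^ 'n) set"
  assumes sub: "subgroup \<Gamma> (Isom_plus K)"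
    and discrete: "discrete_isometries K \<Gamma>"
begin

lemma \<Gamma>_G: "\<gamma> \<in> \<Gamma> \<Longrightarrow> \<gamma> \<in> carrier (Isom_plus K)"
  using subgroup.subset[OF sub] by blast

lemma \<Gamma>_isom: "\<gamma> \<in> \<Gamma> \<Longrightarrow> hyp_isom \<gamma>"
  using \<Gamma>_G G_isom by blast

lemma \<Gamma>_id: "(\<lambda>x\<in>hyp K. x) \<in> \<Gamma>"
  using subgroup.one_closed[OF sub] by (simp add: one_Isom_plus)

lemma \<Gamma>_hinv: "\<gamma> \<in> \<Gamma> \<Longrightarrow> hinv \<gamma> \<in> \<Gamma>"
  using subgroup.m_inv_closed[OF sub] inv_Isom_plus \<Gamma>_G by metis

lemma \<Gamma>_compose: "\<gamma> \<in> \<Gamma> \<Longrightarrow> \<delta> \<in> \<Gamma> \<Longrightarrow> compose (hyp K) \<gamma> \<delta> \<in> \<Gamma>"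
  using subgroup.m_closed[OF sub] mult_Isom_plus \<Gamma>_isom by metis

text \<open>Discreteness makes the identity an open point of \<open>\<Gamma>\<close>, and a basic
  neighbourhood for pointwise convergence restricts the values at finitely many points only.\<close>

lemma isolated_identity:
  obtains F \<epsilon> where "finite F" "F \<subseteq> hyp K" "0 < \<epsilon>"
    "\<And>\<gamma>. \<gamma> \<in> \<Gamma> \<Longrightarrow> (\<And>z. z \<in> F \<Longrightarrow> dist (\<gamma> z) z < \<epsilon>) \<Longrightarrow> \<gamma> = (\<lambda>x\<in>hyp K. x)"
proof -
  let ?e = "\<lambda>x\<in>hyp K. x :: complex ^ 'n"
  let ?P = "product_topology (\<lambda>_. top_of_set (hyp K :: (complex ^ 'n) set)) (hyp K :: (complex ^ 'n) set)"
  have "openin (subtopology ?P \<Gamma>) {?e}"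
    using discrete \<Gamma>_id by (simp add: discrete_isometries_def)
  then obtain T where T: "openin ?P T" "{?e} = T \<inter> \<Gamma>" by (auto simp: openin_subtopology)
  then have "?e \<in> T" by blast
  from bspec[OF T(1)[unfolded openin_product_topology_alt] this]
  obtain U where U: "finite {z \<in> hyp K. U z \<noteq> topspace (top_of_set (hyp K))}"
      "\<And>z. z \<in> hyp K \<Longrightarrow> openin (top_of_set (hyp K)) (U z)" "?e \<in> Pi\<^sub>E (hyp K) U" "Pi\<^sub>E (hyp K) U \<subseteq> T"
    by blast
  define F where "F = {z \<in> hyp K. U z \<noteq> hyp K}"
  have finF: "finite F" using U(1) by (simp add: F_def)
  have "\<exists>\<epsilon>>0. ball z \<epsilon> \<inter> hyp K \<subseteq> U z" if "z \<in> F" for z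
  proof -
    have "z \<in> hyp K" using that by (simp add: F_def)
    moreover from this have "z \<in> U z" using U(3) by (auto simp: PiE_iff)
    ultimately show ?thesis using U(2)[of z] by (auto simp: openin_contains_ball)
  qed
  then obtain r where r: "\<And>z. z \<in> F \<Longrightarrow> 0 < r z \<and> ball z (r z) \<inter> hyp K \<subseteq> U z" by metis
  \<comment> \<open>The inserted 1 keeps the minimum defined when \<open>F\<close> is empty.\<close>
  define \<epsilon> where "\<epsilon> = Min (insert 1 (r ` F))"
  have eps: "0 < \<epsilon>" "\<And>z. z \<in> F \<Longrightarrow> \<epsilon> \<le> r z"
    using finF r by (auto simp: \<epsilon>_def)
  have "\<gamma> = ?e" if \<gamma>: "\<gamma> \<in> \<Gamma>" and cl: "\<And>z. z \<in> F \<Longrightarrow> dist (\<gamma> z) z < \<epsilon>" for \<gamma>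
  proof -
    have "\<gamma> z \<in> U z" if z: "z \<in> hyp K" for z
    proof (cases "z \<in> F")
      case True
      have "\<gamma> z \<in> ball z (r z)" using cl[OF True] eps(2)[OF True] by (simp add: dist_commute)
      then show ?thesis using r[OF True] hyp_isomD(3)[OF \<Gamma>_isom[OF \<gamma>] z] by blast
    next
      case False
      then show ?thesis using z hyp_isomD(3)[OF \<Gamma>_isom[OF \<gamma>] z] by (simp add: F_def)
    qed
    then have "\<gamma> \<in> Pi\<^sub>E (hyp K) U" using hyp_isomD(2)[OF \<Gamma>_isom[OF \<gamma>]] by (simp add: PiE_iff)
    then show ?thesis using U(4) \<gamma> T(2) by blast
  qed
  moreover have "F \<subseteq> hyp K" by (auto simp: F_def)
  ultimately show ?thesis using that finF eps(1) by blast
qed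

text \<open>Bolzano-Weierstrass, one point of \<open>F\<close> at a time. The bound
  \<open>\<kappa>\<close> keeps the limits off the sphere: it bounds \<open>conf (g k) z\<close>
  below by \<open>sqrt \<kappa> / 2\<close>, whence 1 - |g k z|^2 is at least (1 - |z|^2) times
  \<open>\<kappa> / 4\<close>.\<close>

lemma bounded_subsequence:
  fixes g :: "nat \<Rightarrow> complex ^ 'n \<Rightarrow> complex ^ 'n"
  assumes g: "\<And>k. hyp_isom (g k)" and \<kappa>: "0 < \<kappa>" "\<And>k. \<kappa> \<le> 1 - (norm (g k 0))\<^sup>2"
    and F: "finite F" "F \<subseteq> (hyp K :: (complex ^ 'n) set)"
  shows "\<exists>r. strict_mono r \<and> (\<forall>z\<in>F. \<exists>a. norm a < 1 \<and> (\<lambda>k. g (r k) z) \<longlonglongrightarrow> a)"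
  using F
proof (induction F rule: finite_induct)
  case empty
  show ?case by (rule exI[of _ "\<lambda>k :: nat. k"]) (simp add: strict_mono_def)
next
  case (insert z F)
  then obtain r where r: "strict_mono r" "\<And>y. y \<in> F \<Longrightarrow> \<exists>a. norm a < 1 \<and> (\<lambda>k. g (r k) y) \<longlonglongrightarrow> a"
    by auto
  have z: "z \<in> hyp K" using insert by auto
  define b where "b = (1 - (norm z)\<^sup>2) * (\<kappa> / 4)"
  have b0: "0 < b" using norm_sq_less_1[OF hyp_norm[OF z]] \<kappa> by (simp add: b_def)
  have nb: "(norm (g k z))\<^sup>2 \<le> 1 - b" for k
  proof -
    have nz: "norm z \<le> 1" using z by (simp add: hyp_iff)
    have "sqrt \<kappa> / 2 \<le> sqrt (1 - (norm (g k 0))\<^sup>2) / 2" using \<kappa>(2)[of k] by simp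
    also have "\<dots> \<le> conf (g k) z" by (rule conf_bounds[OF g nz])
    finally have "(sqrt \<kappa> / 2)\<^sup>2 \<le> (conf (g k) z)\<^sup>2" using \<kappa> by (intro power_mono) auto
    then have "\<kappa> / 4 \<le> (conf (g k) z)\<^sup>2" using \<kappa> by (simp add: power_divide)
    then have "b \<le> (1 - (norm z)\<^sup>2) * (conf (g k) z)\<^sup>2"
      unfolding b_def using norm_sq_less_1[OF hyp_norm[OF z]] by (intro mult_left_mono) auto
    also have "\<dots> = rho (g k z) (g k z)"
      by (simp add: rho_isom[OF g z z] rho_self[OF nz] power2_eq_square)
    also have "\<dots> = 1 - (norm (g k z))\<^sup>2"
      using hyp_isomD(3)[OF g z] by (simp add: rho_self hyp_iff less_imp_le)
    finally show ?thesis by simp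
  qed
  have "bounded (range (\<lambda>k. g (r k) z))"
    using hyp_isomD(3)[OF g z] by (intro boundedI[of _ 1]) (auto simp: hyp_iff less_imp_le)
  then obtain l s where s: "strict_mono s" "((\<lambda>k. g (r k) z) \<circ> s) \<longlonglongrightarrow> l"
    using bounded_imp_convergent_subsequence by blast
  have "(norm l)\<^sup>2 \<le> 1 - b"
    by (rule tendsto_upperbound[OF tendsto_power[OF tendsto_norm[OF s(2)]]]) (simp_all add: nb)
  then have l1: "norm l < 1" using b0 abs_square_less_1[of "norm l"] by simp
  have "\<exists>a. norm a < 1 \<and> (\<lambda>k. g ((r \<circ> s) k) y) \<longlonglongrightarrow> a" if y: "y \<in> insert z F" for y
  proof (cases "y = z")
    case True
    then show ?thesis using s(2) l1 by (auto simp: o_def)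
  next
    case False
    then have "y \<in> F" using y by blast
    then obtain a where "norm a < 1" "(\<lambda>k. g (r k) y) \<longlonglongrightarrow> a" using r by blast
    then show ?thesis using LIMSEQ_subseq_LIMSEQ[OF _ s(1), of "\<lambda>k. g (r k) y" a] by (auto simp: o_def)
  qed
  then show ?case using strict_mono_o[OF r(1) s(1)] by blast
qed

text \<open>
  Convergence on the finite set \<open>F\<close> of \<open>isolated_identity\<close> is enough: it forces
  \<open>(g k)\<inverse> (g (k + 1))\<close> to be close to the identity on \<open>F\<close>.
\<close>

lemma finite_bounded_displacement:
  assumes \<kappa>: "0 < \<kappa>"
  shows "finite {\<gamma> \<in> \<Gamma>. \<kappa> \<le> 1 - (norm (\<gamma> 0))\<^sup>2}"
proof (rule ccontr)
  assume "infinite {\<gamma> \<in> \<Gamma>. \<kappa> \<le> 1 - (norm (\<gamma> 0))\<^sup>2}"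
  then obtain g :: "nat \<Rightarrow> complex ^ 'n \<Rightarrow> complex ^ 'n" where
    g: "inj g" "range g \<subseteq> {\<gamma> \<in> \<Gamma>. \<kappa> \<le> 1 - (norm (\<gamma> 0))\<^sup>2}"
    using infinite_countable_subset by blast
  have g\<Gamma>: "g k \<in> \<Gamma>" for k using g(2) by blast
  have gi: "hyp_isom (g k)" for k using \<Gamma>_isom[OF g\<Gamma>] .
  obtain F \<epsilon> where F: "finite F" "F \<subseteq> hyp K" "0 < \<epsilon>"
    "\<And>\<gamma>. \<gamma> \<in> \<Gamma> \<Longrightarrow> (\<And>z. z \<in> F \<Longrightarrow> dist (\<gamma> z) z < \<epsilon>) \<Longrightarrow> \<gamma> = (\<lambda>x\<in>hyp K. x)"
    using isolated_identity by blast
  obtain r where r: "strict_mono r" "\<And>z. z \<in> F \<Longrightarrow> \<exists>a. norm a < 1 \<and> (\<lambda>k. g (r k) z) \<longlonglongrightarrow> a"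
    using bounded_subsequence[of g \<kappa>, OF gi \<kappa> _ F(1,2)] g(2) by blast
  define h where "h = (\<lambda>k. compose (hyp K) (hinv (g (r k))) (g (r (Suc k))))"
  have h\<Gamma>: "h k \<in> \<Gamma>" for k unfolding h_def by (intro \<Gamma>_compose \<Gamma>_hinv g\<Gamma>)
  have "\<forall>\<^sub>F k in sequentially. dist (h k z) z < \<epsilon>" if z: "z \<in> F" for z
  proof -
    have zh: "z \<in> hyp K" using z F(2) by blast
    obtain a where a: "norm a < 1" "(\<lambda>k. g (r k) z) \<longlonglongrightarrow> a" using r(2)[OF z] by blast
    have "(\<lambda>k. (cdist (g (r (Suc k)) z) (g (r k) z))\<^sup>2 - 1) \<longlonglongrightarrow> (cdist a a)\<^sup>2 - 1"
      by (intro tendsto_intros tendsto_cdist a LIMSEQ_Suc[OF a(2)])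
    then have "(\<lambda>k. (cdist (g (r (Suc k)) z) (g (r k) z))\<^sup>2 - 1) \<longlonglongrightarrow> 0"
      by (simp add: cdist_self[OF a(1)])
    then have "\<forall>\<^sub>F k in sequentially. (cdist (g (r (Suc k)) z) (g (r k) z))\<^sup>2 - 1 < \<epsilon>\<^sup>2"
      using F(3) by (intro order_tendstoD) auto
    then show ?thesis
    proof (rule eventually_mono)
      fix k assume k: "(cdist (g (r (Suc k)) z) (g (r k) z))\<^sup>2 - 1 < \<epsilon>\<^sup>2"
      have hz: "h k z = hinv (g (r k)) (g (r (Suc k)) z)" using zh by (simp add: h_def compose_def)
      have m: "g (r (Suc k)) z \<in> hyp K" by (rule hyp_isomD(3)[OF gi zh])
      then have hm: "h k z \<in> hyp K" unfolding hz by (rule hinv(1)[OF gi])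
      have "(norm (h k z - z))\<^sup>2 \<le> (cdist (h k z) z)\<^sup>2 - 1"
        using hm zh by (intro norm_diff_cdist) (auto simp: hyp_iff)
      also have "cdist (h k z) z = cdist (g (r (Suc k)) z) (g (r k) z)"
        using hyp_isom_cdist[OF gi hm zh, of "r k"] hinv(2)[OF gi m] by (simp add: hz)
      finally have "(dist (h k z) z)\<^sup>2 < \<epsilon>\<^sup>2" using k by (simp add: dist_norm)
      then show "dist (h k z) z < \<epsilon>" using F(3) power2_less_imp_less by fastforce
    qed
  qed
  then have "\<forall>\<^sub>F k in sequentially. \<forall>z\<in>F. dist (h k z) z < \<epsilon>"
    using F(1) by (simp add: eventually_ball_finite)
  then obtain k where "\<forall>z\<in>F. dist (h k z) z < \<epsilon>"
    using eventually_happens trivial_limit_sequentially by blast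
  then have hk: "h k = (\<lambda>x\<in>hyp K. x)" using F(4)[OF h\<Gamma>] by blast
  have "g (r (Suc k)) z = g (r k) z" for z
  proof (cases "z \<in> hyp K")
    case True
    then have "hinv (g (r k)) (g (r (Suc k)) z) = z" using fun_cong[OF hk, of z] by (simp add: h_def compose_def)
    then show ?thesis using hinv(2)[OF gi, of "g (r (Suc k)) z" "r k"] hyp_isomD(3)[OF gi True] by simp
  next
    case False
    then show ?thesis using hyp_isomD(2)[OF gi] by (simp add: extensional_def)
  qed
  then have "g (r (Suc k)) = g (r k)" by blast
  then have "r (Suc k) = r k" using g(1) by (simp add: inj_eq)
  then show False using r(1) by (metis lessI less_irrefl strict_mono_less)
qed

text \<open>Each element keeps 0 inside the open ball, so it satisfies the displacement bound for
  some \<open>\<kappa>\<close> of the form 1/(k + 1); for each such \<open>\<kappa>\<close> there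
  are finitely many.\<close>

lemma countable_\<Gamma>: "countable \<Gamma>"
proof -
  have eq: "\<Gamma> = (\<Union>k. {\<gamma> \<in> \<Gamma>. inverse (real (Suc k)) \<le> 1 - (norm (\<gamma> 0))\<^sup>2})"
  proof
    show "\<Gamma> \<subseteq> (\<Union>k. {\<gamma> \<in> \<Gamma>. inverse (real (Suc k)) \<le> 1 - (norm (\<gamma> 0))\<^sup>2})"
    proof
      fix \<gamma> assume \<gamma>: "\<gamma> \<in> \<Gamma>"
      have "0 < 1 - (norm (\<gamma> 0))\<^sup>2"
        using norm_sq_less_1[OF hyp_norm[OF hyp_isomD(3)[OF \<Gamma>_isom[OF \<gamma>] zero_hyp]]] by simp
      then obtain k where "inverse (real (Suc k)) < 1 - (norm (\<gamma> 0))\<^sup>2" using reals_Archimedean by blast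
      then show "\<gamma> \<in> (\<Union>k. {\<gamma> \<in> \<Gamma>. inverse (real (Suc k)) \<le> 1 - (norm (\<gamma> 0))\<^sup>2})"
        using \<gamma> by (auto intro: less_imp_le)
    qed
  qed auto
  show ?thesis
    by (subst eq) (intro countable_UN countableI_type countable_finite finite_bounded_displacement, simp)
qed

text \<open>
  Three points are needed: the products of the conformal factors at the points of each pair are
  controlled, which bounds the factors themselves only if there is a third point to divide out.
\<close>

lemma finite_triple_returns:
  assumes b: "\<xi> \<in> bdry K" "\<eta> \<in> bdry K" "\<zeta> \<in> bdry K" and d: "\<xi> \<noteq> \<eta>" "\<xi> \<noteq> \<zeta>" "\<eta> \<noteq> \<zeta>" and \<delta>: "0 < \<delta>"
  shows "finite {\<gamma> \<in> \<Gamma>. \<delta> \<le> rho (bdry_act K \<gamma> \<xi>) (bdry_act K \<gamma> \<eta>) \<and>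
     \<delta> \<le> rho (bdry_act K \<gamma> \<xi>) (bdry_act K \<gamma> \<zeta>) \<and> \<delta> \<le> rho (bdry_act K \<gamma> \<eta>) (bdry_act K \<gamma> \<zeta>)}"
proof -
  define r where "r = min (rho \<xi> \<zeta>) (rho \<eta> \<zeta>)"
  define r' where "r' = min r (rho \<xi> \<eta>)"
  have r': "0 < r'" using rho_bdry_eq_0 b d rho_nonneg unfolding r'_def r_def by (metis less_eq_real_def min_def)
  \<comment> \<open>\<open>\<alpha>\<close> and \<open>\<beta>\<close> bound the product of two
    conformal factors from below and above; the 2 in both is the maximum of \<open>rho\<close> on
    the closed ball.\<close>
  define \<alpha> where "\<alpha> = \<delta> / 2"
  define \<beta> where "\<beta> = 2 / r'"
  have ab: "0 < \<alpha>" "0 < \<beta>" using \<delta> r' by (auto simp: \<alpha>_def \<beta>_def)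
  \<comment> \<open>The 8 is collected below: 2 from squaring a sum of two distances, times 2 terms,
    times the 2 of \<open>norm_diff_rho\<close>.\<close>
  define n where "n = (norm (\<xi> - \<eta>))\<^sup>2 / 8"
  have n0: "0 < n" using d by (simp add: n_def)
  have pair: "\<alpha> \<le> conf \<gamma> x * conf \<gamma> y \<and> conf \<gamma> x * conf \<gamma> y \<le> \<beta>"
    if \<gamma>: "\<gamma> \<in> \<Gamma>" and x: "x \<in> bdry K" and y: "y \<in> bdry K" and xy: "r' \<le> rho x y"
      and lo: "\<delta> \<le> rho (bdry_act K \<gamma> x) (bdry_act K \<gamma> y)" for \<gamma> x y
  proof -
    have g: "hyp_isom \<gamma>" by (rule \<Gamma>_isom[OF \<gamma>])
    define c where "c = conf \<gamma> x * conf \<gamma> y"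
    have c0: "0 < c" unfolding c_def using x y by (intro mult_pos_pos conf_bounds(2)[OF g]) (auto simp: bdry_iff)
    have eq: "rho (bdry_act K \<gamma> x) (bdry_act K \<gamma> y) = rho x y * c"
      using rho_bdry_act[OF g x y] by (simp add: c_def)
    have "rho x y \<le> 2" using x y by (intro rho_le_2) (auto simp: bdry_iff)
    then have "rho x y * c \<le> 2 * c" using c0 by (intro mult_right_mono) auto
    moreover have "r' * c \<le> rho x y * c" using c0 xy by (intro mult_right_mono) auto
    moreover have "rho (bdry_act K \<gamma> x) (bdry_act K \<gamma> y) \<le> 2"
      using bdry_act_tendsto(2)[OF g x] bdry_act_tendsto(2)[OF g y] by (intro rho_le_2) (auto simp: bdry_iff)
    ultimately have "\<delta> \<le> 2 * c" "r' * c \<le> 2" using lo eq by auto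
    then show ?thesis using r' unfolding c_def[symmetric] \<alpha>_def \<beta>_def
      by (auto simp: pos_le_divide_eq mult.commute)
  qed
  \<comment> \<open>This rests on A^2 = (A B)(A C) / (B C).\<close>
  have sq: "\<alpha>\<^sup>2 / \<beta> \<le> A\<^sup>2"
    if "\<alpha> \<le> A * B" "\<alpha> \<le> A * C" "B * C \<le> \<beta>" "0 < A" "0 < B" "0 < C" for A B C :: real
  proof -
    have "\<alpha> * \<alpha> \<le> (A * B) * (A * C)" using that ab by (intro mult_mono) auto
    also have "\<dots> = A\<^sup>2 * (B * C)" by (simp add: power2_eq_square mult_ac)
    also have "\<dots> \<le> A\<^sup>2 * \<beta>" using that by (intro mult_left_mono) auto
    finally show ?thesis using ab by (simp add: pos_divide_le_eq power2_eq_square)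
  qed
  define \<kappa> where "\<kappa> = n\<^sup>2 * (\<alpha>\<^sup>2 / \<beta>)"
  have \<kappa>: "0 < \<kappa>" using n0 ab by (simp add: \<kappa>_def)
  have main: "\<kappa> \<le> 1 - (norm (\<gamma> 0))\<^sup>2"
    if \<gamma>: "\<gamma> \<in> \<Gamma>" and h1: "\<delta> \<le> rho (bdry_act K \<gamma> \<xi>) (bdry_act K \<gamma> \<eta>)"
      and h2: "\<delta> \<le> rho (bdry_act K \<gamma> \<xi>) (bdry_act K \<gamma> \<zeta>)"
      and h3: "\<delta> \<le> rho (bdry_act K \<gamma> \<eta>) (bdry_act K \<gamma> \<zeta>)" for \<gamma>
  proof -
    have g: "hyp_isom \<gamma>" by (rule \<Gamma>_isom[OF \<gamma>])
    define p where "p = hinv \<gamma> 0"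
    have p: "p \<in> hyp K" unfolding p_def by (rule hinv(1)[OF g zero_hyp])
    have np: "norm p = norm (\<gamma> 0)" unfolding p_def by (rule norm_hinv_0[OF g])
    define s where "s = 1 - (norm p)\<^sup>2"
    have s0: "0 < s" using norm_sq_less_1[OF hyp_norm[OF p]] by (simp add: s_def)
    have pos: "0 < conf \<gamma> \<xi>" "0 < conf \<gamma> \<eta>" "0 < conf \<gamma> \<zeta>"
      using b by (auto intro!: conf_bounds(2)[OF g] simp: bdry_iff)
    note P1 = pair[OF \<gamma> b(1) b(2) _ h1] and P2 = pair[OF \<gamma> b(1) b(3) _ h2] and P3 = pair[OF \<gamma> b(2) b(3) _ h3]
    have rr: "r' \<le> rho \<xi> \<eta>" "r' \<le> rho \<xi> \<zeta>" "r' \<le> rho \<eta> \<zeta>" by (auto simp: r'_def r_def)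
    have C1: "\<alpha>\<^sup>2 / \<beta> \<le> (conf \<gamma> \<xi>)\<^sup>2"
      by (rule sq[of _ "conf \<gamma> \<eta>" "conf \<gamma> \<zeta>"]) (use P1 P2 P3 rr pos in auto)
    have C2: "\<alpha>\<^sup>2 / \<beta> \<le> (conf \<gamma> \<eta>)\<^sup>2"
      by (rule sq[of _ "conf \<gamma> \<xi>" "conf \<gamma> \<zeta>"]) (use P1 P2 P3 rr pos in \<open>auto simp: mult.commute\<close>)
    \<comment> \<open>A conformal factor bounded below at \<open>x\<close> forces \<open>p\<close>
      close to \<open>x\<close> when \<open>s\<close> is small. Holding for both
      \<open>\<xi>\<close> and \<open>\<eta>\<close>, which are a fixed distance apart, this bounds
      \<open>s\<close> from below.\<close>
    have near: "(norm (x - p))\<^sup>2 \<le> 2 * sqrt (s * (\<beta> / \<alpha>\<^sup>2))" if x: "x \<in> bdry K" and c: "\<alpha>\<^sup>2 / \<beta> \<le> (conf \<gamma> x)\<^sup>2" for x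
    proof -
      have nx: "norm x \<le> 1" "norm p \<le> 1" using x p by (auto simp: bdry_iff hyp_iff)
      have rp: "0 < rho x p" using x p by (intro rho_pos) (auto simp: bdry_iff hyp_iff)
      have "(conf \<gamma> x)\<^sup>2 = s / (rho x p)\<^sup>2"
        using s0 by (simp add: conf_def p_def[symmetric] power_divide s_def)
      then have "\<alpha>\<^sup>2 / \<beta> * (rho x p)\<^sup>2 \<le> s" using c rp by (simp add: pos_le_divide_eq)
      then have "(rho x p)\<^sup>2 \<le> s * (\<beta> / \<alpha>\<^sup>2)" using ab by (simp add: field_simps)
      then have "rho x p \<le> sqrt (s * (\<beta> / \<alpha>\<^sup>2))" by (rule real_le_rsqrt)
      then show ?thesis using norm_diff_rho[OF nx] by simp
    qed
    have "norm (\<xi> - \<eta>) \<le> norm (\<xi> - p) + norm (\<eta> - p)"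
      using norm_triangle_ineq4[of "\<xi> - p" "\<eta> - p"] by simp
    then have "(norm (\<xi> - \<eta>))\<^sup>2 \<le> (norm (\<xi> - p) + norm (\<eta> - p))\<^sup>2" by (intro power_mono) auto
    also have "\<dots> \<le> 2 * ((norm (\<xi> - p))\<^sup>2 + (norm (\<eta> - p))\<^sup>2)"
      using sum_squares_ge_zero[of "norm (\<xi> - p) - norm (\<eta> - p)" 0]
      by (simp add: power2_eq_square algebra_simps)
    also have "\<dots> \<le> 8 * sqrt (s * (\<beta> / \<alpha>\<^sup>2))" using near[OF b(1) C1] near[OF b(2) C2] by simp
    finally have "n \<le> sqrt (s * (\<beta> / \<alpha>\<^sup>2))" by (simp add: n_def)
    then have "n\<^sup>2 \<le> (sqrt (s * (\<beta> / \<alpha>\<^sup>2)))\<^sup>2" using n0 by (intro power_mono) auto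
    then have "n\<^sup>2 \<le> s * (\<beta> / \<alpha>\<^sup>2)" using s0 ab by simp
    then have "\<kappa> \<le> s" using ab by (simp add: \<kappa>_def field_simps)
    then show ?thesis by (simp add: s_def np)
  qed
  show ?thesis
    by (rule finite_subset[OF _ finite_bounded_displacement[OF \<kappa>]]) (use main in blast)
qed

end

section \<open>Equivariant maps are the identity or the flip\<close>

text \<open>The indices \<open>i\<close> and \<open>j\<close> witness dimension at least 2 in the
  form that transitivity and uncountability take.\<close>

locale ergodic_group = discrete_group K \<Gamma> for K :: "complex set" and \<Gamma> :: "(complex ^ 'n \<Rightarrow> complex ^ 'n) set" +
  fixes \<mu> :: "((complex ^ 'n) \<times> (complex ^ 'n)) measure" and i j :: 'n
  assumes inv: "invariant_class K \<mu>" and erg: "ergodic_on K \<Gamma> \<mu>" and ij: "i \<noteq> j"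
begin

lemma sets_\<mu>: "sets \<mu> = sets (restrict_space borel (bdry2 K))"
  using inv by (simp add: invariant_class_def)

lemma space_\<mu>: "space \<mu> = bdry2 K"
  using sets_eq_imp_space_eq[OF sets_\<mu>] by (simp add: space_restrict_space)

lemma space_not_null: "space \<mu> \<notin> null_sets \<mu>"
proof
  assume "space \<mu> \<in> null_sets \<mu>"
  then have "emeasure \<mu> (space \<mu>) = 0" by (rule null_setsD1)
  moreover have "emeasure \<mu> (space \<mu>) \<noteq> 0" using inv unfolding invariant_class_def by (elim conjE) assumption
  ultimately show False by blast
qed

lemma act2_null:
  assumes "g \<in> carrier (Isom_plus K)" "E \<in> null_sets \<mu>"
  shows "act2 K g ` E \<in> null_sets \<mu>"
proof -
  have "\<forall>g\<in>carrier (Isom_plus K). \<forall>E\<in>null_sets \<mu>. act2 K g ` E \<in> null_sets \<mu>"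
    using inv unfolding invariant_class_def by (elim conjE) assumption
  then show ?thesis using assms by blast
qed

lemma measurable_restrict_target:
  "f \<in> \<mu> \<rightarrow>\<^sub>M \<mu> \<longleftrightarrow> f \<in> borel_measurable \<mu> \<and> f \<in> bdry2 K \<rightarrow> bdry2 K"
proof -
  have "f \<in> \<mu> \<rightarrow>\<^sub>M \<mu> \<longleftrightarrow> f \<in> \<mu> \<rightarrow>\<^sub>M restrict_space borel (bdry2 K)"
    by (intro arg_cong[where f = "\<lambda>S. f \<in> S"] measurable_cong_sets sets_\<mu> refl)
  then show ?thesis by (simp add: measurable_restrict_space2_iff space_\<mu> conj_commute)
qed

lemma borel_continuous: "continuous_on (bdry2 K) f \<Longrightarrow> f \<in> borel_measurable \<mu>"
  by (subst measurable_cong_sets[OF sets_\<mu> refl]) (rule borel_measurable_continuous_on_restrict)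

lemma borel_id [measurable]: "(\<lambda>q. q) \<in> borel_measurable \<mu>"
  by (rule borel_continuous) (rule continuous_on_id)

lemma act2_measurable: "hyp_isom g \<Longrightarrow> act2 K g \<in> \<mu> \<rightarrow>\<^sub>M \<mu>"
  by (intro iffD2[OF measurable_restrict_target] conjI borel_continuous continuous_on_act2 Pi_I act2_bdry2)

lemma sets_eq:
  fixes f g :: "_ \<Rightarrow> 'b::euclidean_space"
  assumes [measurable]: "f \<in> borel_measurable \<mu>" "g \<in> borel_measurable \<mu>"
  shows "{q \<in> space \<mu>. f q = g q} \<in> sets \<mu>"
proof -
  have "{q \<in> space \<mu>. f q = g q} = (\<lambda>q. f q - g q) -` {0} \<inter> space \<mu>" by auto
  also have "\<dots> \<in> sets \<mu>" by (rule measurable_sets[of _ _ borel]) auto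
  finally show ?thesis .
qed

lemma act2_\<Gamma>_compose:
  "\<gamma> \<in> \<Gamma> \<Longrightarrow> \<delta> \<in> \<Gamma> \<Longrightarrow> q \<in> bdry2 K \<Longrightarrow> act2 K (compose (hyp K) \<gamma> \<delta>) q = act2 K \<gamma> (act2 K \<delta> q)"
  by (simp add: act2_compose \<Gamma>_isom)

text \<open>\<open>ergodic_on\<close> speaks of sets equal to all their translates; inclusion in one
  direction implies this because \<open>\<Gamma>\<close> contains inverses.\<close>

lemma invariant_dichotomy:
  assumes E: "E \<in> sets \<mu>" and iv: "\<And>\<gamma> q. \<gamma> \<in> \<Gamma> \<Longrightarrow> q \<in> E \<Longrightarrow> act2 K \<gamma> q \<in> E"
  shows "E \<in> null_sets \<mu> \<or> space \<mu> - E \<in> null_sets \<mu>"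
proof -
  have EB: "E \<subseteq> bdry2 K" using sets.sets_into_space[OF E] by (simp add: space_\<mu>)
  have "act2 K \<gamma> ` E = E" if \<gamma>: "\<gamma> \<in> \<Gamma>" for \<gamma>
  proof
    show "act2 K \<gamma> ` E \<subseteq> E" using iv \<gamma> by blast
    show "E \<subseteq> act2 K \<gamma> ` E"
    proof
      fix q assume q: "q \<in> E"
      have "q = act2 K \<gamma> (act2 K (hinv \<gamma>) q)"
        using act2_hinv(1)[OF \<Gamma>_isom[OF \<gamma>] subsetD[OF EB q]] by simp
      then show "q \<in> act2 K \<gamma> ` E" using iv[OF \<Gamma>_hinv[OF \<gamma>] q] by blast
    qed
  qed
  then show ?thesis using bspec[OF erg[unfolded ergodic_on_def] E] by simp
qed

text \<open>
  An equivariant measurable choice of a third boundary point maps pairs to triples, on which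
  \<open>\<Gamma>\<close> acts properly.  By ergodicity almost all triples lie in a single \<open>\<Gamma>\<close>-orbit, and as a triple
  determines its pair, some countable \<open>\<Gamma>\<close>-orbit of pairs is conull.
\<close>

lemma no_equivariant_third_point:
  assumes A: "A \<in> sets \<mu>" "space \<mu> - A \<in> null_sets \<mu>"
    and Ainv: "\<And>\<gamma> q. \<gamma> \<in> \<Gamma> \<Longrightarrow> q \<in> A \<Longrightarrow> act2 K \<gamma> q \<in> A"
    and c: "c \<in> borel_measurable \<mu>"
    and cb: "\<And>q. q \<in> A \<Longrightarrow> c q \<in> bdry K \<and> c q \<noteq> fst q \<and> c q \<noteq> snd q"
    and ceq: "\<And>\<gamma> q. \<gamma> \<in> \<Gamma> \<Longrightarrow> q \<in> A \<Longrightarrow> c (act2 K \<gamma> q) = bdry_act K \<gamma> (c q)"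
  shows False
proof -
  have AB: "A \<subseteq> bdry2 K" using sets.sets_into_space[OF A(1)] by (simp add: space_\<mu>)
  obtain B :: "(((complex ^ 'n) \<times> (complex ^ 'n)) \<times> (complex ^ 'n)) set set"
    where B: "countable B" "topological_basis B" using ex_countable_basis by blast
  define \<tau> where "\<tau> = (\<lambda>q. (q, c q))"
  have \<tau>m: "\<tau> \<in> borel_measurable \<mu>" unfolding \<tau>_def using c by measurable
  \<comment> \<open>The pairs whose triple has a \<open>\<Gamma>\<close>-translate in
    \<open>U\<close>: invariant and measurable, so the zero-one law applies for each basic open
    \<open>U\<close>.\<close>
  define E where "E = (\<lambda>U. {q \<in> A. \<exists>\<gamma>\<in>\<Gamma>. \<tau> (act2 K \<gamma> q) \<in> U})"
  have EA: "E U \<subseteq> A" for U by (auto simp: E_def)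
  have Em: "E U \<in> sets \<mu>" if U: "U \<in> B" for U
  proof -
    have Ub: "U \<in> sets borel" using topological_basis_open[OF B(2) U] by simp
    have "(\<lambda>q. \<tau> (act2 K \<gamma> q)) -` U \<inter> space \<mu> \<in> sets \<mu>" if \<gamma>: "\<gamma> \<in> \<Gamma>" for \<gamma>
      by (rule measurable_sets[OF measurable_compose[OF act2_measurable[OF \<Gamma>_isom[OF \<gamma>]] \<tau>m] Ub])
    then have "A \<inter> (\<Union>\<gamma>\<in>\<Gamma>. (\<lambda>q. \<tau> (act2 K \<gamma> q)) -` U \<inter> space \<mu>) \<in> sets \<mu>"
      by (intro sets.Int A sets.countable_UN' countable_\<Gamma>) auto
    moreover have "E U = A \<inter> (\<Union>\<gamma>\<in>\<Gamma>. (\<lambda>q. \<tau> (act2 K \<gamma> q)) -` U \<inter> space \<mu>)"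
      using AB unfolding E_def space_\<mu> vimage_def by blast
    ultimately show ?thesis by simp
  qed
  have Einv: "act2 K \<delta> q \<in> E U" if \<delta>: "\<delta> \<in> \<Gamma>" and q: "q \<in> E U" for \<delta> q U
  proof -
    obtain \<gamma> where \<gamma>: "\<gamma> \<in> \<Gamma>" "\<tau> (act2 K \<gamma> q) \<in> U" and qA: "q \<in> A" using q unfolding E_def by blast
    have qB: "q \<in> bdry2 K" using qA AB by blast
    have "act2 K (compose (hyp K) \<gamma> (hinv \<delta>)) (act2 K \<delta> q) = act2 K \<gamma> q"
      using act2_\<Gamma>_compose[OF \<gamma>(1) \<Gamma>_hinv[OF \<delta>] act2_bdry2[OF \<Gamma>_isom[OF \<delta>] qB]]
        act2_hinv(2)[OF \<Gamma>_isom[OF \<delta>] qB] by simp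
    then show ?thesis
      using \<Gamma>_compose[OF \<gamma>(1) \<Gamma>_hinv[OF \<delta>]] \<gamma>(2) Ainv[OF \<delta> qA] unfolding E_def by force
  qed
  have dich: "E U \<in> null_sets \<mu> \<or> space \<mu> - E U \<in> null_sets \<mu>" if "U \<in> B" for U
    by (rule invariant_dichotomy[OF Em[OF that] Einv])
  \<comment> \<open>A countable union of null sets. Any two pairs outside it belong to
    \<open>A\<close> and to exactly the same sets \<open>E U\<close> with \<open>U\<close> in the
    basis.\<close>
  define N where "N = (space \<mu> - A) \<union>
      ((\<Union>U\<in>{U \<in> B. E U \<in> null_sets \<mu>}. E U) \<union> (\<Union>U\<in>{U \<in> B. space \<mu> - E U \<in> null_sets \<mu>}. space \<mu> - E U))"
  have N: "N \<in> null_sets \<mu>"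
    unfolding N_def
    by (intro null_sets.Un A null_sets_UN') (auto intro: countable_subset[OF _ B(1)])
  have "space \<mu> - N \<noteq> {}"
    using space_not_null null_sets_subset[OF N sets.top[of \<mu>]] by blast
  then obtain q0 where q0: "q0 \<in> space \<mu>" "q0 \<notin> N" by blast
  have q0A: "q0 \<in> A" using q0 by (auto simp: N_def)
  have q0B: "q0 \<in> bdry2 K" using q0A AB by blast
  define Orb where "Orb = (\<lambda>\<gamma>. act2 K \<gamma> q0) ` \<Gamma>"
  have orbit: "q \<in> Orb" if q: "q \<in> space \<mu>" "q \<notin> N" for q
  proof -
    have qA: "q \<in> A" using q by (auto simp: N_def)
    have qB: "q \<in> bdry2 K" using qA AB by blast
    have meet: "\<exists>\<gamma>\<in>\<Gamma>. \<tau> (act2 K \<gamma> q) \<in> U" if U: "U \<in> B" "\<tau> q0 \<in> U" for U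
    proof -
      have "\<tau> (act2 K (\<lambda>x\<in>hyp K. x) q0) \<in> U" using U(2) by (simp add: act2_id[OF q0B])
      then have "q0 \<in> E U" unfolding E_def using q0A \<Gamma>_id by blast
      then have "E U \<notin> null_sets \<mu>" using q0(2) U(1) unfolding N_def by blast
      then have "space \<mu> - E U \<in> null_sets \<mu>" using dich[OF U(1)] by blast
      then have "q \<in> E U" using q U(1) unfolding N_def by blast
      then show ?thesis unfolding E_def by blast
    qed
    \<comment> \<open>The least mutual separation of the three points. It is continuous and positive
      on triples of distinct points, and an orbit visits the set where it exceeds
      \<open>\<delta>\<close> only finitely often.\<close>
    define f where "f = (\<lambda>t :: ((complex ^ 'n) \<times> (complex ^ 'n)) \<times> (complex ^ 'n).
      min (rho (fst (fst t)) (snd (fst t))) (min (rho (fst (fst t)) (snd t)) (rho (snd (fst t)) (snd t))))"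
    have f: "continuous_on UNIV f" unfolding f_def by (intro continuous_intros)
    have trip: "fst (fst (\<tau> r)) \<in> bdry K" "snd (fst (\<tau> r)) \<in> bdry K" "snd (\<tau> r) \<in> bdry K"
      "fst (fst (\<tau> r)) \<noteq> snd (fst (\<tau> r))" "fst (fst (\<tau> r)) \<noteq> snd (\<tau> r)" "snd (fst (\<tau> r)) \<noteq> snd (\<tau> r)"
      if "r \<in> A" for r
      using cb[OF that] subsetD[OF AB that] by (auto simp: \<tau>_def bdry2_def)
    define \<delta> where "\<delta> = f (\<tau> q0) / 2"
    have rho_gt_0: "0 < rho x y" if "x \<in> bdry K" "y \<in> bdry K" "x \<noteq> y" for x y :: "complex ^ 'n"
      using rho_bdry_eq_0[OF that(1,2)] that(3) by (simp add: less_le)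
    have "0 < f (\<tau> q0)"
      unfolding f_def min_less_iff_conj by (intro conjI rho_gt_0 trip[OF q0A])
    then have \<delta>: "0 < \<delta>" "\<delta> < f (\<tau> q0)" by (auto simp: \<delta>_def)
    define U0 where "U0 = f -` {\<delta><..}"
    have U0: "open U0" "\<tau> q0 \<in> U0"
      using \<delta> open_vimage[OF _ f, of "{\<delta><..}"] by (auto simp: U0_def)
    define F where "F = {\<gamma> \<in> \<Gamma>. \<tau> (act2 K \<gamma> q) \<in> U0}"
    have \<tau>act: "\<tau> (act2 K \<gamma> q) = ((bdry_act K \<gamma> (fst q), bdry_act K \<gamma> (snd q)), bdry_act K \<gamma> (c q))" if "\<gamma> \<in> \<Gamma>" for \<gamma>
      using ceq[OF that qA] by (simp add: \<tau>_def act2_def map_prod_def case_prod_beta)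
    have "finite F"
    proof (rule finite_subset)
      show "finite {\<gamma> \<in> \<Gamma>. \<delta> \<le> rho (bdry_act K \<gamma> (fst q)) (bdry_act K \<gamma> (snd q)) \<and>
         \<delta> \<le> rho (bdry_act K \<gamma> (fst q)) (bdry_act K \<gamma> (c q)) \<and>
         \<delta> \<le> rho (bdry_act K \<gamma> (snd q)) (bdry_act K \<gamma> (c q))}"
        using trip[OF qA] by (intro finite_triple_returns \<delta>) (auto simp: \<tau>_def)
    qed (auto simp: F_def U0_def f_def \<tau>act)
    then have cl: "closed ((\<lambda>\<gamma>. \<tau> (act2 K \<gamma> q)) ` F)" by (simp add: finite_imp_closed)
    \<comment> \<open>Otherwise deleting the finitely many visited points from \<open>U0\<close>
      leaves a neighbourhood of \<open>\<tau> q0\<close>, which the orbit of \<open>\<tau> q\<close>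
      would have to visit again.\<close>
    have "\<tau> q0 \<in> (\<lambda>\<gamma>. \<tau> (act2 K \<gamma> q)) ` F"
    proof (rule ccontr)
      assume "\<tau> q0 \<notin> (\<lambda>\<gamma>. \<tau> (act2 K \<gamma> q)) ` F"
      then have W: "\<tau> q0 \<in> U0 - (\<lambda>\<gamma>. \<tau> (act2 K \<gamma> q)) ` F" using U0 by blast
      obtain U where U: "U \<in> B" "\<tau> q0 \<in> U" "U \<subseteq> U0 - (\<lambda>\<gamma>. \<tau> (act2 K \<gamma> q)) ` F"
        by (rule topological_basisE[OF B(2) open_Diff[OF U0(1) cl] W])
      then obtain \<gamma> where "\<gamma> \<in> \<Gamma>" "\<tau> (act2 K \<gamma> q) \<in> U" using meet by blast
      then show False using U(3) unfolding F_def by blast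
    qed
    then obtain \<gamma> where \<gamma>: "\<gamma> \<in> \<Gamma>" "\<tau> q0 = \<tau> (act2 K \<gamma> q)" unfolding F_def by blast
    then have "q0 = act2 K \<gamma> q" by (simp add: \<tau>_def)
    then have "q = act2 K (hinv \<gamma>) q0" using act2_hinv(2)[OF \<Gamma>_isom[OF \<gamma>(1)] qB] by simp
    then show "q \<in> Orb" using \<Gamma>_hinv[OF \<gamma>(1)] unfolding Orb_def by blast
  qed
  \<comment> \<open>A pair outside the countable orbit lies in the null set \<open>N\<close>.
    Transitivity of the full group then makes every point null, hence also the orbit, and nothing of
    positive measure remains.\<close>
  have cOrb: "countable Orb" using countable_\<Gamma> by (simp add: Orb_def)
  then obtain r where r: "r \<in> bdry2 K" "r \<notin> Orb"
    using uncountable_bdry2[OF ij] countable_subset[of "bdry2 K" Orb] by blast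
  have sing: "{q} \<in> sets \<mu>" if "q \<in> bdry2 K" for q
    using that by (auto simp: sets_\<mu> sets_restrict_space intro!: image_eqI[of _ _ "{q}"])
  have "r \<in> N" using r orbit[of r] unfolding space_\<mu> by blast
  then have rnull: "{r} \<in> null_sets \<mu>" using null_sets_subset[OF N sing[OF r(1)]] by simp
  have null: "{q} \<in> null_sets \<mu>" if q: "q \<in> bdry2 K" for q
  proof -
    obtain g where g: "g \<in> carrier (Isom_plus K)" "act2 K g r = q"
      by (rule act2_transitive[OF r(1) q disjI2[OF ij]])
    then show ?thesis using act2_null[OF g(1) rnull] by simp
  qed
  have OrbB: "Orb \<subseteq> bdry2 K" using act2_bdry2[OF \<Gamma>_isom q0B] unfolding Orb_def by blast
  have "(\<Union>q\<in>Orb. {q}) \<in> null_sets \<mu>"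
    by (rule null_sets_UN'[OF cOrb]) (use OrbB null in blast)
  then have "N \<union> Orb \<in> null_sets \<mu>" using null_sets.Un[OF N] by simp
  moreover have "space \<mu> \<subseteq> N \<union> Orb" using orbit by blast
  ultimately have "space \<mu> \<in> null_sets \<mu>" by (rule null_sets_subset[OF _ sets.top])
  then show False using space_not_null by blast
qed

lemma equivariant_map_cases:
  assumes f: "f \<in> \<mu> \<rightarrow>\<^sub>M \<mu>" and eq: "\<And>\<gamma>. \<gamma> \<in> \<Gamma> \<Longrightarrow> AE q in \<mu>. f (act2 K \<gamma> q) = act2 K \<gamma> (f q)"
  shows "(AE q in \<mu>. f q = q) \<or> (AE q in \<mu>. f q = prod.swap q)"
proof -
  note fm = iffD1[OF measurable_restrict_target f]
  have fb: "f \<in> borel_measurable \<mu>" using fm by (rule conjunct1)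
  have fP: "f \<in> bdry2 K \<rightarrow> bdry2 K" using fm by (rule conjunct2)
  have fB: "f q \<in> bdry2 K" if "q \<in> bdry2 K" for q using fP that by (rule funcset_mem)
  have mb: "(\<lambda>q. g q) \<in> borel_measurable \<mu>" if "g \<in> \<mu> \<rightarrow>\<^sub>M \<mu>" for g
    using that by (simp add: measurable_restrict_target)
  \<comment> \<open>Here equivariance holds for all elements at once. The set is conull because
    \<open>\<Gamma>\<close> is countable, and invariant because \<open>\<Gamma>\<close> is closed
    under composition.\<close>
  define A where "A = {q \<in> space \<mu>. \<forall>\<gamma>\<in>\<Gamma>. f (act2 K \<gamma> q) = act2 K \<gamma> (f q)}"
  have Am: "A \<in> sets \<mu>"
  proof -
    have "{q \<in> space \<mu>. f (act2 K \<gamma> q) = act2 K \<gamma> (f q)} \<in> sets \<mu>" if "\<gamma> \<in> \<Gamma>" for \<gamma>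
    proof -
      note a = act2_measurable[OF \<Gamma>_isom[OF that]]
      show ?thesis
        by (rule sets_eq[OF mb[OF measurable_compose[OF a f]] mb[OF measurable_compose[OF f a]]])
    qed
    then have "(\<Inter>\<gamma>\<in>\<Gamma>. {q \<in> space \<mu>. f (act2 K \<gamma> q) = act2 K \<gamma> (f q)}) \<in> sets \<mu>"
      using \<Gamma>_id by (intro sets.countable_INT' countable_\<Gamma>) auto
    moreover have "A = (\<Inter>\<gamma>\<in>\<Gamma>. {q \<in> space \<mu>. f (act2 K \<gamma> q) = act2 K \<gamma> (f q)})"
      using \<Gamma>_id by (auto simp: A_def)
    ultimately show ?thesis by simp
  qed
  have "AE q in \<mu>. \<forall>\<gamma>\<in>\<Gamma>. f (act2 K \<gamma> q) = act2 K \<gamma> (f q)"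
    using eq by (simp add: AE_ball_countable[OF countable_\<Gamma>])
  then have "AE q in \<mu>. q \<in> A" by (rule AE_mp) (auto simp: A_def)
  then have Anull: "space \<mu> - A \<in> null_sets \<mu>" using Am by (simp add: AE_iff_null_sets[symmetric] AE_iff_null set_diff_eq)
  have AB: "A \<subseteq> bdry2 K" by (auto simp: A_def space_\<mu>)
  have Aeq: "f (act2 K \<gamma> q) = act2 K \<gamma> (f q)" if "\<gamma> \<in> \<Gamma>" "q \<in> A" for \<gamma> q
    using that by (simp add: A_def)
  have Ainv: "act2 K \<delta> q \<in> A" if \<delta>: "\<delta> \<in> \<Gamma>" and q: "q \<in> A" for \<delta> q
  proof -
    have qB: "q \<in> bdry2 K" using q AB by blast
    have "f (act2 K \<gamma> (act2 K \<delta> q)) = act2 K \<gamma> (f (act2 K \<delta> q))" if \<gamma>: "\<gamma> \<in> \<Gamma>" for \<gamma>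
      using Aeq[OF \<Gamma>_compose[OF \<gamma> \<delta>] q] Aeq[OF \<delta> q] act2_\<Gamma>_compose[OF \<gamma> \<delta> qB]
        act2_\<Gamma>_compose[OF \<gamma> \<delta> fB[OF qB]] by simp
    then show ?thesis using act2_bdry2[OF \<Gamma>_isom[OF \<delta>] qB] by (simp add: A_def space_\<mu>)
  qed
  have swapm: "prod.swap \<in> borel_measurable \<mu>"
    unfolding prod.swap_def by (intro borel_continuous continuous_intros)
  define A1 where "A1 = A \<inter> {q \<in> space \<mu>. f q = q}"
  define A2 where "A2 = A \<inter> {q \<in> space \<mu>. f q = prod.swap q}"
  have A12: "A1 \<in> sets \<mu>" "A2 \<in> sets \<mu>"
    unfolding A1_def A2_def by (intro sets.Int Am sets_eq fb borel_id swapm)+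
  have inv1: "act2 K \<gamma> q \<in> A1" if "\<gamma> \<in> \<Gamma>" "q \<in> A1" for \<gamma> q
    using that Ainv[of \<gamma> q] Aeq[of \<gamma> q] AB by (auto simp: A1_def space_\<mu>)
  have inv2: "act2 K \<gamma> q \<in> A2" if "\<gamma> \<in> \<Gamma>" "q \<in> A2" for \<gamma> q
  proof -
    have "f (act2 K \<gamma> q) = prod.swap (act2 K \<gamma> q)"
      using that Aeq[of \<gamma> q] act2_swap[of \<gamma> q] by (simp add: A2_def)
    then show ?thesis using that Ainv[of \<gamma> q] AB by (auto simp: A2_def space_\<mu>)
  qed
  consider "space \<mu> - A1 \<in> null_sets \<mu>" | "space \<mu> - A2 \<in> null_sets \<mu>"
    | "A1 \<in> null_sets \<mu>" "A2 \<in> null_sets \<mu>"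
    using invariant_dichotomy[OF A12(1) inv1] invariant_dichotomy[OF A12(2) inv2] by blast
  then show ?thesis
  proof cases
    case 1
    then show ?thesis by (intro disjI1 AE_I'[OF 1]) (auto simp: A1_def)
  next
    case 2
    then show ?thesis by (intro disjI2 AE_I'[OF 2]) (auto simp: A2_def)
  next
    case 3
    define A3 where "A3 = A - A1 - A2"
    \<comment> \<open>The first entry of \<open>f q\<close> if it is new, else the second. On
      \<open>A3\<close> the chosen entry is new: two distinct entries both taken from
      \<open>q\<close> would make \<open>f q\<close> equal to \<open>q\<close> or its flip.\<close>
    define c where "c = (\<lambda>q. if fst (f q) = fst q \<or> fst (f q) = snd q then snd (f q) else fst (f q))"
    have A3: "A3 \<in> sets \<mu>" using Am A12 by (auto simp: A3_def)
    have "(space \<mu> - A) \<union> (A1 \<union> A2) \<in> null_sets \<mu>" using Anull 3 by (intro null_sets.Un)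
    moreover have "space \<mu> - A3 = (space \<mu> - A) \<union> (A1 \<union> A2)"
      by (auto simp: A3_def A1_def A2_def)
    ultimately have A3n: "space \<mu> - A3 \<in> null_sets \<mu>" by simp
    have A3inv: "act2 K \<gamma> q \<in> A3" if \<gamma>: "\<gamma> \<in> \<Gamma>" and q: "q \<in> A3" for \<gamma> q
    proof -
      have qA: "q \<in> A" using q by (simp add: A3_def)
      have "q \<in> A1" if "act2 K \<gamma> q \<in> A1"
        using inv1[OF \<Gamma>_hinv[OF \<gamma>] that] act2_hinv(2)[OF \<Gamma>_isom[OF \<gamma>] subsetD[OF AB qA]] by simp
      moreover have "q \<in> A2" if "act2 K \<gamma> q \<in> A2"
        using inv2[OF \<Gamma>_hinv[OF \<gamma>] that] act2_hinv(2)[OF \<Gamma>_isom[OF \<gamma>] subsetD[OF AB qA]] by simp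
      ultimately show ?thesis using q Ainv[OF \<gamma> qA] unfolding A3_def by blast
    qed
    have fstm: "(\<lambda>q. fst (h q)) \<in> borel_measurable \<mu>" and sndm: "(\<lambda>q. snd (h q)) \<in> borel_measurable \<mu>"
      if "h \<in> borel_measurable \<mu>" for h :: "_ \<Rightarrow> (complex ^ 'n) \<times> (complex ^ 'n)"
      by (rule measurable_compose[OF that], rule borel_measurable_continuous_onI, rule continuous_on_fst[OF continuous_on_id])
        (rule measurable_compose[OF that], rule borel_measurable_continuous_onI, rule continuous_on_snd[OF continuous_on_id])
    have cm: "c \<in> borel_measurable \<mu>"
    proof -
      have "{q \<in> space \<mu>. fst (f q) = fst q \<or> fst (f q) = snd q} \<in> sets \<mu>"
      proof -
        have "{q \<in> space \<mu>. fst (f q) = fst q \<or> fst (f q) = snd q}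
            = {q \<in> space \<mu>. fst (f q) = fst q} \<union> {q \<in> space \<mu>. fst (f q) = snd q}" by blast
        then show ?thesis
          using sets.Un[OF sets_eq[OF fstm[OF fb] fstm[OF borel_id]] sets_eq[OF fstm[OF fb] sndm[OF borel_id]]]
          by (simp only:)
      qed
      then show ?thesis unfolding c_def by (intro measurable_If fstm sndm fb)
    qed
    have cb: "c q \<in> bdry K \<and> c q \<noteq> fst q \<and> c q \<noteq> snd q" if q: "q \<in> A3" for q
    proof -
      have "q \<in> bdry2 K" "f q \<noteq> q" "f q \<noteq> prod.swap q"
        using q AB by (auto simp: A3_def A1_def A2_def space_\<mu>)
      moreover from this have "f q \<in> bdry2 K" using fB by blast
      ultimately show ?thesis by (auto simp: c_def bdry2_def prod_eq_iff split: if_splits)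
    qed
    have ceq: "c (act2 K \<gamma> q) = bdry_act K \<gamma> (c q)" if \<gamma>: "\<gamma> \<in> \<Gamma>" and q: "q \<in> A3" for \<gamma> q
    proof -
      have qA: "q \<in> A" using q by (simp add: A3_def)
      then have qB: "q \<in> bdry2 K" using AB by blast
      have "fst (f q) \<in> bdry K" "fst q \<in> bdry K" "snd q \<in> bdry K"
        using qB fB[OF qB] by (auto simp: bdry2_def)
      moreover have "fst (act2 K \<gamma> p) = bdry_act K \<gamma> (fst p)" "snd (act2 K \<gamma> p) = bdry_act K \<gamma> (snd p)" for p
        by (simp_all add: act2_def)
      \<comment> \<open>The boundary action is injective, so the case distinction in
        \<open>c\<close> comes out the same at \<open>q\<close> and at its translate.\<close>
      ultimately show ?thesis
        by (simp add: c_def Aeq[OF \<gamma> qA] bdry_act_eq_iff[OF \<Gamma>_isom[OF \<gamma>]])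
    qed
    have False by (rule no_equivariant_third_point[OF A3 A3n A3inv cm cb ceq])
    then show ?thesis ..
  qed
qed

end

section \<open>The automorphism group and the normalizer\<close>

context hyp_field begin

abbreviation idB :: "(complex ^ 'n) \<times> (complex ^ 'n) \<Rightarrow> (complex ^ 'n) \<times> (complex ^ 'n)" where
  "idB \<equiv> \<lambda>x\<in>bdry2 K. x"

lemma act2_mult:
  "g \<in> carrier (Isom_plus K) \<Longrightarrow> h \<in> carrier (Isom_plus K) \<Longrightarrow> q \<in> bdry2 K \<Longrightarrow> act2 K (g \<otimes>\<^bsub>Isom_plus K\<^esub> h) q = act2 K g (act2 K h q)"
  by (simp add: mult_Isom_plus G_isom act2_compose)

lemma act2_inv:
  assumes "g \<in> carrier (Isom_plus K)" "q \<in> bdry2 K"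
  shows "act2 K (inv\<^bsub>Isom_plus K\<^esub> g) (act2 K g q) = q" "act2 K g (act2 K (inv\<^bsub>Isom_plus K\<^esub> g) q) = q"
  unfolding inv_Isom_plus[OF assms(1)] using assms by (simp_all add: act2_hinv G_isom)

lemma act2_G_bdry2: "g \<in> carrier (Isom_plus K) \<Longrightarrow> q \<in> bdry2 K \<Longrightarrow> act2 K g q \<in> bdry2 K"
  by (simp add: G_isom act2_bdry2)

lemma swap_neq: "q \<in> bdry2 K \<Longrightarrow> prod.swap q \<noteq> q"
  by (auto simp: bdry2_def)

lemma standard_pair: "(axis i 1, - axis i 1 :: complex ^ 'n) \<in> bdry2 K"
proof -
  have "(axis i 1 :: complex ^ 'n) $ i \<noteq> (- axis i 1 :: complex ^ 'n) $ i" by (simp add: axis_def)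
  then have "axis i 1 \<noteq> (- axis i 1 :: complex ^ 'n)" by metis
  then show ?thesis by (auto simp: bdry2_def bdry_iff axis_Kvec)
qed

text \<open>After moving \<open>q\<close> to the standard pair, its stabilizer contains a hyperbolic
  element whose only fixed boundary points are the two entries. Both the automorphisms and the
  normalizer are computed from this.\<close>

lemma common_fixed_pair:
  fixes i j :: "'n::finite"
  assumes ij: "K = UNIV \<or> i \<noteq> j" and q: "q \<in> bdry2 K" and r: "r \<in> (bdry2 K :: ((complex ^ 'n) \<times> (complex ^ 'n)) set)"
    and fixr: "\<And>h. h \<in> carrier (Isom_plus K) \<Longrightarrow> act2 K h q = q \<Longrightarrow> act2 K h r = r"
  shows "r = q \<or> r = prod.swap q"
proof -
  define e where "e = (axis i 1 :: complex ^ 'n)"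
  have e: "e \<in> bdry K" "- e \<in> bdry K" by (auto simp: e_def bdry_iff axis_Kvec)
  obtain g where g: "g \<in> carrier (Isom_plus K)" "act2 K g (fst q, snd q) = (e, - e)"
    unfolding e_def by (rule transitive_standard[of "fst q" "snd q" i j, OF _ ij]) (use q in auto)
  obtain t where t: "t \<in> carrier (Isom_plus K)" "\<And>\<xi>. \<xi> \<in> bdry K \<Longrightarrow> bdry_act K t \<xi> = \<xi> \<longleftrightarrow> \<xi> = e \<or> \<xi> = - e"
    by (rule hyperbolic_element[OF e(1)]) blast
  have gq: "act2 K g q = (e, - e)" using g(2) by simp
  have gr: "act2 K g r \<in> bdry2 K" by (rule act2_G_bdry2[OF g(1) r])
  interpret G: group "Isom_plus K :: (complex ^ 'n \<Rightarrow> complex ^ 'n) monoid"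
    by (rule group_Isom_plus)
  define h where "h = inv\<^bsub>Isom_plus K\<^esub> g \<otimes>\<^bsub>Isom_plus K\<^esub> (t \<otimes>\<^bsub>Isom_plus K\<^esub> g)"
  have hG: "h \<in> carrier (Isom_plus K)" using g t by (simp add: h_def)
  have hact: "act2 K h s = act2 K (inv\<^bsub>Isom_plus K\<^esub> g) (act2 K t (act2 K g s))" if "s \<in> bdry2 K" for s
    unfolding h_def using g(1) t(1) that by (simp add: act2_mult act2_G_bdry2)
  have "act2 K t (e, - e) = (e, - e)" using t(2) e by (simp add: act2_def)
  then have "act2 K h q = q" by (simp add: hact[OF q] gq) (simp add: act2_inv(1)[OF g(1) q] flip: gq)
  then have "act2 K h r = r" by (rule fixr[OF hG])
  then have "act2 K g (act2 K h r) = act2 K g r" by simp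
  then have "act2 K t (act2 K g r) = act2 K g r"
    unfolding hact[OF r] by (simp add: act2_inv(2)[OF g(1) act2_G_bdry2[OF t(1) gr]])
  then have "act2 K g r = (e, - e) \<or> act2 K g r = (- e, e)"
    using gr t(2)[of "fst (act2 K g r)"] t(2)[of "snd (act2 K g r)"]
    by (auto simp: act2_def[of K t] bdry2_def prod_eq_iff map_prod_def case_prod_beta)
  then have "act2 K g r = act2 K g q \<or> act2 K g r = act2 K g (prod.swap q)"
    by (simp add: act2_swap gq)
  then show ?thesis
    using act2_inv(1)[OF g(1) r] act2_inv(1)[OF g(1) q] act2_inv(1)[OF g(1) bdry2_swap[OF q]] by metis
qed

lemma flip_swap: "q \<in> bdry2 K \<Longrightarrow> flip K q = prod.swap q"
  by (simp add: flip_def case_prod_beta prod.swap_def)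

text \<open>
  The dimension of \<open>Aut_eq K\<close> in the last two conjuncts of the theorem is a type variable of its own,
  unrelated to \<open>'n\<close>.  Hence dimension one has to be treated as well, where for \<open>K = \<real>\<close> the group is
  not transitive on pairs.
\<close>

lemma bdry2_dim1:
  fixes i :: "'n::finite"
  assumes KR: "K = \<real>" and one: "\<And>j :: 'n. j = i" and q: "q \<in> bdry2 K"
    and r: "r \<in> (bdry2 K :: ((complex ^ 'n) \<times> (complex ^ 'n)) set)"
  shows "r = q \<or> r = prod.swap q"
proof -
  have U: "(UNIV :: 'n set) = {i}" using one by blast
  have ax: "x = axis i 1 \<or> x = - axis i 1" if x: "x \<in> bdry K" for x :: "complex ^ 'n"
  proof -
    have "x $ i \<in> \<real>" "cmod (x $ i) = 1" using x KR by (auto simp: bdry_iff Kvec_def norm_vec_def U)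
    then have "x $ i = 1 \<or> x $ i = - 1" by (auto elim!: Reals_cases simp: abs_if split: if_splits)
    moreover have "y = z \<longleftrightarrow> y $ i = z $ i" for y z :: "complex ^ 'n"
      using one by (auto simp: vec_eq_iff) metis
    ultimately show ?thesis by simp
  qed
  have "fst q \<in> bdry K" "snd q \<in> bdry K" "fst q \<noteq> snd q" "fst r \<in> bdry K" "snd r \<in> bdry K" "fst r \<noteq> snd r"
    using q r by (auto simp: bdry2_def)
  then show ?thesis
    using ax[of "fst q"] ax[of "snd q"] ax[of "fst r"] ax[of "snd r"] by (auto simp: prod_eq_iff)
qed

lemma flip_Bij: "flip K \<in> Bij (bdry2 K :: ((complex ^ 'n) \<times> (complex ^ 'n)) set)"
proof -
  have "bij_betw (flip K) (bdry2 K :: ((complex ^ 'n) \<times> (complex ^ 'n)) set) (bdry2 K)"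
    by (rule bij_betw_byWitness[of _ "flip K"]) (auto simp: flip_swap bdry2_swap simp del: swap_simp split_paired_All)
  moreover have "flip K \<in> extensional (bdry2 K)" by (simp add: flip_def)
  ultimately show ?thesis by (simp add: Bij_def)
qed

text \<open>With a transitive group, an equivariant map is determined by its value at one pair, and
  that value is fixed by the stabilizer of the pair.\<close>

lemma carrier_Aut_eq:
  "carrier (Aut_eq K) = {idB, flip K :: (complex ^ 'n) \<times> (complex ^ 'n) \<Rightarrow> (complex ^ 'n) \<times> (complex ^ 'n)}"
proof
  show "{idB, flip K :: (complex ^ 'n) \<times> (complex ^ 'n) \<Rightarrow> (complex ^ 'n) \<times> (complex ^ 'n)} \<subseteq> carrier (Aut_eq K)"
    using flip_Bij by (simp add: Aut_eq_def id_Bij act2_G_bdry2 flip_swap act2_swap)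
  show "carrier (Aut_eq K) \<subseteq> {idB, flip K :: (complex ^ 'n) \<times> (complex ^ 'n) \<Rightarrow> (complex ^ 'n) \<times> (complex ^ 'n)}"
  proof
    fix \<phi> :: "(complex ^ 'n) \<times> (complex ^ 'n) \<Rightarrow> (complex ^ 'n) \<times> (complex ^ 'n)"
    assume "\<phi> \<in> carrier (Aut_eq K)"
    then have B: "\<phi> \<in> Bij (bdry2 K)"
      and eq: "\<And>g x. g \<in> carrier (Isom_plus K) \<Longrightarrow> x \<in> bdry2 K \<Longrightarrow> \<phi> (act2 K g x) = act2 K g (\<phi> x)"
      by (simp_all add: Aut_eq_def)
    fix i :: 'n
    define q where "q = (axis i 1 :: complex ^ 'n, - axis i 1 :: complex ^ 'n)"
    have q: "q \<in> bdry2 K" unfolding q_def by (rule standard_pair)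
    have \<phi>q: "\<phi> q \<in> bdry2 K" using Bij_imp_funcset[OF B] q by (rule funcset_mem)
    have inj: "inj_on \<phi> (bdry2 K)" using B by (simp add: Bij_def bij_betw_def)
    have main: "(\<phi> q = q \<longrightarrow> (\<forall>r\<in>bdry2 K. \<phi> r = r)) \<and> (\<phi> q = prod.swap q \<longrightarrow> (\<forall>r\<in>bdry2 K. \<phi> r = prod.swap r)) \<and>
        (\<phi> q = q \<or> \<phi> q = prod.swap q)"
    proof (cases "\<exists>j. K = UNIV \<or> i \<noteq> j")
      case True
      then obtain j where ij: "K = UNIV \<or> i \<noteq> j" by blast
      have "\<phi> q = q \<or> \<phi> q = prod.swap q"
      proof (rule common_fixed_pair[OF ij q \<phi>q])
        show "act2 K h (\<phi> q) = \<phi> q" if "h \<in> carrier (Isom_plus K)" "act2 K h q = q" for h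
          using eq[OF that(1) q] that(2) by simp
      qed
      moreover have tr: "\<exists>g\<in>carrier (Isom_plus K). act2 K g q = r \<and> act2 K g (\<phi> q) = \<phi> r" if r: "r \<in> bdry2 K" for r
      proof -
        obtain g where g: "g \<in> carrier (Isom_plus K)" "act2 K g q = r"
          by (rule act2_transitive[OF q r ij])
        then show ?thesis using eq[OF g(1) q] by auto
      qed
      ultimately show ?thesis using act2_swap by metis
    next
      case False
      \<comment> \<open>Now there are only two pairs, so bijectivity alone decides.\<close>
      then have KR: "K = \<real>" and one: "\<And>j. j = i" using K by auto
      have two: "r = q \<or> r = prod.swap q" if "r \<in> bdry2 K" for r
        by (rule bdry2_dim1[OF KR one q that])
      have sq: "prod.swap q \<in> bdry2 K" by (rule bdry2_swap[OF q])
      have "\<phi> (prod.swap q) \<in> bdry2 K" using Bij_imp_funcset[OF B] sq by (rule funcset_mem)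
      moreover have "\<phi> (prod.swap q) \<noteq> \<phi> q" using inj_onD[OF inj _ sq q] swap_neq[OF q] by blast
      ultimately show ?thesis using two two[OF \<phi>q] two[of "\<phi> (prod.swap q)"] swap_swap by metis
    qed
    have ext: "\<phi> \<in> extensional (bdry2 K)" by (rule Bij_imp_extensional[OF B])
    from main consider "\<forall>r\<in>bdry2 K. \<phi> r = r" | "\<forall>r\<in>bdry2 K. \<phi> r = prod.swap r" by blast
    then show "\<phi> \<in> {idB, flip K}"
    proof cases
      case 1
      have "\<phi> = idB"
      proof (rule extensionalityI[OF ext])
        fix r :: "(complex ^ 'n) \<times> (complex ^ 'n)" assume r: "r \<in> bdry2 K"
        then show "\<phi> r = idB r" using 1 by simp
      qed simp
      then show ?thesis by simp
    next
      case 2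
      have "\<phi> = flip K"
      proof (rule extensionalityI[OF ext])
        fix r :: "(complex ^ 'n) \<times> (complex ^ 'n)" assume r: "r \<in> bdry2 K"
        then show "\<phi> r = flip K r" using 2 flip_swap[OF r] by simp
      qed (simp add: flip_def)
      then show ?thesis by simp
    qed
  qed
qed

lemma one_Aut_eq: "\<one>\<^bsub>Aut_eq K\<^esub> = idB"
  by (simp add: Aut_eq_def BijGroup_def)

lemma idB_neq_flip: "idB \<noteq> (flip K :: (complex ^ 'n) \<times> (complex ^ 'n) \<Rightarrow> (complex ^ 'n) \<times> (complex ^ 'n))"
proof
  fix i :: 'n
  assume "idB = (flip K :: (complex ^ 'n) \<times> (complex ^ 'n) \<Rightarrow> (complex ^ 'n) \<times> (complex ^ 'n))"
  from fun_cong[OF this, of "(axis i 1, - axis i 1)"]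
  show False using flip_swap[OF standard_pair[of i]] swap_neq[OF standard_pair[of i]] standard_pair[of i] by simp
qed

lemma mult_Aut_eq:
  "idB \<otimes>\<^bsub>Aut_eq K\<^esub> idB = idB" "idB \<otimes>\<^bsub>Aut_eq K\<^esub> flip K = flip K"
  "flip K \<otimes>\<^bsub>Aut_eq K\<^esub> idB = flip K" "flip K \<otimes>\<^bsub>Aut_eq K\<^esub> flip K = idB"
  by (simp_all add: Aut_eq_def BijGroup_def id_Bij flip_Bij,
      rule_tac [!] extensionalityI[of _ "bdry2 K"])
     (simp_all add: compose_def flip_swap bdry2_swap, simp_all add: flip_def)

lemma group_Aut_eq: "group (Aut_eq K :: ((complex ^ 'n) \<times> (complex ^ 'n) \<Rightarrow> (complex ^ 'n) \<times> (complex ^ 'n)) monoid)"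
  by (rule groupI) (auto simp: carrier_Aut_eq one_Aut_eq mult_Aut_eq)

text \<open>If \<open>g\<close> normalizes \<open>A\<close>, then \<open>A\<close> fixes
  \<open>act2 K g p\<close>, and \<open>common_fixed_pair\<close> applies. Conversely, the flip
  commutes with the action, so \<open>p\<close> and its flip have the same stabilizer.\<close>

lemma normalizer_stabilizer:
  fixes i j :: "'n::finite" and p :: "(complex ^ 'n) \<times> (complex ^ 'n)"
  assumes ij: "K = UNIV \<or> i \<noteq> j"
    and p: "p \<in> bdry2 K" and A: "A = stabilizer (Isom_plus K) (act2 K) p"
  shows "g \<in> normalizer (Isom_plus K) A \<longleftrightarrow> g \<in> carrier (Isom_plus K) \<and> (act2 K g p = p \<or> act2 K g p = prod.swap p)"
proof -
  interpret G: group "Isom_plus K :: (complex ^ 'n \<Rightarrow> complex ^ 'n) monoid"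
    by (rule group_Isom_plus)
  have memA: "a \<in> A \<longleftrightarrow> a \<in> carrier (Isom_plus K) \<and> act2 K a p = p" for a by (simp add: A stabilizer_def)
  have AG: "A \<subseteq> carrier (Isom_plus K)" using memA by blast
  have norm: "g \<in> normalizer (Isom_plus K) A \<longleftrightarrow> g \<in> carrier (Isom_plus K) \<and> g <#\<^bsub>Isom_plus K\<^esub> A #>\<^bsub>Isom_plus K\<^esub> inv\<^bsub>Isom_plus K\<^esub> g = A"
    using AG by (simp add: normalizer_def stabilizer_def[of "Isom_plus K" "\<lambda>g. \<lambda>H\<in>{H. H \<subseteq> carrier (Isom_plus K)}. g <#\<^bsub>Isom_plus K\<^esub> H #>\<^bsub>Isom_plus K\<^esub> inv\<^bsub>Isom_plus K\<^esub> g"])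
  have conj: "g <#\<^bsub>Isom_plus K\<^esub> A #>\<^bsub>Isom_plus K\<^esub> inv\<^bsub>Isom_plus K\<^esub> g = {g \<otimes>\<^bsub>Isom_plus K\<^esub> a \<otimes>\<^bsub>Isom_plus K\<^esub> inv\<^bsub>Isom_plus K\<^esub> g |a. a \<in> A}"
    by (auto simp: l_coset_def r_coset_def)
  show ?thesis
  proof
    assume "g \<in> normalizer (Isom_plus K) A"
    then have g: "g \<in> carrier (Isom_plus K)" and eq: "{g \<otimes>\<^bsub>Isom_plus K\<^esub> a \<otimes>\<^bsub>Isom_plus K\<^esub> inv\<^bsub>Isom_plus K\<^esub> g |a. a \<in> A} = A"
      using norm conj by auto
    have gp: "act2 K g p \<in> bdry2 K" by (rule act2_G_bdry2[OF g p])
    have "act2 K g p = p \<or> act2 K g p = prod.swap p"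
    proof (rule common_fixed_pair[OF ij p gp])
      fix h assume "h \<in> carrier (Isom_plus K)" "act2 K h p = p"
      then have "h \<in> A" using memA by blast
      then obtain a where a: "a \<in> A" "h = g \<otimes>\<^bsub>Isom_plus K\<^esub> a \<otimes>\<^bsub>Isom_plus K\<^esub> inv\<^bsub>Isom_plus K\<^esub> g" using eq by blast
      have aG: "a \<in> carrier (Isom_plus K)" "act2 K a p = p" using a(1) memA by auto
      show "act2 K h (act2 K g p) = act2 K g p"
        unfolding a(2) using g aG p gp by (simp add: act2_mult act2_inv act2_G_bdry2)
    qed
    then show "g \<in> carrier (Isom_plus K) \<and> (act2 K g p = p \<or> act2 K g p = prod.swap p)" using g by blast
  next
    assume "g \<in> carrier (Isom_plus K) \<and> (act2 K g p = p \<or> act2 K g p = prod.swap p)"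
    then have g: "g \<in> carrier (Isom_plus K)" and gp: "act2 K g p = p \<or> act2 K g p = prod.swap p" by auto
    define g' where "g' = inv\<^bsub>Isom_plus K\<^esub> g"
    have g': "g' \<in> carrier (Isom_plus K)" using g by (simp add: g'_def)
    have g'p: "act2 K g' p = p \<or> act2 K g' p = prod.swap p"
      using gp act2_inv(1)[OF g p] act2_swap[of g' p] act2_inv(1)[OF g bdry2_swap[OF p]] act2_swap[of g p]
      unfolding g'_def by (metis swap_swap)
    have conjA: "h \<otimes>\<^bsub>Isom_plus K\<^esub> a \<otimes>\<^bsub>Isom_plus K\<^esub> h' \<in> A"
      if h: "h \<in> carrier (Isom_plus K)" "h' \<in> carrier (Isom_plus K)" "\<And>q. q \<in> bdry2 K \<Longrightarrow> act2 K h (act2 K h' q) = q"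
        "act2 K h' p = p \<or> act2 K h' p = prod.swap p" and a: "a \<in> A" for h h' a
    proof -
      have aG: "a \<in> carrier (Isom_plus K)" "act2 K a p = p" using a memA by auto
      have "act2 K a (act2 K h' p) = act2 K h' p" using h(4) aG act2_swap[of a p] by auto
      then have "act2 K (h \<otimes>\<^bsub>Isom_plus K\<^esub> a \<otimes>\<^bsub>Isom_plus K\<^esub> h') p = p"
        using h(1,2) h(3)[OF p] aG p by (simp add: act2_mult act2_G_bdry2)
      then show ?thesis using h aG memA by simp
    qed
    have "g <#\<^bsub>Isom_plus K\<^esub> A #>\<^bsub>Isom_plus K\<^esub> inv\<^bsub>Isom_plus K\<^esub> g = A"
    proof
      show "g <#\<^bsub>Isom_plus K\<^esub> A #>\<^bsub>Isom_plus K\<^esub> inv\<^bsub>Isom_plus K\<^esub> g \<subseteq> A"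
        unfolding conj using conjA[OF g g' _ g'p] act2_inv(2)[OF g] by (auto simp: g'_def)
      show "A \<subseteq> g <#\<^bsub>Isom_plus K\<^esub> A #>\<^bsub>Isom_plus K\<^esub> inv\<^bsub>Isom_plus K\<^esub> g"
      proof
        fix a assume a: "a \<in> A"
        then have aG: "a \<in> carrier (Isom_plus K)" using AG by blast
        have "g' \<otimes>\<^bsub>Isom_plus K\<^esub> a \<otimes>\<^bsub>Isom_plus K\<^esub> g \<in> A"
          using conjA[OF g' g _ gp a] act2_inv(1)[OF g] by (simp add: g'_def)
        moreover have "a = g \<otimes>\<^bsub>Isom_plus K\<^esub> (g' \<otimes>\<^bsub>Isom_plus K\<^esub> a \<otimes>\<^bsub>Isom_plus K\<^esub> g) \<otimes>\<^bsub>Isom_plus K\<^esub> g'"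
        proof -
          have "g \<otimes>\<^bsub>Isom_plus K\<^esub> (g' \<otimes>\<^bsub>Isom_plus K\<^esub> a \<otimes>\<^bsub>Isom_plus K\<^esub> g) \<otimes>\<^bsub>Isom_plus K\<^esub> g' = (g \<otimes>\<^bsub>Isom_plus K\<^esub> g') \<otimes>\<^bsub>Isom_plus K\<^esub> a \<otimes>\<^bsub>Isom_plus K\<^esub> (g \<otimes>\<^bsub>Isom_plus K\<^esub> g')"
            using g g' aG by (simp add: G.m_assoc)
          then show ?thesis using g aG by (simp add: g'_def)
        qed
        ultimately show "a \<in> g <#\<^bsub>Isom_plus K\<^esub> A #>\<^bsub>Isom_plus K\<^esub> inv\<^bsub>Isom_plus K\<^esub> g"
          unfolding conj g'_def by blast
      qed
    qed
    then show "g \<in> normalizer (Isom_plus K) A" using norm g by blast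
  qed
qed

text \<open>The first isomorphism theorem for the map recording whether an element of
  \<open>N\<close> fixes or flips \<open>p\<close>. Its kernel is \<open>A\<close>, and it is onto
  because transitivity provides an element that flips \<open>p\<close>.\<close>

lemma Aut_iso_normalizer_quotient:
  fixes i j :: "'n::finite" and p :: "(complex ^ 'n) \<times> (complex ^ 'n)"
  assumes ij: "K = UNIV \<or> i \<noteq> j"
    and p: "p \<in> bdry2 K" and A: "A = stabilizer (Isom_plus K) (act2 K) p" and N: "N = normalizer (Isom_plus K) A"
  shows "(Aut_eq K :: ((complex ^ 'm) \<times> (complex ^ 'm) \<Rightarrow> (complex ^ 'm) \<times> (complex ^ 'm)) monoid) \<cong> ((Isom_plus K)\<lparr>carrier := N\<rparr>) Mod A"
proof -
  interpret G: group "Isom_plus K :: (complex ^ 'n \<Rightarrow> complex ^ 'n) monoid"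
    by (rule group_Isom_plus)
  have memA: "a \<in> A \<longleftrightarrow> a \<in> carrier (Isom_plus K) \<and> act2 K a p = p" for a by (simp add: A stabilizer_def)
  have memN: "g \<in> N \<longleftrightarrow> g \<in> carrier (Isom_plus K) \<and> (act2 K g p = p \<or> act2 K g p = prod.swap p)" for g
    unfolding N by (rule normalizer_stabilizer[OF ij p A])
  have "subgroup N (Isom_plus K)" unfolding N by (rule G.normalizer_imp_subgroup) (use memA in blast)
  then have gN: "group ((Isom_plus K)\<lparr>carrier := N\<rparr>)" by (rule subgroup.subgroup_is_group) (rule group_Isom_plus)
  define \<Psi> :: "(complex ^ 'n \<Rightarrow> complex ^ 'n) \<Rightarrow> (complex ^ 'm) \<times> (complex ^ 'm) \<Rightarrow> (complex ^ 'm) \<times> (complex ^ 'm)"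
    where "\<Psi> = (\<lambda>g. if act2 K g p = p then idB else flip K)"
  have sp: "prod.swap p \<noteq> p" by (rule swap_neq[OF p])
  have "\<Psi> \<in> hom ((Isom_plus K)\<lparr>carrier := N\<rparr>) (Aut_eq K)"
  proof (rule homI)
    show "\<Psi> g \<in> carrier (Aut_eq K)" for g by (simp add: \<Psi>_def carrier_Aut_eq)
    fix g h assume "g \<in> carrier ((Isom_plus K)\<lparr>carrier := N\<rparr>)" "h \<in> carrier ((Isom_plus K)\<lparr>carrier := N\<rparr>)"
    then have g: "g \<in> carrier (Isom_plus K)" "act2 K g p = p \<or> act2 K g p = prod.swap p"
      and h: "h \<in> carrier (Isom_plus K)" "act2 K h p = p \<or> act2 K h p = prod.swap p" using memN by auto
    have "act2 K (g \<otimes>\<^bsub>Isom_plus K\<^esub> h) p = act2 K g (act2 K h p)" by (rule act2_mult[OF g(1) h(1) p])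
    then show "\<Psi> (g \<otimes>\<^bsub>(Isom_plus K)\<lparr>carrier := N\<rparr>\<^esub> h) = \<Psi> g \<otimes>\<^bsub>Aut_eq K\<^esub> \<Psi> h"
      using g(2) h(2) sp act2_swap[of g p] by (auto simp: \<Psi>_def mult_Aut_eq simp del: swap_simp)
  qed
  then interpret \<Psi>: group_hom "(Isom_plus K)\<lparr>carrier := N\<rparr>" "Aut_eq K" \<Psi>
    using gN group_Aut_eq by (simp add: group_hom_def group_hom_axioms_def)
  have ker: "kernel ((Isom_plus K)\<lparr>carrier := N\<rparr>) (Aut_eq K) \<Psi> = A"
    using memA memN idB_neq_flip[where 'n = 'm] by (auto simp: kernel_def \<Psi>_def one_Aut_eq split: if_splits)
  obtain s where s: "s \<in> carrier (Isom_plus K)" "act2 K s p = prod.swap p"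
    by (rule act2_transitive[OF p bdry2_swap[OF p] ij])
  have one: "act2 K \<one>\<^bsub>Isom_plus K\<^esub> p = p" by (simp add: one_Isom_plus act2_id[OF p])
  have "\<one>\<^bsub>Isom_plus K\<^esub> \<in> N" "s \<in> N" using s one unfolding memN by simp_all
  moreover have "\<Psi> \<one>\<^bsub>Isom_plus K\<^esub> = idB" "\<Psi> s = flip K"
    using s sp one by (simp_all add: \<Psi>_def)
  ultimately have "idB \<in> \<Psi> ` N" "flip K \<in> \<Psi> ` N" by (auto intro: rev_image_eqI simp del: split_paired_All)
  then have "\<Psi> ` carrier ((Isom_plus K)\<lparr>carrier := N\<rparr>) = carrier (Aut_eq K)"
    unfolding carrier_Aut_eq by (auto simp: \<Psi>_def)
  then have "((Isom_plus K)\<lparr>carrier := N\<rparr>) Mod A \<cong>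
      (Aut_eq K :: ((complex ^ 'm) \<times> (complex ^ 'm) \<Rightarrow> (complex ^ 'm) \<times> (complex ^ 'm)) monoid)"
    using \<Psi>.FactGroup_iso ker by simp
  moreover have "group (((Isom_plus K)\<lparr>carrier := N\<rparr>) Mod A)"
    using normal.factorgroup_is_group[OF \<Psi>.normal_kernel] ker by simp
  ultimately show ?thesis by (rule group.iso_sym[rotated])
qed

end

section \<open>Classes of equivariant maps modulo null sets\<close>

context ergodic_group begin

lemma ae_class_cong:
  assumes "AE x in \<mu>. f x = g x"
  shows "ae_class \<mu> f = ae_class \<mu> g"
proof -
  have "(AE x in \<mu>. h x = f x) \<longleftrightarrow> (AE x in \<mu>. h x = g x)" for h :: "_ \<Rightarrow> (complex ^ 'n) \<times> (complex ^ 'n)"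
    using assms by (auto elim!: AE_mp)
  then show ?thesis unfolding ae_class_def by blast
qed

lemma idB_measurable: "idB \<in> \<mu> \<rightarrow>\<^sub>M \<mu>"
  by (subst measurable_cong[of _ _ "\<lambda>x. x"]) (simp_all add: space_\<mu> measurable_ident_sets)

lemma flip_measurable: "flip K \<in> \<mu> \<rightarrow>\<^sub>M \<mu>"
proof -
  have "prod.swap \<in> \<mu> \<rightarrow>\<^sub>M \<mu>"
    unfolding prod.swap_def
    by (intro iffD2[OF measurable_restrict_target] conjI borel_continuous continuous_intros)
       (auto simp: bdry2_def)
  then show ?thesis
    by (subst measurable_cong[of _ _ prod.swap]) (simp_all add: space_\<mu> flip_swap)
qed

text \<open>The description is the same for every \<open>L\<close> between \<open>\<Gamma>\<close>
  and the full group; taking the two extremes gives the rigidity statement.\<close>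

lemma Map_eq_between:
  assumes L: "\<Gamma> \<subseteq> L" "L \<subseteq> carrier (Isom_plus K)"
  shows "Map_eq K \<mu> L = {ae_class \<mu> idB, ae_class \<mu> (flip K)}"
proof
  have eqv: "AE x in \<mu>. \<phi> (act2 K g x) = act2 K g (\<phi> x)"
    if "g \<in> L" "\<phi> = idB \<or> \<phi> = flip K" for g \<phi>
  proof (rule AE_I2)
    fix x assume "x \<in> space \<mu>"
    then have "x \<in> bdry2 K" by (simp add: space_\<mu>)
    moreover from this have "act2 K g x \<in> bdry2 K" using that(1) L(2) act2_G_bdry2 by blast
    ultimately show "\<phi> (act2 K g x) = act2 K g (\<phi> x)"
      using that(2) by (auto simp: flip_swap act2_swap simp del: swap_simp)
  qed
  show "{ae_class \<mu> idB, ae_class \<mu> (flip K)} \<subseteq> Map_eq K \<mu> L"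
    unfolding Map_eq_def using eqv idB_measurable flip_measurable by blast
  show "Map_eq K \<mu> L \<subseteq> {ae_class \<mu> idB, ae_class \<mu> (flip K)}"
  proof
    fix c assume "c \<in> Map_eq K \<mu> L"
    then obtain f where f: "c = ae_class \<mu> f" "f \<in> \<mu> \<rightarrow>\<^sub>M \<mu>"
      "\<And>g. g \<in> L \<Longrightarrow> AE x in \<mu>. f (act2 K g x) = act2 K g (f x)"
      unfolding Map_eq_def by blast
    have "AE q in \<mu>. f (act2 K \<gamma> q) = act2 K \<gamma> (f q)" if "\<gamma> \<in> \<Gamma>" for \<gamma>
      using f(3) L(1) that by blast
    from equivariant_map_cases[OF f(2) this]
    show "c \<in> {ae_class \<mu> idB, ae_class \<mu> (flip K)}"
    proof
      assume a: "AE q in \<mu>. f q = q"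
      have "AE q in \<mu>. f q = idB q"
        using a by (rule AE_mp) (auto simp: space_\<mu> intro!: AE_I2)
      then show ?thesis unfolding f(1) by (simp add: ae_class_cong)
    next
      assume a: "AE q in \<mu>. f q = prod.swap q"
      have "AE q in \<mu>. f q = flip K q"
        using a by (rule AE_mp) (auto simp: space_\<mu> flip_swap intro!: AE_I2)
      then show ?thesis unfolding f(1) by (simp add: ae_class_cong)
    qed
  qed
qed

text \<open>Identity and flip differ at every pair, and the whole space is not null.\<close>

lemma inj_on_ae_class: "inj_on (ae_class \<mu>) {idB, flip K}"
proof -
  have "ae_class \<mu> idB \<noteq> ae_class \<mu> (flip K)"
  proof
    assume "ae_class \<mu> idB = ae_class \<mu> (flip K)"
    moreover have "idB \<in> ae_class \<mu> idB" using idB_measurable by (simp add: ae_class_def)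
    ultimately have "AE x in \<mu>. idB x = flip K x" by (simp add: ae_class_def)
    then obtain S where S: "{x \<in> space \<mu>. \<not> idB x = flip K x} \<subseteq> S" "emeasure \<mu> S = 0" "S \<in> sets \<mu>"
      by (rule AE_E)
    have "idB q \<noteq> flip K q" if "q \<in> bdry2 K" for q :: "(complex ^ 'n) \<times> (complex ^ 'n)"
      using that swap_neq[OF that] flip_swap[OF that] by simp
    then have "space \<mu> \<subseteq> S" using S(1) unfolding space_\<mu> by blast
    then have "space \<mu> \<in> null_sets \<mu>"
      using null_sets_subset[OF null_setsI[OF S(2,3)] sets.top] by blast
    then show False using space_not_null by blast
  qed
  then show ?thesis by (simp add: inj_on_def)
qed

lemma bij_betw_Aut_Map: "bij_betw (ae_class \<mu>) (carrier (Aut_eq K)) (Map_eq K \<mu> (carrier (Isom_plus K)))"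
proof -
  have "Map_eq K \<mu> (carrier (Isom_plus K)) = ae_class \<mu> ` {idB, flip K}"
    using Map_eq_between[OF subgroup.subset[OF sub] subset_refl] by simp
  then show ?thesis unfolding bij_betw_def carrier_Aut_eq using inj_on_ae_class by simp
qed

end

theorem theorem1p9:
  fixes K :: "complex set"
    and G :: "(complex ^ 'n \<Rightarrow> complex ^ 'n) monoid"
    and \<Gamma> A N :: "(complex ^ 'n \<Rightarrow> complex ^ 'n) set"
    and \<mu> :: "((complex ^ 'n) \<times> (complex ^ 'n)) measure"
    and p :: "(complex ^ 'n) \<times> (complex ^ 'n)"
  assumes K: "K = \<real> \<or> K = UNIV"
    and n: "CARD('n) \<ge> 2"
    and G: "G = Isom_plus K"
    and \<mu>: "invariant_class K \<mu>"
    and p: "p \<in> bdry2 K"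
    and A: "A = stabilizer G (act2 K) p"
    and N: "N = normalizer G A"
    and \<Gamma>: "subgroup \<Gamma> G" "discrete_isometries K \<Gamma>" "ergodic_on K \<Gamma> \<mu>"
  shows "Map_eq K \<mu> \<Gamma> = Map_eq K \<mu> (carrier G) \<and>
         bij_betw (ae_class \<mu>) (carrier (Aut_eq K)) (Map_eq K \<mu> (carrier G)) \<and>
         Aut_eq K \<cong> (G\<lparr>carrier := N\<rparr>) Mod A \<and>
         carrier (Aut_eq K) = {\<one>\<^bsub>Aut_eq K\<^esub>, flip K}"
proof -
  obtain i j :: 'n where ij: "i \<noteq> j"
    using n card_le_Suc0_iff_eq[of "UNIV :: 'n set"] by auto
  interpret ergodic_group K \<Gamma> \<mu> i j
    by (intro ergodic_group.intro discrete_group.intro hyp_field.intro discrete_group_axioms.intro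
        ergodic_group_axioms.intro K \<mu> \<Gamma>(1)[unfolded G] \<Gamma>(2,3) ij)
  have "\<Gamma> \<subseteq> carrier G" using \<Gamma>(1) by (rule subgroup.subset)
  then have "Map_eq K \<mu> \<Gamma> = Map_eq K \<mu> (carrier (Isom_plus K))"
    unfolding G using Map_eq_between[of \<Gamma>] Map_eq_between[of "carrier (Isom_plus K)"] by simp
  then show ?thesis
    unfolding G one_Aut_eq
    by (intro conjI bij_betw_Aut_Map carrier_Aut_eq
        Aut_iso_normalizer_quotient[OF disjI2[OF ij] p A[unfolded G] N[unfolded G]])
qed

end
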